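(* Fix $\varepsilon\in(0,\frac1{10})$. Let $x$ be large, and let $\alpha\in[0,1)$ be such that there exist coprime integers $a$ and $q$ with $$\Big|\alpha-\frac aq\Big|\le\frac1{qx},\qquad (\log x)^{2+\varepsilon}\le q\le\frac{x}{(\log x)^{2+\varepsilon}},\qquad q\le x^{1/2-\varepsilon}.$$ Then, uniformly for all multiplicative functions $f:\mathbb{N}\to\mathbb{U}$, we have $$\sum_{q^2<n\le x}\frac{f(n)}n e(n\alpha)=\sum_{m\le M}\frac{f(m)}m\sum_{q^2<p\le x/m}\frac{f(p)}p e(mp\alpha)+O(1),$$ where $M=(\log\log x)^3$.
   Context: $\mathbb{U}=\{z\in\mathbb{C}:|z|\le1\}$ and $e(t)=\exp(2\pi i t)$. The letter $p$ denotes primes. The implied constant depends at most on $\varepsilon$. *)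

theory Defs
  imports "HOL-Analysis.Analysis" "HOL-Computational_Algebra.Primes"
begin

definition e :: "real \<Rightarrow> complex" where
  "e t = exp (2 * of_real pi * \<i> * of_real t)"

definition unit_disc :: "complex set" where
  "unit_disc = {z. norm z \<le> 1}"

(* Arithmetic functions live on the positive integers; the value at 0 is unconstrained and is
   never used. *)
definition multiplicative :: "(nat \<Rightarrow> complex) \<Rightarrow> bool" where
  "multiplicative f \<longleftrightarrow>
     f 1 = 1 \<and> (\<forall>m n. m > 0 \<longrightarrow> n > 0 \<longrightarrow> coprime m n \<longrightarrow> f (m * n) = f m * f n)"

end

theory Submission
  imports Defs
    "HOL-Number_Theory.Totient"
    "HOL-Number_Theory.Cong"
    "HOL-Computational_Algebra.Squarefree"
    "HOL-Analysis.Harmonic_Numbers"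
    "HOL-Real_Asymp.Real_Asymp"
begin

text \<open>
Write \<open>L = ln x\<close> and \<open>M = (ln ln x)^3\<close>.  Since \<open>\<alpha>\<close> differs from \<open>a/q\<close> by at most \<open>1/(qx)\<close>,
replacing \<open>\<alpha>\<close> by \<open>a/q\<close> changes \<open>e(n\<alpha>)\<close> by \<open>O(n/(qx))\<close>, and after division by \<open>n\<close> and
summation this costs only \<open>O(1)\<close> on either side (\<open>frequency_perturbation\<close>).  So everything happens
at the rational point \<open>a/q\<close>.

The integers \<open>n\<close> in \<open>(q^2, x]\<close> are separated according to whether they have a prime factor
exceeding \<open>q^(3/2)\<close>.  In both cases a prime factor \<open>p\<close> of \<open>n = pm\<close> is extracted with the weight
\<open>1/\<omega>(n)\<close>, where \<open>\<omega>\<close> counts the prime factors of \<open>n\<close> from a chosen set.  Up to the few \<open>n\<close> divisible by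
the square of such a prime, this writes the sum as a bilinear form in \<open>p\<close> and \<open>m\<close>
(\<open>ramare_identity\<close>, \<open>ramare_sum\<close>).  On a dyadic block \<open>H < p \<le> 2H\<close> the condition on \<open>pm\<close> can be
made independent of \<open>p\<close>: the pairs affected have \<open>pm\<close> within a factor 2 of an end of the range, and
they contribute \<open>O(1)\<close> altogether.  Cauchy-Schwarz over \<open>p\<close>, a bound for the number of \<open>p\<close> in
each residue class modulo \<open>q\<close>, and orthogonality of the characters modulo \<open>q\<close> then bound the block
(\<open>bilinear_block\<close>, \<open>type_II_sum\<close>).  For \<open>m > U\<close> with weights at most \<open>1/m\<close> the orthogonality
step produces the factor \<open>1/U + (ln x)^2/q\<close>, which is where \<open>q \<ge> L^(2+\<epsilon>)\<close> enters.

For large primes \<open>p > q^(3/2)\<close> the pairs with \<open>m \<le> M\<close> and \<open>p > q^2\<close> are exactly the main term,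
because such an \<open>m\<close> has no prime factor in the chosen set and hence weight 1; those with \<open>p \<le> q^2\<close>
have \<open>p\<close> in the short range \<open>(q^2/M, q^2]\<close> and are negligible by Chebyshev's bound.  For \<open>m > M\<close>
the residue classes are controlled by the Brun-Titchmarsh inequality.  The block at \<open>H\<close> is then
\<open>O((1/ln H) (q/(\<phi>(q) M))^(1/2))\<close>.  As \<open>q/\<phi>(q) = O(ln ln x)\<close> and the sum of \<open>1/ln H\<close> over dyadic
\<open>H \<le> x\<close> is \<open>O(ln ln x)\<close>, the choice of \<open>M\<close> makes the total \<open>O(1)\<close> (\<open>large_prime_factor_part\<close>).

For \<open>n\<close> without a prime factor above \<open>q^(3/2)\<close> put \<open>l = ln q\<close>.  Rankin's method
(\<open>smooth_reciprocal_tail\<close>) discards \<open>n > exp(l^2)\<close> and those \<open>n\<close> all of whose primes are at most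
\<open>exp(sqrt l)\<close>.  What remains has a prime factor between \<open>exp(sqrt l)\<close> and \<open>q^(3/2)\<close>, and a range of
only \<open>l^2\<close> on the logarithmic scale.  Counting integers in place of primes already saves
\<open>exp(-sqrt l / 2)\<close>, more than enough against powers of \<open>l\<close> (\<open>smooth_part_bounded\<close>).

The arithmetic input is elementary: Selberg's upper bound sieve gives Brun-Titchmarsh,
its case \<open>q = 1\<close> gives Chebyshev's bound, and from that follow the upper halves of Mertens'
theorems, the bound for \<open>q/\<phi>(q)\<close> and Rankin's estimate.
\<close>

section \<open>Sums over integers with restricted prime factors\<close>

lemma exists_coprime_part:
  fixes n q :: nat
  assumes "n > 0" "q > 0"
  shows "\<exists>k n'. n = k * n' \<and> coprime n' q \<and> prime_factors k \<subseteq> prime_factors q"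
  using assms(1)
proof (induction n rule: less_induct)
  case (less n)
  show ?case
  proof (cases "coprime n q")
    case True
    then show ?thesis by (intro exI[of _ 1] exI[of _ n]) auto
  next
    case False
    then obtain p where p: "prime p" "p dvd n" "p dvd q"
      using prime_factor_nat[of "gcd n q"] by (auto simp: coprime_iff_gcd_eq_1)
    then obtain n1 where n1: "n = p * n1" by blast
    have "n1 > 0" using less.prems n1 by (auto intro: gr0I)
    moreover have "n1 < n" using n1 p(1) \<open>n1 > 0\<close> prime_gt_1_nat by simp
    ultimately obtain k n' where *: "n1 = k * n'" "coprime n' q" "prime_factors k \<subseteq> prime_factors q"
      using less.IH by blast
    have "k > 0" using * \<open>n1 > 0\<close> by (auto intro: gr0I)
    then have "prime_factors (p * k) \<subseteq> prime_factors q"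
      using * p assms(2) by (auto simp: prime_factors_product prime_prime_factors in_prime_factors_iff)
    then show ?thesis using n1 * by (intro exI[of _ "p * k"] exI[of _ n']) auto
  qed
qed

lemma exists_squarefree_kernel:
  fixes n :: nat
  assumes "n > 0"
  shows "\<exists>t k. n = t * k \<and> squarefree t \<and> prime_factors k \<subseteq> prime_factors t"
  using assms
proof (induction n rule: less_induct)
  case (less n)
  show ?case
  proof (cases "n = 1")
    case True
    then show ?thesis by (intro exI[of _ 1]) auto
  next
    case False
    then obtain p where p: "prime p" "p dvd n"
      using prime_factor_nat by blast
    then obtain n1 where n1: "n = p * n1" by blast
    have "n1 > 0" using less.prems n1 by (auto intro: gr0I)
    moreover have "n1 < n" using n1 p(1) \<open>n1 > 0\<close> prime_gt_1_nat by simp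
    ultimately obtain t k where *: "n1 = t * k" "squarefree t" "prime_factors k \<subseteq> prime_factors t"
      using less.IH by blast
    have pos: "k > 0" "t > 0" using * \<open>n1 > 0\<close> by (auto intro: gr0I)
    show ?thesis
    proof (cases "p dvd t")
      case True
      have "prime_factors (p * k) \<subseteq> prime_factors t"
        using * p pos True by (auto simp: prime_factors_product prime_prime_factors in_prime_factors_iff)
      then show ?thesis using n1 * by (intro exI[of _ t] exI[of _ "p * k"]) auto
    next
      case False
      have "squarefree (p * t)"
        using False p * by (intro squarefree_mult_coprime) (auto simp: squarefree_prime prime_imp_coprime)
      moreover have "prime_factors k \<subseteq> prime_factors (p * t)"
        using * pos p by (auto simp: prime_factors_product prime_gt_0_nat)
      ultimately show ?thesis using n1 * by (intro exI[of _ "p * t"] exI[of _ k]) auto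
    qed
  qed
qed

text \<open>
One half of the Euler product formula, for finite sums and a completely multiplicative \<open>h\<close>.
It serves three times: for \<open>q/\<phi>(q)\<close> and \<open>1/\<phi>(t)\<close> in the sieve (\<open>h(n) = 1/n\<close>), and for Rankin's
method (\<open>h(n) = n^(\<delta>-1)\<close>).  Adjoining one prime \<open>p\<close> multiplies the bound by \<open>1/(1 - h p)\<close>:
an integer either avoids \<open>p\<close> or is \<open>p\<close> times a smaller integer of the same kind.
\<close>

lemma euler_product_bound:
  fixes h :: "nat \<Rightarrow> real" and Q :: "nat set"
  assumes "finite Q" "\<And>p. p \<in> Q \<Longrightarrow> prime p"
  assumes h1: "h 1 = 1" and hmult: "\<And>m n. m > 0 \<Longrightarrow> n > 0 \<Longrightarrow> h (m * n) = h m * h n"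
  assumes hpos: "\<And>n. h n \<ge> 0" and hlt: "\<And>p. p \<in> Q \<Longrightarrow> h p < 1"
  shows "(\<Sum>k | 1 \<le> k \<and> k \<le> N \<and> prime_factors k \<subseteq> Q. h k) \<le> (\<Prod>p\<in>Q. 1 / (1 - h p))"
  using assms(1,2) hlt
proof (induction Q arbitrary: N rule: finite_induct)
  case empty
  have "{k. 1 \<le> k \<and> k \<le> N \<and> prime_factors k \<subseteq> {}} \<subseteq> {1}"
    by (auto simp: prime_factorization_empty_iff)
  then have "(\<Sum>k | 1 \<le> k \<and> k \<le> N \<and> prime_factors k \<subseteq> {}. h k) \<le> sum h {1}"
    by (intro sum_mono2) (auto simp: hpos)
  then show ?case using h1 by simp
next
  case (insert p Q)
  define S where "S = (\<lambda>Q' N. {k. 1 \<le> k \<and> k \<le> N \<and> prime_factors k \<subseteq> (Q' :: nat set)})"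
  have fin: "finite (S Q' N)" for Q' N by (rule finite_subset[of _ "{..N}"]) (auto simp: S_def)
  have p: "prime p" using insert by auto
  have hp: "h p < 1" "0 \<le> h p" using insert hpos by auto
  have IH: "sum h (S Q N) \<le> (\<Prod>p\<in>Q. 1 / (1 - h p))" for N
    using insert.IH[of N] insert.prems by (auto simp: S_def)
  have step: "sum h (S (insert p Q) N) \<le> 1 / (1 - h p) * (\<Prod>p\<in>Q. 1 / (1 - h p))"
    for N
  proof (induction N rule: less_induct)
    case (less N)
    show ?case
    proof (cases "N = 0")
      case True
      then have "S (insert p Q) N = {}" by (auto simp: S_def)
      moreover have "(\<Prod>p\<in>Q. 1 / (1 - h p)) \<ge> 0"
        using insert.prems by (intro prod_nonneg) (auto simp: less_imp_le)
      ultimately show ?thesis using hp by simp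
    next
      case False
      have sub: "S (insert p Q) N \<subseteq> S Q N \<union> (\<lambda>k. p * k) ` S (insert p Q) (N div p)"
      proof
        fix k assume k: "k \<in> S (insert p Q) N"
        show "k \<in> S Q N \<union> (\<lambda>k. p * k) ` S (insert p Q) (N div p)"
        proof (cases "p dvd k")
          case True
          then obtain j where j: "k = p * j" by blast
          have "j > 0" using j k by (auto simp: S_def intro: gr0I)
          then have "prime_factors j \<subseteq> insert p Q"
            using k j p prime_gt_0_nat[OF p] by (auto simp: S_def prime_factors_product)
          moreover have "j \<le> N div p" using j k p
            by (auto simp: S_def less_eq_div_iff_mult_less_eq prime_gt_0_nat mult.commute)
          ultimately have "j \<in> S (insert p Q) (N div p)" using \<open>j > 0\<close> by (auto simp: S_def)
          then show ?thesis using j by blast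
        next
          case False
          then have "p \<notin> prime_factors k" by auto
          then show ?thesis using k by (auto simp: S_def)
        qed
      qed
      have "sum h (S (insert p Q) N) \<le> sum h (S Q N \<union> (\<lambda>k. p * k) ` S (insert p Q) (N div p))"
        using sub fin hpos by (intro sum_mono2) auto
      also have "\<dots> \<le> sum h (S Q N) + sum h ((\<lambda>k. p * k) ` S (insert p Q) (N div p))"
        using fin hpos by (subst sum_Un) (auto intro!: sum_nonneg)
      also have "sum h ((\<lambda>k. p * k) ` S (insert p Q) (N div p)) = (\<Sum>k\<in>S (insert p Q) (N div p). h (p * k))"
        using p by (subst sum.reindex) (auto simp: inj_on_def prime_gt_0_nat)
      also have "\<dots> = h p * sum h (S (insert p Q) (N div p))"
        unfolding sum_distrib_left using prime_gt_0_nat[OF p] by (intro sum.cong) (auto simp: S_def hmult)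
      also have "\<dots> \<le> h p * (1 / (1 - h p) * (\<Prod>p\<in>Q. 1 / (1 - h p)))"
        using less.IH[of "N div p"] False prime_gt_1_nat[OF p] hp
        by (intro mult_left_mono) (auto simp del: prod_dividef prod_constant)
      also have "sum h (S Q N) + h p * (1 / (1 - h p) * (\<Prod>p\<in>Q. 1 / (1 - h p)))
          \<le> (\<Prod>p\<in>Q. 1 / (1 - h p)) * (1 + h p / (1 - h p))"
        using IH[of N] by (simp add: algebra_simps)
      also have "1 + h p / (1 - h p) = 1 / (1 - h p)" using hp by (simp add: field_simps)
      finally show ?thesis by (simp add: mult.commute)
    qed
  qed
  show ?case using step[of N] insert.hyps by (simp add: S_def)
qed

section \<open>Selberg sieve and the Brun-Titchmarsh inequality\<close>

text \<open>
The Moebius function, on the squarefree integers.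
\<close>

definition sieve_mu :: "nat \<Rightarrow> real" where
  "sieve_mu n = (-1) ^ card (prime_factors n)"

lemma sieve_mu_prime_mult:
  assumes "prime p" "\<not> p dvd n" "n > 0"
  shows "sieve_mu (p * n) = - sieve_mu n"
proof -
  have "prime_factors (p * n) = insert p (prime_factors n)"
    using assms by (auto simp: prime_factors_product prime_gt_0_nat prime_prime_factors)
  moreover have "p \<notin> prime_factors n" using assms by auto
  ultimately show ?thesis by (simp add: sieve_mu_def)
qed

lemma abs_sieve_mu [simp]: "\<bar>sieve_mu n\<bar> = 1"
  by (simp add: sieve_mu_def power_abs)

lemma sieve_mu_square: "sieve_mu n * sieve_mu n = 1"
  using abs_sieve_mu[of n] by (metis abs_mult_self_eq mult_1)

text \<open>
The divisors \<open>d\<close> of \<open>t\<close> above \<open>e\<close> cancel in pairs \<open>d, pd\<close>, where \<open>p\<close> is a prime dividing \<open>t/e\<close>.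
\<close>

lemma sieve_mu_sum_between:
  fixes e t :: nat
  assumes "squarefree t" "e dvd t"
  shows "(\<Sum>d | e dvd d \<and> d dvd t. sieve_mu d) = (if e = t then sieve_mu t else 0)"
proof (cases "e = t")
  case True
  then have "{d. e dvd d \<and> d dvd t} = {t}" by (auto intro: dvd_antisym)
  then show ?thesis using True by simp
next
  case False
  have t0: "t > 0" using assms by (auto intro: gr0I)
  obtain s where s: "t = e * s" using assms by blast
  have "s \<noteq> 1" using s False by auto
  then obtain p where p: "prime p" "p dvd s" using prime_factor_nat by blast
  then obtain s' where s': "s = p * s'" by blast
  define u where "u = e * s'"
  have tu: "t = p * u" using s s' by (simp add: u_def)
  have npu: "\<not> p dvd u"
  proof
    assume "p dvd u"
    then have "p ^ 2 dvd t" unfolding tu power2_eq_square by (rule mult_dvd_mono[OF dvd_refl])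
    then have "is_unit p" using assms(1) by (rule squarefreeD[rotated])
    then show False using p(1) not_prime_unit by blast
  qed
  have u0: "u > 0" using t0 tu by (auto intro: gr0I)
  have eu: "e dvd u" by (simp add: u_def)
  have split: "{d. e dvd d \<and> d dvd t} = {d. e dvd d \<and> d dvd u} \<union> (\<lambda>d. p * d) ` {d. e dvd d \<and> d dvd u}"
  proof (intro equalityI subsetI)
    fix d assume d: "d \<in> {d. e dvd d \<and> d dvd t}"
    show "d \<in> {d. e dvd d \<and> d dvd u} \<union> (\<lambda>d. p * d) ` {d. e dvd d \<and> d dvd u}"
    proof (cases "p dvd d")
      case True
      then obtain d' where d': "d = p * d'" by blast
      have "d' dvd u" using d d' tu p(1) prime_gt_0_nat by auto
      moreover have "coprime e p"
        using npu eu p(1) by (metis coprime_commute dvd_trans prime_imp_coprime)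
      then have "e dvd d'" using d d' by (auto simp: coprime_dvd_mult_right_iff)
      ultimately show ?thesis using d' by blast
    next
      case False
      then have "coprime d p" using p(1) by (metis coprime_commute prime_imp_coprime)
      then have "d dvd u" using d tu by (auto simp: coprime_dvd_mult_right_iff)
      then show ?thesis using d by blast
    qed
  next
    fix d assume "d \<in> {d. e dvd d \<and> d dvd u} \<union> (\<lambda>d. p * d) ` {d. e dvd d \<and> d dvd u}"
    then show "d \<in> {d. e dvd d \<and> d dvd t}" using tu by auto
  qed
  have fin: "finite {d. e dvd d \<and> d dvd u}"
    using u0 by (intro finite_subset[OF _ finite_divisors_nat[of u]]) auto
  have "(\<Sum>d | e dvd d \<and> d dvd t. sieve_mu d) =
      (\<Sum>d | e dvd d \<and> d dvd u. sieve_mu d) + sum sieve_mu ((\<lambda>d. p * d) ` {d. e dvd d \<and> d dvd u})"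
    unfolding split
  proof (rule sum.union_disjoint)
    show "{d. e dvd d \<and> d dvd u} \<inter> (\<lambda>d. p * d) ` {d. e dvd d \<and> d dvd u} = {}"
      using npu by (auto dest: dvd_mult_left)
  qed (use fin in auto)
  also have "sum sieve_mu ((\<lambda>d. p * d) ` {d. e dvd d \<and> d dvd u}) = (\<Sum>d | e dvd d \<and> d dvd u. sieve_mu (p * d))"
    using prime_gt_0_nat[OF p(1)] by (subst sum.reindex) (auto simp: inj_on_def)
  also have "\<dots> = (\<Sum>d | e dvd d \<and> d dvd u. - sieve_mu d)"
  proof (intro sum.cong refl sieve_mu_prime_mult p(1))
    fix d assume d: "d \<in> {d. e dvd d \<and> d dvd u}"
    then show "\<not> p dvd d" using npu dvd_trans[of p d u] by blast
    show "d > 0" using d u0 by (metis (mono_tags, lifting) dvd_pos_nat mem_Collect_eq)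
  qed
  finally show ?thesis using False by (simp add: sum_negf)
qed

lemma gcd_eq_totient_sum:
  fixes d d' :: nat
  assumes "d > 0"
  shows "gcd d d' = (\<Sum>e | e dvd d \<and> e dvd d'. totient e)"
  using totient_divisor_sum[of "gcd d d'"] by simp

text \<open>
For squarefree \<open>t\<close> let \<open>c(t,n)\<close> be the sum of \<open>\<mu>(d) d\<close> over the common divisors \<open>d\<close> of \<open>t\<close> and \<open>n\<close>;
up to sign this is the Ramanujan sum.  The left side below is the mean value of \<open>c(t,n) c(t',n)\<close> over
\<open>n\<close>, because \<open>d\<close> and \<open>d'\<close> both divide \<open>n\<close> with density \<open>1/lcm(d,d')\<close> and \<open>d d'/lcm(d,d') = gcd(d,d')\<close>.
Writing \<open>gcd(d,d')\<close> as the sum of \<open>\<phi>(e)\<close> over the common divisors \<open>e\<close> separates \<open>d\<close> from \<open>d'\<close>.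
\<close>

lemma sieve_orthogonality:
  fixes t t' :: nat
  assumes "squarefree t" "squarefree t'"
  shows "(\<Sum>d | d dvd t. \<Sum>d' | d' dvd t'. sieve_mu d * sieve_mu d' * real (gcd d d'))
       = (if t = t' then real (totient t) else 0)"
proof -
  have t0: "t > 0" "t' > 0" using assms by (auto intro: gr0I)
  have fin: "finite {d. d dvd t}" "finite {d. d dvd t'}" using t0 by auto
  have "(\<Sum>d | d dvd t. \<Sum>d' | d' dvd t'. sieve_mu d * sieve_mu d' * real (gcd d d')) =
     (\<Sum>d | d dvd t. \<Sum>d' | d' dvd t'. sieve_mu d * sieve_mu d' *
        (\<Sum>e | e dvd t. real (totient e) * (of_bool (e dvd d) * of_bool (e dvd d'))))"
  proof (intro sum.cong refl)
    fix d d' assume d: "d \<in> {d. d dvd t}" "d' \<in> {d'. d' dvd t'}"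
    have "real (gcd d d') = (\<Sum>e | e dvd d \<and> e dvd d'. real (totient e))"
      using d t0 by (subst gcd_eq_totient_sum) (auto intro: gr0I)
    also have "\<dots> = (\<Sum>e | e dvd t. real (totient e) * (of_bool (e dvd d) * of_bool (e dvd d')))"
    proof (intro sum.mono_neutral_cong_left)
      show "{e. e dvd d \<and> e dvd d'} \<subseteq> {e. e dvd t}" using d dvd_trans[of _ d t] by blast
    qed (use fin in auto)
    finally show "sieve_mu d * sieve_mu d' * real (gcd d d') = sieve_mu d * sieve_mu d' *
        (\<Sum>e | e dvd t. real (totient e) * (of_bool (e dvd d) * of_bool (e dvd d')))" by simp
  qed
  also have "\<dots> = (\<Sum>e | e dvd t. real (totient e) *
      ((\<Sum>d | d dvd t. sieve_mu d * of_bool (e dvd d)) * (\<Sum>d' | d' dvd t'. sieve_mu d' * of_bool (e dvd d'))))"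
  proof -
    have "(\<Sum>d | d dvd t. \<Sum>d' | d' dvd t'. sieve_mu d * sieve_mu d' *
        (\<Sum>e | e dvd t. real (totient e) * (of_bool (e dvd d) * of_bool (e dvd d')))) =
      (\<Sum>d | d dvd t. \<Sum>d' | d' dvd t'. \<Sum>e | e dvd t.
        real (totient e) * ((sieve_mu d * of_bool (e dvd d)) * (sieve_mu d' * of_bool (e dvd d'))))"
      unfolding sum_distrib_left by (intro sum.cong refl) (simp only: mult_ac)
    also have "\<dots> = (\<Sum>d | d dvd t. \<Sum>e | e dvd t. \<Sum>d' | d' dvd t'.
        real (totient e) * ((sieve_mu d * of_bool (e dvd d)) * (sieve_mu d' * of_bool (e dvd d'))))"
      by (intro sum.cong refl sum.swap)
    also have "\<dots> = (\<Sum>e | e dvd t. \<Sum>d | d dvd t. \<Sum>d' | d' dvd t'.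
        real (totient e) * ((sieve_mu d * of_bool (e dvd d)) * (sieve_mu d' * of_bool (e dvd d'))))"
      by (rule sum.swap)
    also have "\<dots> = (\<Sum>e | e dvd t. real (totient e) *
      ((\<Sum>d | d dvd t. sieve_mu d * of_bool (e dvd d)) * (\<Sum>d' | d' dvd t'. sieve_mu d' * of_bool (e dvd d'))))"
      by (subst sum_product) (simp only: sum_distrib_left)
    finally show ?thesis .
  qed
  also have "\<dots> = (\<Sum>e | e dvd t. real (totient e) *
      ((if e = t then sieve_mu t else 0) * (\<Sum>d' | d' dvd t'. sieve_mu d' * of_bool (e dvd d'))))"
  proof (intro sum.cong refl)
    fix e assume e: "e \<in> {e. e dvd t}"
    have "(\<Sum>d | d dvd t. sieve_mu d * of_bool (e dvd d)) = (\<Sum>d | e dvd d \<and> d dvd t. sieve_mu d)"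
      using fin by (intro sum.mono_neutral_cong_right) auto
    then show "real (totient e) * ((\<Sum>d | d dvd t. sieve_mu d * of_bool (e dvd d)) *
           (\<Sum>d' | d' dvd t'. sieve_mu d' * of_bool (e dvd d'))) =
         real (totient e) * ((if e = t then sieve_mu t else 0) *
           (\<Sum>d' | d' dvd t'. sieve_mu d' * of_bool (e dvd d')))"
      using sieve_mu_sum_between[OF assms(1), of e] e by simp
  qed
  also have "\<dots> = (\<Sum>e\<in>{t}. real (totient e) *
      (sieve_mu t * (\<Sum>d' | d' dvd t'. sieve_mu d' * of_bool (e dvd d'))))"
    using fin by (intro sum.mono_neutral_cong_right) auto
  also have "\<dots> = real (totient t) *
      (sieve_mu t * (\<Sum>d' | d' dvd t'. sieve_mu d' * of_bool (t dvd d')))" by simp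
  also have "(\<Sum>d' | d' dvd t'. sieve_mu d' * of_bool (t dvd d')) = (\<Sum>d | t dvd d \<and> d dvd t'. sieve_mu d)"
    using fin by (intro sum.mono_neutral_cong_right) auto
  also have "\<dots> = (if t = t' then sieve_mu t else 0)"
  proof (cases "t dvd t'")
    case True
    then show ?thesis using sieve_mu_sum_between[OF assms(2), of t] by simp
  next
    case False
    then have *: "{d. t dvd d \<and> d dvd t'} = {}" using dvd_trans by blast
    show ?thesis unfolding * using False by auto
  qed
  finally show ?thesis
    by (auto simp: sieve_mu_square)
qed

text \<open>
An exact count, so that the error in every interval is at most 1 with no case distinctions.
\<close>

lemma card_residue_below:
  fixes n D r :: nat
  assumes "r < D"
  shows "card {k. k < n \<and> k mod D = r} = (n + (D - 1 - r)) div D"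
proof (induction n)
  case 0
  then show ?case using assms by simp
next
  case (Suc n)
  have "{k. k < Suc n \<and> k mod D = r} =
      (if n mod D = r then insert n {k. k < n \<and> k mod D = r} else {k. k < n \<and> k mod D = r})"
    by (auto simp: less_Suc_eq)
  then have "card {k. k < Suc n \<and> k mod D = r} = (n + (D - 1 - r)) div D + of_bool (n mod D = r)"
    using Suc.IH by simp
  also have "\<dots> = (Suc n + (D - 1 - r)) div D"
  proof -
    have "D dvd Suc (n + (D - 1 - r)) \<longleftrightarrow> int D dvd int n - int r"
    proof -
      have "int (Suc (n + (D - 1 - r))) = int n - int r + int D" using assms by (simp add: of_nat_diff)
      then have "int D dvd int (Suc (n + (D - 1 - r))) \<longleftrightarrow> int D dvd int n - int r"
        by (simp only: dvd_add_triv_right_iff)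
      then show ?thesis by (simp only: of_nat_dvd_iff)
    qed
    also have "\<dots> \<longleftrightarrow> int n mod int D = int r mod int D" by (rule mod_eq_dvd_iff[symmetric])
    also have "\<dots> \<longleftrightarrow> n mod D = r" using assms by (simp flip: of_nat_mod)
    finally show ?thesis by (simp add: div_Suc dvd_eq_mod_eq_0)
  qed
  finally show ?case .
qed

lemma card_residue_interval:
  fixes lo len D r :: nat
  assumes "r < D"
  shows "\<bar>real (card {k \<in> {lo..<lo + len}. k mod D = r}) - real len / real D\<bar> \<le> 1"
proof -
  define F where "F n = (n + (D - 1 - r)) div D" for n
  have F: "real (F n) \<le> real (n + (D - 1 - r)) / D" "real (n + (D - 1 - r)) / D < real (F n) + 1" for n
  proof -
    show "real (F n) \<le> real (n + (D - 1 - r)) / D" unfolding F_def by (rule of_nat_div_le_of_nat)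
    have "n + (D - 1 - r) < D * (F n + 1)"
      unfolding F_def using dividend_less_times_div[of D "n + (D - 1 - r)"] assms by simp
    then have "real (n + (D - 1 - r)) < real D * (real (F n) + 1)"
      by (metis of_nat_1 of_nat_add of_nat_less_iff of_nat_mult)
    then show "real (n + (D - 1 - r)) / D < real (F n) + 1"
      using assms by (simp add: field_simps)
  qed
  have split: "{k. k < lo + len \<and> k mod D = r} =
      {k. k < lo \<and> k mod D = r} \<union> {k \<in> {lo..<lo + len}. k mod D = r}" by auto
  have "card {k. k < lo + len \<and> k mod D = r} =
      card {k. k < lo \<and> k mod D = r} + card {k \<in> {lo..<lo + len}. k mod D = r}"
    unfolding split by (intro card_Un_disjoint) auto
  then have eq: "real (card {k \<in> {lo..<lo + len}. k mod D = r}) = real (F (lo + len)) - real (F lo)"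
    unfolding card_residue_below[OF assms] F_def by linarith
  have "real (lo + len + (D - 1 - r)) / D - real (lo + (D - 1 - r)) / D = real len / D"
    by (simp add: add_divide_distrib)
  then show ?thesis unfolding eq using F[of "lo + len"] F[of lo] by linarith
qed

lemma progression_divisible_class:
  fixes q b D :: nat
  assumes "coprime q D" "D > 0"
  shows "\<exists>r<D. \<forall>k. D dvd b + q * k \<longleftrightarrow> k mod D = r"
proof -
  obtain q' where q': "[q * q' = 1] (mod D)"
    using cong_solve_coprime_nat[of q D] assms by auto
  define z where "z = q' * (b * (D - 1))"
  have "[b + q * z = b + 1 * (b * (D - 1))] (mod D)"
    unfolding z_def mult.assoc[symmetric] using q'
    by (intro cong_add cong_mult cong_refl) auto
  also have "b + 1 * (b * (D - 1)) = D * b" using assms(2) by (cases D) auto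
  finally have z: "D dvd b + q * z" by (simp add: cong_def dvd_eq_mod_eq_0)
  have "D dvd b + q * k \<longleftrightarrow> k mod D = z mod D" for k
  proof -
    have "D dvd b + q * k \<longleftrightarrow> [b + q * k = b + q * z] (mod D)"
      using z by (auto simp: cong_def dvd_eq_mod_eq_0)
    also have "\<dots> \<longleftrightarrow> [q * k = q * z] (mod D)" by (simp add: cong_add_lcancel_nat)
    also have "\<dots> \<longleftrightarrow> [k = z] (mod D)" using assms(1) by (rule cong_mult_lcancel_nat)
    finally show ?thesis by (simp add: cong_def)
  qed
  then show ?thesis using assms(2) by (intro exI[of _ "z mod D"]) auto
qed

lemma card_progression_divisible:
  fixes q b D lo len :: nat
  assumes "coprime q D" "D > 0"
  shows "\<bar>real (card {k \<in> {lo..<lo + len}. D dvd b + q * k}) - real len / real D\<bar> \<le> 1"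
proof -
  obtain r where "r < D" "\<And>k. D dvd b + q * k \<longleftrightarrow> k mod D = r"
    using progression_divisible_class[OF assms] by blast
  then show ?thesis using card_residue_interval[of r D lo len] by simp
qed

text \<open>
Selberg's optimal weights, up to the factor \<open>sieve_mass T\<close>, written as a combination of the mutually orthogonal
functions \<open>c(t,n)\<close> instead of a list of divisor coefficients.  In this form orthogonality gives the second
moment at once and no quadratic form has to be diagonalised.  At a prime above the sieve level every
\<open>c(t,n)\<close> is 1, so the weight there equals \<open>sieve_mass T\<close>.
\<close>

definition sieve_weight :: "nat set \<Rightarrow> nat \<Rightarrow> real" where
  "sieve_weight T n = (\<Sum>t\<in>T. 1 / real (totient t) * (\<Sum>d | d dvd t. of_bool (d dvd n) * (sieve_mu d * real d)))"

definition sieve_mass :: "nat set \<Rightarrow> real" where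
  "sieve_mass T = (\<Sum>t\<in>T. 1 / real (totient t))"

text \<open>
Each pair of divisors contributes its density times the length of the interval, with an error at most 1.
The densities assemble to the mean value of \<open>sieve_orthogonality\<close>; the errors cost at most the product
of the two divisor sums, hence \<open>R^4\<close>.
\<close>

lemma sieve_correlation_bound:
  fixes q b lo len R t t' :: nat
  assumes "squarefree t" "squarefree t'" "t \<le> R" "t' \<le> R" "coprime t q" "coprime t' q"
  shows "(\<Sum>k\<in>{lo..<lo + len}. (\<Sum>d | d dvd t. of_bool (d dvd b + q * k) * (sieve_mu d * real d)) *
            (\<Sum>d | d dvd t'. of_bool (d dvd b + q * k) * (sieve_mu d * real d)))
         \<le> real len * (if t = t' then real (totient t) else 0) + real R ^ 4"
proof -
  define I where "I = {lo..<lo + len}"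
  define N where "N D = real (card {k \<in> I. D dvd b + q * k})" for D
  have t0: "t > 0" "t' > 0" using assms by (auto intro: gr0I)
  have divsum: "(\<Sum>d | d dvd s. real d) \<le> real R ^ 2" if "s > 0" "s \<le> R" for s
  proof -
    have sub: "{d. d dvd s} \<subseteq> {1..R}"
    proof
      fix d assume "d \<in> {d. d dvd s}"
      then have "d > 0" "d \<le> s" using that by (auto intro: dvd_imp_le dvd_pos_nat)
      then show "d \<in> {1..R}" using that by auto
    qed
    then have "(\<Sum>d | d dvd s. real d) \<le> (\<Sum>d\<in>{1..R}. real R)"
      by (intro order.trans[OF sum_mono2 sum_mono]) auto
    then show ?thesis by (simp add: power2_eq_square)
  qed
  have N: "N (lcm d d') \<le> real len / real (lcm d d') + 1" "N (lcm d d') \<ge> real len / real (lcm d d') - 1"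
    if "d dvd t" "d' dvd t'" for d d'
  proof -
    have "coprime q (lcm d d')"
    proof (rule coprime_divisors[OF dvd_refl])
      show "lcm d d' dvd t * t'" using that by (intro lcm_least dvd_mult dvd_mult2) 
      show "coprime q (t * t')" using assms(5,6) by (simp add: coprime_commute)
    qed
    moreover have "lcm d d' > 0" using that t0 by (auto intro!: gr0I)
    ultimately show "N (lcm d d') \<le> real len / real (lcm d d') + 1"
       "N (lcm d d') \<ge> real len / real (lcm d d') - 1"
      using card_progression_divisible[of q "lcm d d'" lo len b] unfolding N_def I_def by linarith+
  qed
  have "(\<Sum>k\<in>I. (\<Sum>d | d dvd t. of_bool (d dvd b + q * k) * (sieve_mu d * real d)) *
            (\<Sum>d | d dvd t'. of_bool (d dvd b + q * k) * (sieve_mu d * real d))) =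
     (\<Sum>k\<in>I. \<Sum>d | d dvd t. \<Sum>d' | d' dvd t'. of_bool (lcm d d' dvd b + q * k) * (sieve_mu d * real d * (sieve_mu d' * real d')))"
    unfolding sum_product by (intro sum.cong refl) (auto simp: of_bool_def)
  also have "\<dots> = (\<Sum>d | d dvd t. \<Sum>k\<in>I. \<Sum>d' | d' dvd t'. of_bool (lcm d d' dvd b + q * k) * (sieve_mu d * real d * (sieve_mu d' * real d')))"
    by (rule sum.swap)
  also have "\<dots> = (\<Sum>d | d dvd t. \<Sum>d' | d' dvd t'. \<Sum>k\<in>I. of_bool (lcm d d' dvd b + q * k) * (sieve_mu d * real d * (sieve_mu d' * real d')))"
    by (intro sum.cong refl sum.swap)
  also have "\<dots> = (\<Sum>d | d dvd t. \<Sum>d' | d' dvd t'. N (lcm d d') * (sieve_mu d * real d * (sieve_mu d' * real d')))"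
  proof (intro sum.cong refl)
    fix d d'
    have "(\<Sum>k\<in>I. of_bool (lcm d d' dvd b + q * k) :: real) = N (lcm d d')"
      unfolding N_def I_def by (simp add: of_bool_def sum.If_cases Int_def)
    then show "(\<Sum>k\<in>I. of_bool (lcm d d' dvd b + q * k) * (sieve_mu d * real d * (sieve_mu d' * real d')))
       = N (lcm d d') * (sieve_mu d * real d * (sieve_mu d' * real d'))"
      by (simp only: sum_distrib_right[symmetric])
  qed
  also have "\<dots> \<le> (\<Sum>d | d dvd t. \<Sum>d' | d' dvd t'. real len * (sieve_mu d * sieve_mu d' * real (gcd d d')) + real d * real d')"
  proof (intro sum_mono)
    fix d d' assume d: "d \<in> {d. d dvd t}" "d' \<in> {d'. d' dvd t'}"
    then have pos: "d > 0" "d' > 0" using t0 by (auto intro: gr0I)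
    have "real d * real d' = real (gcd d d') * real (lcm d d')"
      by (metis of_nat_mult prod_gcd_lcm_nat)
    moreover have "real (lcm d d') > 0" using pos by (simp add: lcm_pos_nat)
    ultimately have g: "real len / real (lcm d d') * (real d * real d') = real len * real (gcd d d')"
      using pos by simp
    have "\<bar>(N (lcm d d') - real len / real (lcm d d')) * (sieve_mu d * real d * (sieve_mu d' * real d'))\<bar>
        \<le> 1 * (real d * real d')"
      unfolding abs_mult using N[of d d'] d by (intro mult_mono) (auto simp: abs_le_iff)
    then have "N (lcm d d') * (sieve_mu d * real d * (sieve_mu d' * real d'))
       \<le> real len / real (lcm d d') * (sieve_mu d * real d * (sieve_mu d' * real d')) + real d * real d'"
      by (simp only: left_diff_distrib abs_le_iff) linarith
    also have "real len / real (lcm d d') * (sieve_mu d * real d * (sieve_mu d' * real d')) =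
       sieve_mu d * sieve_mu d' * (real len / real (lcm d d') * (real d * real d'))"
      by (simp only: mult_ac)
    finally show "N (lcm d d') * (sieve_mu d * real d * (sieve_mu d' * real d')) \<le>
       real len * (sieve_mu d * sieve_mu d' * real (gcd d d')) + real d * real d'"
      unfolding g by (simp only: mult_ac)
  qed
  also have "\<dots> = real len * (\<Sum>d | d dvd t. \<Sum>d' | d' dvd t'. sieve_mu d * sieve_mu d' * real (gcd d d')) +
      (\<Sum>d | d dvd t. real d) * (\<Sum>d | d dvd t'. real d)"
    unfolding sum.distrib by (subst sum_product) (simp only: sum_distrib_left)
  also have "\<dots> \<le> real len * (if t = t' then real (totient t) else 0) + real R ^ 2 * real R ^ 2"
    unfolding sieve_orthogonality[OF assms(1,2)]
    using divsum[of t] divsum[of t'] t0 assms by (intro add_left_mono mult_mono) (auto intro!: sum_nonneg)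
  finally show ?thesis unfolding I_def by (simp flip: power_add)
qed

lemma sieve_second_moment:
  fixes q b lo len R :: nat
  assumes "finite T" "\<And>t. t \<in> T \<Longrightarrow> squarefree t \<and> t \<le> R \<and> coprime t q"
  shows "(\<Sum>k\<in>{lo..<lo + len}. (sieve_weight T (b + q * k))\<^sup>2)
         \<le> real len * sieve_mass T + real R ^ 4 * (sieve_mass T)\<^sup>2"
proof -
  define I where "I = {lo..<lo + len}"
  define c where "c t n = (\<Sum>d | d dvd t. of_bool (d dvd n) * (sieve_mu d * real d))" for t n :: nat
  define w where "w t = 1 / real (totient t)" for t
  have w0: "w t \<ge> 0" for t by (simp add: w_def)
  have "(\<Sum>k\<in>I. (sieve_weight T (b + q * k))\<^sup>2) =
     (\<Sum>k\<in>I. \<Sum>t\<in>T. \<Sum>t'\<in>T. w t * w t' * (c t (b + q * k) * c t' (b + q * k)))"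
    unfolding sieve_weight_def power2_eq_square sum_product c_def[symmetric] w_def[symmetric]
    by (intro sum.cong refl) (simp only: mult_ac)
  also have "\<dots> = (\<Sum>t\<in>T. \<Sum>k\<in>I. \<Sum>t'\<in>T. w t * w t' * (c t (b + q * k) * c t' (b + q * k)))"
    by (rule sum.swap)
  also have "\<dots> = (\<Sum>t\<in>T. \<Sum>t'\<in>T. \<Sum>k\<in>I. w t * w t' * (c t (b + q * k) * c t' (b + q * k)))"
    by (intro sum.cong refl sum.swap)
  also have "\<dots> = (\<Sum>t\<in>T. \<Sum>t'\<in>T. w t * w t' * (\<Sum>k\<in>I. c t (b + q * k) * c t' (b + q * k)))"
    by (simp only: sum_distrib_left)
  also have "\<dots> \<le> (\<Sum>t\<in>T. \<Sum>t'\<in>T. w t * w t' * (real len * (if t = t' then real (totient t) else 0) + real R ^ 4))"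
    unfolding I_def c_def using assms(2) w0
    by (intro sum_mono mult_left_mono sieve_correlation_bound) auto
  also have "\<dots> = (\<Sum>t\<in>T. (\<Sum>t'\<in>T. if t = t' then real len * (w t * w t * real (totient t)) else 0)
       + (\<Sum>t'\<in>T. real R ^ 4 * (w t * w t')))"
    unfolding sum.distrib[symmetric] by (intro sum.cong refl) (simp add: algebra_simps)
  also have "\<dots> = (\<Sum>t\<in>T. real len * (w t * w t * real (totient t))) + (\<Sum>t\<in>T. \<Sum>t'\<in>T. real R ^ 4 * (w t * w t'))"
    unfolding sum.distrib using assms(1) by (simp add: sum.delta)
  also have "(\<Sum>t\<in>T. \<Sum>t'\<in>T. real R ^ 4 * (w t * w t')) = real R ^ 4 * (sieve_mass T)\<^sup>2"
    unfolding sieve_mass_def w_def[symmetric] power2_eq_square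
    by (subst sum_product) (simp only: sum_distrib_left)
  also have "(\<Sum>t\<in>T. real len * (w t * w t * real (totient t))) = real len * sieve_mass T"
    unfolding sieve_mass_def sum_distrib_left
  proof (intro sum.cong refl)
    fix t assume "t \<in> T"
    then have "t \<noteq> 0" using assms(2)[of t] by (metis not_squarefree_0)
    then show "real len * (w t * w t * real (totient t)) = real len * (1 / real (totient t))"
      by (simp add: w_def)
  qed
  finally show ?thesis unfolding I_def .
qed

lemma sum_reciprocal_smooth_le:
  fixes q N :: nat
  assumes "q > 0"
  shows "(\<Sum>k | 1 \<le> k \<and> k \<le> N \<and> prime_factors k \<subseteq> prime_factors q. 1 / real k) \<le> real q / real (totient q)"
proof -
  have "(\<Sum>k | 1 \<le> k \<and> k \<le> N \<and> prime_factors k \<subseteq> prime_factors q. 1 / real k)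
     \<le> (\<Prod>p\<in>prime_factors q. 1 / (1 - 1 / real p))"
    by (rule euler_product_bound) (auto dest!: in_prime_factors_imp_prime prime_gt_1_nat)
  also have "\<dots> = real q / real (totient q)"
    using assms unfolding totient_formula2 by (simp add: prod_dividef)
  finally show ?thesis .
qed

text \<open>
The sum of \<open>1/\<phi>(t)\<close> over squarefree \<open>t\<close> is the sum of \<open>1/n\<close> over all \<open>n\<close> with squarefree kernel at most
\<open>R\<close>, hence at least the harmonic sum when there is no coprimality condition.  The condition of being
coprime to \<open>q\<close> costs at most the factor \<open>q/\<phi>(q)\<close>, the sum of \<open>1/k\<close> over \<open>k\<close> composed of primes
dividing \<open>q\<close>.
\<close>

lemma sieve_mass_ge:
  fixes q R :: nat
  assumes "q > 0"
  defines "T \<equiv> {t. 1 \<le> t \<and> t \<le> R \<and> squarefree t \<and> coprime t q}"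
  shows "ln (real R + 1) \<le> real q / real (totient q) * sieve_mass T"
proof -
  define S where "S s = {k. 1 \<le> k \<and> k \<le> R \<and> prime_factors k \<subseteq> prime_factors s}" for s :: nat
  define N' where "N' = {n. 1 \<le> n \<and> n \<le> R \<and> coprime n q}"
  have fin: "finite (S s)" "finite N'" "finite T" for s
    unfolding S_def N'_def T_def by auto
  have "ln (real R + 1) \<le> harm R" by (rule ln_le_harm)
  also have "harm R = (\<Sum>n\<in>{1..R}. 1 / real n)" by (simp add: harm_def inverse_eq_divide)
  also have "\<dots> \<le> (\<Sum>n\<in>(\<lambda>(k, n'). k * n') ` (S q \<times> N'). 1 / real n)"
  proof (intro sum_mono2)
    show "{1..R} \<subseteq> (\<lambda>(k, n'). k * n') ` (S q \<times> N')"
    proof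
      fix n assume n: "n \<in> {1..R}"
      then obtain k n' where *: "n = k * n'" "coprime n' q" "prime_factors k \<subseteq> prime_factors q"
        using exists_coprime_part[of n q] assms by auto
      then have "k > 0" "n' > 0" using n by (auto intro: gr0I)
      moreover have "k \<le> n" "n' \<le> n" using * \<open>k > 0\<close> \<open>n' > 0\<close> by auto
      moreover have "n \<le> R" using n by simp
      ultimately have "k \<in> S q" "n' \<in> N'" using *(2,3) by (simp_all add: S_def N'_def)
      then show "n \<in> (\<lambda>(k, n'). k * n') ` (S q \<times> N')" using * by force
    qed
  qed (use fin in auto)
  also have "\<dots> \<le> (\<Sum>x\<in>S q \<times> N'. 1 / real (case x of (k, n') \<Rightarrow> k * n'))"
    using sum_image_le[of "S q \<times> N'" "\<lambda>n. 1 / real n" "\<lambda>(k, n'). k * n'"] fin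
    by (auto simp: o_def)
  also have "\<dots> = (\<Sum>k\<in>S q. 1 / real k) * (\<Sum>n\<in>N'. 1 / real n)"
    unfolding sum_product sum.cartesian_product by (intro sum.cong) auto
  also have "\<dots> \<le> real q / real (totient q) * sieve_mass T"
  proof (intro mult_mono)
    show "(\<Sum>k\<in>S q. 1 / real k) \<le> real q / real (totient q)"
      unfolding S_def by (rule sum_reciprocal_smooth_le[OF assms(1)])
    have "(\<Sum>n\<in>N'. 1 / real n) \<le> (\<Sum>n\<in>(\<lambda>(t, k). t * k) ` (Sigma T S). 1 / real n)"
    proof (intro sum_mono2)
      show "N' \<subseteq> (\<lambda>(t, k). t * k) ` (Sigma T S)"
      proof
        fix n assume n: "n \<in> N'"
        then obtain t k where *: "n = t * k" "squarefree t" "prime_factors k \<subseteq> prime_factors t"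
          using exists_squarefree_kernel[of n] by (auto simp: N'_def)
        then have "k > 0" "t > 0" using n by (auto simp: N'_def intro: gr0I)
        moreover have "k \<le> n" "t \<le> n" using * \<open>k > 0\<close> \<open>t > 0\<close> by auto
        moreover have "n \<le> R" "coprime n q" using n by (auto simp: N'_def)
        moreover have "coprime t q" using \<open>coprime n q\<close> * by simp
        ultimately have "t \<in> T" "k \<in> S t" using *(2,3) by (simp_all add: S_def T_def)
        then show "n \<in> (\<lambda>(t, k). t * k) ` (Sigma T S)" using * by force
      qed
    qed (use fin in auto)
    also have "\<dots> \<le> (\<Sum>x\<in>Sigma T S. 1 / real (case x of (t, k) \<Rightarrow> t * k))"
      using sum_image_le[of "Sigma T S" "\<lambda>n. 1 / real n" "\<lambda>(t, k). t * k"] fin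
      by (auto simp: o_def)
    also have "\<dots> = (\<Sum>t\<in>T. \<Sum>k\<in>S t. 1 / real (t * k))"
      using fin by (subst sum.Sigma) (auto intro!: sum.cong)
    also have "\<dots> = (\<Sum>t\<in>T. 1 / real t * (\<Sum>k\<in>S t. 1 / real k))"
      by (simp add: sum_distrib_left)
    also have "\<dots> \<le> (\<Sum>t\<in>T. 1 / real t * (real t / real (totient t)))"
      unfolding S_def by (intro sum_mono mult_left_mono sum_reciprocal_smooth_le) (auto simp: T_def)
    also have "\<dots> = sieve_mass T" unfolding sieve_mass_def by (intro sum.cong) (auto simp: T_def)
    finally show "(\<Sum>n\<in>N'. 1 / real n) \<le> sieve_mass T" .
  qed (auto intro!: sum_nonneg)
  finally show ?thesis .
qed

lemma sieve_weight_prime: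
  assumes "prime p" "\<And>t. t \<in> T \<Longrightarrow> 0 < t \<and> t < p"
  shows "sieve_weight T p = sieve_mass T"
  unfolding sieve_weight_def sieve_mass_def
proof (intro sum.cong refl)
  fix t assume t: "t \<in> T"
  have "(\<Sum>d | d dvd t. of_bool (d dvd p) * (sieve_mu d * real d)) = (\<Sum>d\<in>{1}. sieve_mu d * real d)"
  proof (rule sum.mono_neutral_cong_right)
    show "\<forall>d\<in>{d. d dvd t} - {1}. of_bool (d dvd p) * (sieve_mu d * real d) = 0"
    proof
      fix d assume d: "d \<in> {d. d dvd t} - {1}"
      then have "d \<le> t" using assms(2)[OF t] by (auto intro: dvd_imp_le)
      then have "d \<noteq> p" using assms(2)[OF t] by auto
      then have "\<not> d dvd p" using d assms(1) by (auto simp: prime_nat_iff)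
      then show "of_bool (d dvd p) * (sieve_mu d * real d) = 0" by simp
    qed
  qed (use assms(2)[OF t] in auto)
  then show "1 / real (totient t) * (\<Sum>d | d dvd t. of_bool (d dvd p) * (sieve_mu d * real d)) = 1 / real (totient t)"
    by (simp add: sieve_mu_def)
qed

text \<open>
At each prime the squared sieve weight is the square of the mass, so the second moment over the
progression \<open>b + q k\<close> bounds the number of primes in it.
\<close>

lemma brun_titchmarsh_sieve_level:
  fixes q b R :: nat and H :: real
  assumes "q > 0" "R \<ge> 1" "real R \<le> H" "real q \<le> H"
  defines "P \<equiv> {p. prime p \<and> H < real p \<and> real p \<le> 2 * H \<and> p mod q = b}"
  shows "real (card P) \<le> 4 * H / (real (totient q) * ln (real R + 1)) + real R ^ 4"
proof -
  define T where "T = {t. 1 \<le> t \<and> t \<le> R \<and> squarefree t \<and> coprime t q}"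
  define G where "G = sieve_mass T"
  define lo where "lo = nat \<lfloor>H\<rfloor> div q"
  define len where "len = nat \<lfloor>2 * H\<rfloor> div q + 1 - lo"
  have H0: "H > 0" using assms by linarith
  have phi: "real (totient q) > 0" using assms(1) by simp
  have lnR: "ln (real R + 1) > 0" using assms(2) by simp
  have G: "ln (real R + 1) \<le> real q / real (totient q) * G"
    unfolding G_def T_def by (rule sieve_mass_ge[OF assms(1)])
  have G0: "G > 0"
  proof (rule ccontr)
    assume "\<not> G > 0"
    then have "real q / real (totient q) * G \<le> 0" by (intro mult_nonneg_nonpos) auto
    then show False using G lnR by linarith
  qed
  have lolen: "lo + len = nat \<lfloor>2 * H\<rfloor> div q + 1"
  proof -
    have "nat \<lfloor>H\<rfloor> \<le> nat \<lfloor>2 * H\<rfloor>" using H0 by (intro nat_mono floor_mono) auto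
    then have "lo \<le> nat \<lfloor>2 * H\<rfloor> div q" unfolding lo_def by (rule div_le_mono)
    then show ?thesis by (simp add: len_def)
  qed
  have len: "real len \<le> 4 * H / q"
  proof -
    have "real (nat \<lfloor>2 * H\<rfloor> div q) \<le> real (nat \<lfloor>2 * H\<rfloor>) / q" by (rule of_nat_div_le_of_nat)
    also have "\<dots> \<le> 2 * H / q" using H0 by (intro divide_right_mono) auto
    finally have 1: "real (nat \<lfloor>2 * H\<rfloor> div q) \<le> 2 * H / q" .
    have "1 \<le> H / q" using assms by (simp add: field_simps)
    moreover have "real len \<le> real (nat \<lfloor>2 * H\<rfloor> div q) + 1" unfolding len_def by linarith
    ultimately have "real len \<le> 2 * H / q + H / q" using 1 by linarith
    also have "\<dots> \<le> 4 * H / q" using H0 assms(1) by (simp add: field_simps)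
    finally show ?thesis .
  qed
  have Psub: "P \<subseteq> {..nat \<lfloor>2 * H\<rfloor>}" unfolding P_def using H0 by (auto simp: le_nat_floor)
  then have finP: "finite P" by (rule finite_subset) auto
  have "real (card P) * G\<^sup>2 = (\<Sum>p\<in>P. (sieve_weight T p)\<^sup>2)"
  proof -
    have "sieve_weight T p = G" if "p \<in> P" for p
      unfolding G_def
    proof (rule sieve_weight_prime)
      show "prime p" using that by (simp add: P_def)
      fix t assume "t \<in> T"
      then have "0 < t" "real t \<le> real R" by (auto simp: T_def)
      moreover have "H < real p" using that by (simp add: P_def)
      ultimately show "0 < t \<and> t < p" using assms(3) by linarith
    qed
    then show ?thesis by simp
  qed
  also have "\<dots> = (\<Sum>k\<in>(\<lambda>p. p div q) ` P. (sieve_weight T (b + q * k))\<^sup>2)"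
  proof -
    have eq: "b + q * (p div q) = p" if "p \<in> P" for p
    proof -
      have "p mod q = b" using that by (simp add: P_def)
      then show ?thesis using mod_mult_div_eq[of p q] by simp
    qed
    have "inj_on (\<lambda>p. p div q) P" by (rule inj_onI) (metis eq)
    then show ?thesis using eq by (subst sum.reindex) auto
  qed
  also have "\<dots> \<le> (\<Sum>k\<in>{lo..<lo + len}. (sieve_weight T (b + q * k))\<^sup>2)"
  proof (rule sum_mono2)
    show "(\<lambda>p. p div q) ` P \<subseteq> {lo..<lo + len}"
    proof clarify
      fix p assume p: "p \<in> P"
      then have "p \<le> nat \<lfloor>2 * H\<rfloor>" using Psub by auto
      then have 1: "p div q \<le> nat \<lfloor>2 * H\<rfloor> div q" by (rule div_le_mono)
      have "nat \<lfloor>H\<rfloor> \<le> p" using p H0 unfolding P_def by (simp add: nat_le_iff floor_le_iff)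
      then have "lo \<le> p div q" unfolding lo_def by (rule div_le_mono)
      then show "p div q \<in> {lo..<lo + len}" using 1 lolen by simp
    qed
  qed auto
  also have "\<dots> \<le> real len * G + real R ^ 4 * G\<^sup>2"
    unfolding G_def by (rule sieve_second_moment) (auto simp: T_def)
  also have "\<dots> = (real len / G + real R ^ 4) * G\<^sup>2"
    using G0 by (simp add: field_simps power2_eq_square)
  finally have "real (card P) \<le> real len / G + real R ^ 4" using G0 by simp
  moreover have "real len / G \<le> 4 * H / (real (totient q) * ln (real R + 1))"
  proof -
    have "real len / G \<le> (4 * H / q) / G" using len G0 by (intro divide_right_mono) auto
    also have "\<dots> = 4 * H / (real q * G)" by simp
    also have "\<dots> \<le> 4 * H / (real (totient q) * ln (real R + 1))"
      using G G0 phi lnR H0 by (intro divide_left_mono) (auto simp: field_simps)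
    finally show ?thesis .
  qed
  ultimately show ?thesis by linarith
qed

lemma brun_titchmarsh:
  fixes q b :: nat and H :: real
  assumes "q > 0" "H \<ge> 2" "real q powr (3/2) \<le> H"
  shows "real (card {p. prime p \<and> H < real p \<and> real p \<le> 2 * H \<and> p mod q = b})
         \<le> 102 * H / (real (totient q) * ln H)"
proof -
  define Y where "Y = H / real q"
  \<comment> \<open>With this sieve level the error \<open>R^4\<close> is at most \<open>Y^(1/2)\<close>.\<close>
  define R where "R = nat \<lfloor>Y powr (1/8)\<rfloor>"
  have q1: "real q \<ge> 1" using assms(1) by simp
  have phi: "real (totient q) > 0" "real (totient q) \<le> q" using assms(1) by (auto simp: totient_le)
  have H0: "H > 0" and lnH: "ln H > 0" using assms by auto
  have qH: "real q \<le> H powr (2/3)"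
  proof -
    have "(real q powr (3/2)) powr (2/3) \<le> H powr (2/3)" using assms by (intro powr_mono2) auto
    then show ?thesis using q1 by (simp add: powr_powr)
  qed
  have YH: "H powr (1/3) \<le> Y"
  proof -
    have "H powr (1/3) * real q \<le> H powr (1/3) * H powr (2/3)" using qH by (intro mult_left_mono) auto
    also have "\<dots> = H" using H0 by (simp flip: powr_add)
    finally show ?thesis using q1 by (simp add: Y_def field_simps)
  qed
  have "1 \<le> H powr (1/3)" using assms by (intro ge_one_powr_ge_zero) auto
  then have Y1: "Y \<ge> 1" using YH by linarith
  have R: "real R \<le> Y powr (1/8)" "Y powr (1/8) \<le> real R + 1"
    unfolding R_def by (auto intro: real_of_int_floor_add_one_ge)
  have R1: "R \<ge> 1"
    using Y1 ge_one_powr_ge_zero[of Y "1/8"] unfolding R_def by (simp add: le_nat_floor)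
  have YleH: "Y \<le> H" using q1 H0 by (simp add: Y_def field_simps)
  have "Y powr (1/8) \<le> Y powr 1" using Y1 by (intro powr_mono) auto
  then have RH: "real R \<le> H" using R YleH Y1 by simp
  have "real q \<le> H" 
    using Y1 q1 by (simp add: Y_def field_simps)
  then have main: "real (card {p. prime p \<and> H < real p \<and> real p \<le> 2 * H \<and> p mod q = b})
     \<le> 4 * H / (real (totient q) * ln (real R + 1)) + real R ^ 4"
    by (intro brun_titchmarsh_sieve_level assms R1 RH)
  have lnR: "ln H / 24 \<le> ln (real R + 1)"
  proof -
    have "ln H / 24 = ln (H powr (1/3)) / 8" using H0 by (simp add: ln_powr)
    also have "\<dots> \<le> ln Y / 8"
      using YH H0 Y1 by (intro divide_right_mono, subst ln_le_cancel_iff) (simp_all del: ln_powr)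
    also have "\<dots> = ln (Y powr (1/8))" using Y1 by (simp add: ln_powr)
    also have "\<dots> \<le> ln (real R + 1)" using R Y1 by (intro ln_mono) auto
    finally show ?thesis .
  qed
  have t1: "4 * H / (real (totient q) * ln (real R + 1)) \<le> 96 * H / (real (totient q) * ln H)"
  proof -
    have "4 * H / (real (totient q) * ln (real R + 1)) \<le> 4 * H / (real (totient q) * (ln H / 24))"
      using lnR lnH phi H0 R1 by (intro divide_left_mono mult_left_mono mult_pos_pos) auto
    then show ?thesis by simp
  qed
  have t2: "real R ^ 4 \<le> 6 * H / (real (totient q) * ln H)"
  proof -
    have "real R ^ 4 \<le> (Y powr (1/8)) ^ 4" using R by (intro power_mono) auto
    also have "\<dots> = Y powr (1/2)" using Y1 by (simp add: powr_powr flip: powr_numeral powr_realpow)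
    finally have a: "real R ^ 4 \<le> Y powr (1/2)" .
    have "ln H = 6 * ln (H powr (1/6))" using H0 by (simp add: ln_powr)
    also have "\<dots> \<le> 6 * H powr (1/6)" using ln_le_minus_one[of "H powr (1/6)"] H0 by simp
    also have "H powr (1/6) = (H powr (1/3)) powr (1/2)" by (simp add: powr_powr)
    also have "\<dots> \<le> Y powr (1/2)" using YH by (intro powr_mono2) auto
    finally have b: "ln H \<le> 6 * Y powr (1/2)" by simp
    have "real R ^ 4 * ln H \<le> Y powr (1/2) * (6 * Y powr (1/2))"
      using a b lnH by (intro mult_mono) auto
    also have "\<dots> = 6 * Y" using Y1 by (simp flip: powr_add)
    finally have "real R ^ 4 * ln H * real (totient q) \<le> 6 * Y * real q"
      using phi Y1 lnH by (rule_tac mult_mono) auto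
    also have "\<dots> = 6 * H" using q1 by (simp add: Y_def)
    finally show ?thesis using phi lnH by (simp add: field_simps)
  qed
  have "real (card {p. prime p \<and> H < real p \<and> real p \<le> 2 * H \<and> p mod q = b})
      \<le> 96 * H / (real (totient q) * ln H) + 6 * H / (real (totient q) * ln H)"
    using main t1 t2 by (meson add_mono order.trans)
  also have "\<dots> = 102 * H / (real (totient q) * ln H)"
    unfolding add_divide_distrib[symmetric] by simp
  finally show ?thesis .
qed

section \<open>Bounds of Chebyshev, Mertens and Rankin\<close>

lemma finite_primes_upto [simp]: "finite {p. prime p \<and> P p \<and> real p \<le> x}"
  by (rule finite_subset[of _ "{..nat \<lfloor>x\<rfloor>}"]) (auto simp: le_nat_floor)

lemma finite_nat_upto_real [simp]: "finite {m. 1 \<le> m \<and> real m \<le> x}"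
  by (rule finite_subset[of _ "{..nat \<lfloor>x\<rfloor>}"]) (auto simp: le_nat_floor)

lemma chebyshev_dyadic:
  fixes H :: real
  assumes "H \<ge> 2"
  shows "real (card {p. prime p \<and> H < real p \<and> real p \<le> 2 * H}) \<le> 102 * H / ln H"
  using brun_titchmarsh[of 1 H 0] assms by simp

lemma sum_reciprocal_primes_dyadic:
  fixes H :: real
  assumes "H \<ge> 2"
  shows "(\<Sum>p | prime p \<and> H < real p \<and> real p \<le> 2 * H. 1 / real p) \<le> 102 / ln H"
proof -
  have "(\<Sum>p | prime p \<and> H < real p \<and> real p \<le> 2 * H. 1 / real p)
      \<le> (\<Sum>p | prime p \<and> H < real p \<and> real p \<le> 2 * H. 1 / H)"
    using assms by (intro sum_mono divide_left_mono) auto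
  also have "\<dots> = real (card {p. prime p \<and> H < real p \<and> real p \<le> 2 * H}) * (1 / H)" by simp
  also have "\<dots> \<le> 102 * H / ln H * (1 / H)"
    using chebyshev_dyadic[OF assms] assms by (intro mult_right_mono) auto
  also have "\<dots> = 102 / ln H" using assms by simp
  finally show ?thesis .
qed

lemma chebyshev_theta: "(\<Sum>p | prime p \<and> p \<le> n. ln (real p)) \<le> 204 * real n"
proof (induction n rule: less_induct)
  case (less n)
  have fin: "finite {p. prime p \<and> p \<le> m}" for m :: nat by (rule finite_subset[of _ "{..m}"]) auto
  show ?case
  proof (cases "n < 4")
    case True
    have "(\<Sum>p | prime p \<and> p \<le> n. ln (real p)) \<le> (\<Sum>p\<in>{1..n}. 3)"
    proof (rule order.trans[OF sum_mono2 sum_mono])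
      show "{p. prime p \<and> p \<le> n} \<subseteq> {1..n}" using prime_ge_1_nat by auto
      fix p assume "p \<in> {1..n}"
      then show "ln (real p) \<le> 3" using True ln_le_minus_one[of "real p"] by auto
    qed auto
    then show ?thesis by simp
  next
    case False
    define H where "H = real n / 2"
    have H: "H \<ge> 2" using False by (simp add: H_def)
    have "{p. prime p \<and> p \<le> n} \<subseteq> {p. prime p \<and> p \<le> n div 2} \<union> {p. prime p \<and> H < real p \<and> real p \<le> 2 * H}"
    proof
      fix p assume p: "p \<in> {p. prime p \<and> p \<le> n}"
      show "p \<in> {p. prime p \<and> p \<le> n div 2} \<union> {p. prime p \<and> H < real p \<and> real p \<le> 2 * H}"
      proof (cases "p \<le> n div 2")
        case False
        then have "n < 2 * p" by linarith
        then have "real n < 2 * real p" by linarith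
        then show ?thesis using p by (auto simp: H_def)
      qed (use p in auto)
    qed
    then have "(\<Sum>p | prime p \<and> p \<le> n. ln (real p)) \<le>
       (\<Sum>p\<in>{p. prime p \<and> p \<le> n div 2} \<union> {p. prime p \<and> H < real p \<and> real p \<le> 2 * H}. ln (real p))"
      using fin prime_ge_1_nat by (intro sum_mono2) auto
    also have "\<dots> \<le> (\<Sum>p | prime p \<and> p \<le> n div 2. ln (real p)) +
        (\<Sum>p | prime p \<and> H < real p \<and> real p \<le> 2 * H. ln (real p))"
      using fin prime_ge_1_nat by (subst sum_Un) (auto intro!: sum_nonneg)
    also have "(\<Sum>p | prime p \<and> p \<le> n div 2. ln (real p)) \<le> 204 * real (n div 2)"
      using False by (intro less.IH) auto
    also have "204 * real (n div 2) \<le> 102 * real n" by linarith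
    also have "(\<Sum>p | prime p \<and> H < real p \<and> real p \<le> 2 * H. ln (real p)) \<le>
        (\<Sum>p | prime p \<and> H < real p \<and> real p \<le> 2 * H. 2 * ln H)"
    proof (intro sum_mono)
      fix p assume p: "p \<in> {p. prime p \<and> H < real p \<and> real p \<le> 2 * H}"
      then have "ln (real p) \<le> ln (H\<^sup>2)"
        using H by (intro ln_mono) (auto simp: power2_eq_square intro: order.trans[of _ "2 * H"])
      then show "ln (real p) \<le> 2 * ln H" using H by (simp add: ln_realpow)
    qed
    also have "\<dots> = real (card {p. prime p \<and> H < real p \<and> real p \<le> 2 * H}) * (2 * ln H)" by simp
    also have "\<dots> \<le> 102 * H / ln H * (2 * ln H)"
      using chebyshev_dyadic[OF H] H by (intro mult_right_mono) auto
    also have "\<dots> = 102 * real n" using H by (simp add: H_def)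
    finally show ?thesis by simp
  qed
qed

lemma sum_ln_prime_factors_le:
  assumes "m > 0"
  shows "(\<Sum>p\<in>prime_factors m. ln (real p)) \<le> ln (real m)"
proof -
  have "(\<Prod>p\<in>prime_factors m. real p) \<le> (\<Prod>p\<in>prime_factors m. real p ^ multiplicity p m)"
  proof (intro prod_mono conjI)
    fix p assume p: "p \<in> prime_factors m"
    then have "real p ^ 1 \<le> real p ^ multiplicity p m"
      by (intro power_increasing)
         (auto simp: prime_factors_multiplicity prime_ge_1_nat prime_gt_0_nat Suc_le_eq)
    then show "real p \<le> real p ^ multiplicity p m" by simp
  qed auto
  also have "\<dots> = real (\<Prod>p\<in>prime_factors m. p ^ multiplicity p m)" by simp
  also have "\<dots> = real m" using assms by (subst prime_factorization_nat[symmetric]) auto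
  finally have le: "(\<Prod>p\<in>prime_factors m. real p) \<le> real m" .
  have pos: "(\<Prod>p\<in>prime_factors m. real p) > 0"
    by (intro prod_pos) (auto dest: in_prime_factors_imp_prime prime_gt_0_nat)
  have "(\<Sum>p\<in>prime_factors m. ln (real p)) = ln (\<Prod>p\<in>prime_factors m. real p)"
    by (subst ln_prod) (auto dest: in_prime_factors_imp_prime prime_gt_0_nat)
  also have "\<dots> \<le> ln (real m)" using le pos assms by (subst ln_le_cancel_iff) auto
  finally show ?thesis .
qed

text \<open>
Legendre's argument: \<open>ln m\<close> is at least the sum of \<open>ln p\<close> over the primes dividing \<open>m\<close>, and summing
this over \<open>m \<le> n\<close> counts \<open>ln p\<close> about \<open>n/p\<close> times.  Rounding \<open>n/p\<close> costs \<open>\<theta>(n) = O(n)\<close>.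
\<close>

lemma mertens_log:
  assumes "n \<ge> 1"
  shows "(\<Sum>p | prime p \<and> p \<le> n. ln (real p) / real p) \<le> ln (real n) + 204"
proof -
  define Q where "Q = {p. prime p \<and> p \<le> n}"
  have fin: "finite Q" unfolding Q_def by (rule finite_subset[of _ "{..n}"]) auto
  have pos: "p > 0" "ln (real p) \<ge> 0" if "p \<in> Q" for p
    using that prime_gt_0_nat prime_ge_1_nat by (auto simp: Q_def)
  have "real n * (\<Sum>p\<in>Q. ln (real p) / real p) = (\<Sum>p\<in>Q. real n / real p * ln (real p))"
    by (simp add: sum_distrib_left)
  also have "\<dots> \<le> (\<Sum>p\<in>Q. (\<Sum>m\<in>{1..n}. of_bool (p dvd m) * ln (real p)) + ln (real p))"
  proof (intro sum_mono)
    fix p assume p: "p \<in> Q"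
    have "real n / real p \<le> real (n div p) + 1"
    proof -
      have "n \<le> p * (n div p + 1)" using dividend_less_times_div[of p n] pos[OF p] by simp
      then have "real n \<le> real p * (real (n div p) + 1)"
        by (metis of_nat_1 of_nat_add of_nat_le_iff of_nat_mult)
      then show ?thesis using pos[OF p] by (simp add: field_simps)
    qed
    also have "real (n div p) = real (card ((\<lambda>k. p * k) ` {1..n div p}))"
      using pos[OF p] by (subst card_image) (auto simp: inj_on_def)
    also have "\<dots> \<le> real (card {m\<in>{1..n}. p dvd m})"
    proof -
      have "(\<lambda>k. p * k) ` {1..n div p} \<subseteq> {m\<in>{1..n}. p dvd m}"
        using pos[OF p] by (auto simp: less_eq_div_iff_mult_less_eq mult.commute)
      then show ?thesis by (intro of_nat_mono card_mono) auto
    qed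
    also have "real (card {m\<in>{1..n}. p dvd m}) = (\<Sum>m\<in>{1..n}. of_bool (p dvd m))"
      by (simp add: of_bool_def sum.If_cases Int_def)
    finally have "real n / real p * ln (real p) \<le> ((\<Sum>m\<in>{1..n}. of_bool (p dvd m)) + 1) * ln (real p)"
      using pos[OF p] by (intro mult_right_mono) auto
    then show "real n / real p * ln (real p) \<le> (\<Sum>m\<in>{1..n}. of_bool (p dvd m) * ln (real p)) + ln (real p)"
      by (simp only: distrib_right sum_distrib_right mult_1)
  qed
  also have "\<dots> = (\<Sum>m\<in>{1..n}. \<Sum>p\<in>Q. of_bool (p dvd m) * ln (real p)) + (\<Sum>p\<in>Q. ln (real p))"
    unfolding sum.distrib by (subst sum.swap) simp
  also have "(\<Sum>m\<in>{1..n}. \<Sum>p\<in>Q. of_bool (p dvd m) * ln (real p)) \<le> (\<Sum>m\<in>{1..n}. ln (real n))"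
  proof (intro sum_mono)
    fix m assume m: "m \<in> {1..n}"
    have "(\<Sum>p\<in>Q. of_bool (p dvd m) * ln (real p)) = (\<Sum>p\<in>prime_factors m. ln (real p))"
    proof (rule sum.mono_neutral_cong_right[OF fin])
      show "prime_factors m \<subseteq> Q"
        using m by (auto simp: Q_def in_prime_factors_iff dest!: dvd_imp_le)
      show "\<forall>p\<in>Q - prime_factors m. of_bool (p dvd m) * ln (real p) = 0"
        using m by (auto simp: Q_def in_prime_factors_iff)
    qed (auto simp: in_prime_factors_iff)
    also have "\<dots> \<le> ln (real m)" using m by (intro sum_ln_prime_factors_le) auto
    also have "\<dots> \<le> ln (real n)" using m by auto
    finally show "(\<Sum>p\<in>Q. of_bool (p dvd m) * ln (real p)) \<le> ln (real n)" .
  qed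
  also have "(\<Sum>p\<in>Q. ln (real p)) \<le> 204 * real n" unfolding Q_def by (rule chebyshev_theta)
  finally have "real n * (\<Sum>p\<in>Q. ln (real p) / real p) \<le> real n * (ln (real n) + 204)"
    by (simp add: algebra_simps)
  then show ?thesis using assms by (simp add: Q_def)
qed

lemma primes_upto_Suc:
  "{p. prime p \<and> p \<le> Suc N} = (if prime (Suc N) then insert (Suc N) {p. prime p \<and> p \<le> N} else {p. prime p \<and> p \<le> N})"
  by (auto simp: le_Suc_eq)

text \<open>
Partial summation against \<open>1/ln N\<close>, as an induction on \<open>N\<close>.  When \<open>N + 1\<close> is prime its two contributions
to the left side cancel, so the left side grows only through the change of \<open>1/ln N\<close>.  By \<open>mertens_log\<close> this
growth is at most \<open>1 - ln N / ln (N+1)\<close>, which is dominated by the growth of \<open>ln ln N\<close>, plus a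
telescoping error.
\<close>

lemma mertens_reciprocal_aux:
  assumes "N \<ge> 2"
  shows "(\<Sum>p | prime p \<and> p \<le> N. 1 / real p) - (\<Sum>p | prime p \<and> p \<le> N. ln (real p) / real p) / ln (real N)
    \<le> ln (ln (real N)) - ln (ln 2) + 204 * (1 / ln 2 - 1 / ln (real N))"
  using assms
proof (induction N rule: dec_induct)
  case base
  have "{p. prime p \<and> p \<le> (2::nat)} = {2}" using prime_ge_2_nat by (auto intro: antisym)
  then show ?case by simp
next
  case (step N)
  define A where "A = (\<Sum>p | prime p \<and> p \<le> N. ln (real p) / real p)"
  define S where "S = (\<Sum>p | prime p \<and> p \<le> N. 1 / real p)"
  define l where "l = ln (real N)"
  define l' where "l' = ln (real (Suc N))"
  have fin: "finite {p. prime p \<and> p \<le> N}" by (rule finite_subset[of _ "{..N}"]) auto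
  have l: "0 < l" "l < l'" using step.hyps unfolding l_def l'_def by auto
  have A: "A \<le> l + 204" unfolding A_def l_def using step.hyps by (intro mertens_log) auto
  have eq: "(\<Sum>p | prime p \<and> p \<le> Suc N. 1 / real p) - (\<Sum>p | prime p \<and> p \<le> Suc N. ln (real p) / real p) / l'
     = S - A / l'"
  proof (cases "prime (Suc N)")
    case True
    have "Suc N \<notin> {p. prime p \<and> p \<le> N}" by auto
    then have 1: "(\<Sum>p | prime p \<and> p \<le> Suc N. 1 / real p) = 1 / real (Suc N) + S"
      and 2: "(\<Sum>p | prime p \<and> p \<le> Suc N. ln (real p) / real p) = l' / real (Suc N) + A"
      unfolding primes_upto_Suc S_def A_def l'_def using True fin by (simp_all del: of_nat_Suc)
    show ?thesis unfolding 1 2 using l by (simp add: add_divide_distrib del: of_nat_Suc)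
  next
    case False
    then show ?thesis unfolding primes_upto_Suc S_def A_def by simp
  qed
  have "A * (1 / l - 1 / l') \<le> (l + 204) * (1 / l - 1 / l')"
    using A l by (intro mult_right_mono) (auto simp: field_simps)
  also have "\<dots> = (1 - l / l') + 204 * (1 / l - 1 / l')" using l by (simp add: field_simps)
  also have "1 - l / l' \<le> ln l' - ln l"
  proof -
    have "ln (l / l') \<le> l / l' - 1" using l by (intro ln_le_minus_one) auto
    then show ?thesis using l by (simp add: ln_div)
  qed
  finally have inc: "A / l - A / l' \<le> ln l' - ln l + 204 * (1 / l - 1 / l')"
    by (simp add: right_diff_distrib)
  have IH: "S - A / l \<le> ln l - ln (ln 2) + 204 * (1 / ln 2 - 1 / l)"
    using step.IH by (simp add: S_def A_def l_def)
  have "S - A / l' \<le> ln l' - ln (ln 2) + 204 * (1 / ln 2 - 1 / l')"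
    using inc IH by (simp add: right_diff_distrib)
  then show ?case using eq by (simp add: l'_def)
qed

lemma mertens_reciprocal:
  "\<exists>C. \<forall>x\<ge>2. (\<Sum>p | prime p \<and> real p \<le> x. 1 / real p) \<le> ln (ln x) + C"
proof (intro exI allI impI)
  fix x :: real assume x: "x \<ge> 2"
  define N where "N = nat \<lfloor>x\<rfloor>"
  have N2: "N \<ge> 2" using x by (simp add: N_def le_nat_floor)
  have Nx: "real N \<le> x" using x by (simp add: N_def)
  have set: "{p. prime p \<and> real p \<le> x} = {p. prime p \<and> p \<le> N}"
    using x Nx order.trans[OF of_nat_mono Nx] by (auto simp: N_def le_nat_floor)
  have lN: "ln (real N) > 0" using N2 by auto
  have "(\<Sum>p | prime p \<and> p \<le> N. ln (real p) / real p) / ln (real N) \<le> (ln (real N) + 204) / ln (real N)"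
    using N2 lN by (intro divide_right_mono mertens_log) auto
  also have "\<dots> = 1 + 204 * (1 / ln (real N))" using lN by (simp add: field_simps)
  finally have "(\<Sum>p | prime p \<and> p \<le> N. 1 / real p) \<le> ln (ln (real N)) + (1 - ln (ln 2) + 204 * (1 / ln 2))"
    using mertens_reciprocal_aux[OF N2] by (simp add: right_diff_distrib)
  also have "ln (ln (real N)) \<le> ln (ln x)" using N2 Nx lN x by (intro ln_mono) auto
  finally show "(\<Sum>p | prime p \<and> real p \<le> x. 1 / real p) \<le> ln (ln x) + (1 - ln (ln 2) + 204 * (1 / ln 2))"
    unfolding set by simp
qed

text \<open>
\<open>q/\<phi>(q)\<close> is the product of \<open>1 + 1/(p-1)\<close> over the primes dividing \<open>q\<close>, so it suffices to bound the sum of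
\<open>1/p\<close> over these primes.  Those up to \<open>z\<close> are covered by Mertens; there are \<open>O(z)\<close> in all, so those above
\<open>z\<close> contribute \<open>O(1)\<close>.
\<close>

lemma totient_ratio_bound:
  "\<exists>C>0. \<forall>z\<ge>2. \<forall>q::nat. q > 0 \<longrightarrow> ln (real q) \<le> z \<longrightarrow> real q / real (totient q) \<le> C * ln z"
proof -
  obtain C where C: "\<And>x. x \<ge> 2 \<Longrightarrow> (\<Sum>p | prime p \<and> real p \<le> x. 1 / real p) \<le> ln (ln x) + C"
    using mertens_reciprocal by blast
  show ?thesis
  proof (intro exI[of _ "exp (C + 1 / ln 2 + 1)"] conjI allI impI)
    fix z :: real and q :: nat
    assume z: "z \<ge> 2" and q: "q > 0" and lq: "ln (real q) \<le> z"
    let ?P = "prime_factors q"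
    have pr: "p \<ge> 2" "prime p" if "p \<in> ?P" for p
      using that in_prime_factors_imp_prime prime_ge_2_nat by blast+
    have cardP: "real (card ?P) * ln 2 \<le> z"
    proof -
      have "real (card ?P) * ln 2 = (\<Sum>p\<in>?P. ln 2)" by simp
      also have "\<dots> \<le> (\<Sum>p\<in>?P. ln (real p))"
      proof (intro sum_mono)
        fix p assume "p \<in> ?P"
        then have "real p \<ge> 2" using pr(1)[of p] by simp
        then show "ln 2 \<le> ln (real p)" by (subst ln_le_cancel_iff) auto
      qed
      also have "\<dots> \<le> ln (real q)" using q by (rule sum_ln_prime_factors_le)
      finally show ?thesis using lq by linarith
    qed
    have rec: "(\<Sum>p\<in>?P. 1 / real p) \<le> ln (ln z) + C + 1 / ln 2"
    proof -
      have "(\<Sum>p\<in>?P. 1 / real p) \<le> (\<Sum>p\<in>{p. prime p \<and> real p \<le> z} \<union> {p\<in>?P. z < real p}. 1 / real p)"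
        using pr(2) finite_primes_upto[of "\<lambda>_. True" z] by (intro sum_mono2) auto
      also have "\<dots> \<le> (\<Sum>p | prime p \<and> real p \<le> z. 1 / real p) + (\<Sum>p | p \<in> ?P \<and> z < real p. 1 / real p)"
        using finite_primes_upto[of "\<lambda>_. True" z] by (subst sum_Un) (auto intro!: sum_nonneg)
      also have "(\<Sum>p | p \<in> ?P \<and> z < real p. 1 / real p) \<le> (\<Sum>p | p \<in> ?P \<and> z < real p. 1 / z)"
        using z by (intro sum_mono divide_left_mono) auto
      also have "\<dots> \<le> (\<Sum>p\<in>?P. 1 / z)" using z by (intro sum_mono2) auto
      also have "\<dots> \<le> 1 / ln 2" using cardP z by (simp add: field_simps)
      finally show ?thesis using C[OF z] by linarith
    qed
    have tel: "(\<Sum>p\<in>?P. 1 / (real p * (real p - 1))) \<le> 1"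
    proof -
      have *: "(\<Sum>n=2..N. 1 / (real n * (real n - 1))) \<le> 1 - 1 / real (max 1 N)" for N :: nat
      proof (induction N)
        case (Suc N)
        show ?case
        proof (cases "N = 0")
          case False
          then have "(\<Sum>n=2..Suc N. 1 / (real n * (real n - 1))) =
              (\<Sum>n=2..N. 1 / (real n * (real n - 1))) + 1 / (real (Suc N) * real N)" by simp
          also have "\<dots> \<le> 1 - 1 / real N + 1 / (real (Suc N) * real N)" using Suc False by (simp add: max_def)
          also have "\<dots> = 1 - 1 / real (max 1 (Suc N))"
            using False by (simp add: field_simps add_nonneg_eq_0_iff)
          finally show ?thesis .
        qed simp
      qed simp
      have "(\<Sum>p\<in>?P. 1 / (real p * (real p - 1))) \<le> (\<Sum>n=2..q. 1 / (real n * (real n - 1)))"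
        using pr(1) q by (intro sum_mono2) (auto dest!: dvd_imp_le simp: in_prime_factors_iff)
      also have "\<dots> \<le> 1" using *[of q] by (rule order.trans) simp
      finally show ?thesis .
    qed
    have "real q / real (totient q) = (\<Prod>p\<in>?P. 1 / (1 - 1 / real p))"
      using q unfolding totient_formula2 by (simp add: prod_dividef)
    also have "\<dots> \<le> (\<Prod>p\<in>?P. exp (1 / real p + 1 / (real p * (real p - 1))))"
    proof (intro prod_mono conjI)
      fix p assume p: "p \<in> ?P"
      have p2: "real p \<ge> 2" using pr(1)[OF p] by simp
      then show "0 \<le> 1 / (1 - 1 / real p)" by simp
      have "1 / (1 - 1 / real p) = 1 + (1 / real p + 1 / (real p * (real p - 1)))"
        using p2 by (simp add: field_simps)
      also have "\<dots> \<le> exp (1 / real p + 1 / (real p * (real p - 1)))" by (rule exp_ge_add_one_self)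
      finally show "1 / (1 - 1 / real p) \<le> exp (1 / real p + 1 / (real p * (real p - 1)))" .
    qed
    also have "\<dots> = exp ((\<Sum>p\<in>?P. 1 / real p) + (\<Sum>p\<in>?P. 1 / (real p * (real p - 1))))"
      by (simp add: exp_sum sum.distrib[symmetric])
    also have "\<dots> \<le> exp (ln (ln z) + (C + 1 / ln 2 + 1))" using rec tel by simp
    also have "\<dots> = exp (C + 1 / ln 2 + 1) * ln z" using z by (simp only: exp_add) simp
    finally show "real q / real (totient q) \<le> exp (C + 1 / ln 2 + 1) * ln z" .
  qed simp
qed

text \<open>
Rankin's method with the shift \<open>\<delta> = 1/ln y\<close>: for \<open>n > Z\<close> the term \<open>1/n\<close> is at most \<open>(n/Z)^\<delta>/n\<close>, and then
the restriction to \<open>n > Z\<close> is dropped.  For \<open>p \<le> y\<close> the factor \<open>p^\<delta>\<close> is at most the base of the natural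
logarithm, hence the Euler product is a power of \<open>ln y\<close>; any fixed exponent would do.
\<close>

lemma smooth_reciprocal_tail:
  "\<exists>C>0. \<forall>y\<ge>exp 2. \<forall>Z\<ge>1. \<forall>N::nat.
     (\<Sum>n | Z < real n \<and> n \<le> N \<and> (\<forall>p\<in>prime_factors n. real p \<le> y). 1 / real n)
       \<le> C * ln y ^ 12 * exp (- (ln Z / ln y))"
proof -
  obtain C where C: "\<And>x. x \<ge> 2 \<Longrightarrow> (\<Sum>p | prime p \<and> real p \<le> x. 1 / real p) \<le> ln (ln x) + C"
    using mertens_reciprocal by blast
  show ?thesis
  proof (intro exI[of _ "exp (12 * C)"] conjI allI impI)
    fix y Z :: real and N :: nat
    assume y: "y \<ge> exp 2" and Z: "Z \<ge> 1"
    have "ln (exp 2) \<le> ln y" using y by (subst ln_le_cancel_iff) (auto intro: less_le_trans[OF exp_gt_zero])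
    then have ly: "ln y \<ge> 2" by simp
    have y2: "y \<ge> 2" using y exp_ge_add_one_self[of 2] by linarith
    define \<delta> where "\<delta> = 1 / ln y"
    have d: "0 < \<delta>" "\<delta> \<le> 1/2" using ly by (auto simp: \<delta>_def field_simps)
    define h where "h n = real n powr (\<delta> - 1)" for n
    define Q where "Q = {p. prime p \<and> real p \<le> y}"
    have finQ: "finite Q" using finite_primes_upto[of "\<lambda>_. True" y] by (simp add: Q_def)
    \<comment> \<open>The bound 3/4 serves to invert \<open>1 - h p\<close>, the bound \<open>3/p\<close> to apply Mertens.\<close>
    have hQ: "h p \<le> 3/4" "h p \<le> 3 / real p" "h p \<ge> 0" if "p \<in> Q" for p
    proof -
      have p: "real p \<ge> 2" "real p \<le> y" using that prime_ge_2_nat[of p] by (auto simp: Q_def)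
      have "h p \<le> real p powr (-1/2)" unfolding h_def using p d by (intro powr_mono) auto
      also have "\<dots> \<le> 2 powr (-1/2)" using p by (intro powr_mono2') auto
      also have "\<dots> \<le> 3/4"
      proof -
        have "(4/3 :: real) = sqrt ((4/3)\<^sup>2)" by simp
        also have "\<dots> \<le> sqrt 2" by (intro real_sqrt_le_mono) (simp add: power2_eq_square)
        finally have "4/3 \<le> 2 powr (1/2 :: real)" by (simp add: powr_half_sqrt)
        then show ?thesis by (simp add: powr_minus field_simps)
      qed
      finally show "h p \<le> 3/4" .
      have "real p powr \<delta> \<le> y powr \<delta>" using p d by (intro powr_mono2) auto
      also have "\<dots> = exp 1" using y2 ly by (simp add: powr_def \<delta>_def)
      also have "\<dots> \<le> 3" by (rule exp_le)
      finally have "real p powr \<delta> \<le> 3" .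
      then show "h p \<le> 3 / real p" using p by (simp add: h_def powr_diff divide_right_mono)
      show "h p \<ge> 0" by (simp add: h_def)
    qed
    define S where "S = {n. Z < real n \<and> n \<le> N \<and> (\<forall>p\<in>prime_factors n. real p \<le> y)}"
    have "(\<Sum>n\<in>S. 1 / real n) \<le> (\<Sum>n\<in>S. Z powr (-\<delta>) * h n)"
    proof (intro sum_mono)
      fix n assume "n \<in> S"
      then have n: "Z < real n" by (simp add: S_def)
      have "1 \<le> (real n / Z) powr \<delta>" using n Z d by (intro ge_one_powr_ge_zero) auto
      then have "1 / real n * 1 \<le> 1 / real n * (real n / Z) powr \<delta>" by (intro mult_left_mono) auto
      also have "\<dots> = Z powr (-\<delta>) * h n"
        using n Z by (simp add: h_def powr_divide powr_diff powr_minus field_simps)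
      finally show "1 / real n \<le> Z powr (-\<delta>) * h n" by simp
    qed
    also have "\<dots> = Z powr (-\<delta>) * (\<Sum>n\<in>S. h n)" by (simp add: sum_distrib_left)
    also have "\<dots> \<le> Z powr (-\<delta>) * (\<Sum>k | 1 \<le> k \<and> k \<le> N \<and> prime_factors k \<subseteq> Q. h k)"
    proof (intro mult_left_mono sum_mono2)
      show "finite {k. 1 \<le> k \<and> k \<le> N \<and> prime_factors k \<subseteq> Q}"
        by (rule finite_subset[of _ "{..N}"]) auto
      show "S \<subseteq> {k. 1 \<le> k \<and> k \<le> N \<and> prime_factors k \<subseteq> Q}"
        using Z by (auto simp: S_def Q_def Suc_le_eq dest: in_prime_factors_imp_prime intro: gr0I)
    qed (auto simp: h_def)
    also have "\<dots> \<le> Z powr (-\<delta>) * (\<Prod>p\<in>Q. 1 / (1 - h p))"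
    proof (intro mult_left_mono euler_product_bound finQ)
      fix p assume "p \<in> Q"
      then show "h p < 1" using hQ(1)[of p] by linarith
    qed (auto simp: h_def Q_def powr_mult)
    also have "\<dots> \<le> Z powr (-\<delta>) * (\<Prod>p\<in>Q. exp (12 * (1 / real p)))"
    proof (intro mult_left_mono prod_mono conjI)
      fix p assume p: "p \<in> Q"
      show "0 \<le> 1 / (1 - h p)" using hQ[OF p] by simp
      have "1 / (1 - h p) \<le> 1 + 4 * h p"
      proof -
        have "4 * h p * (3/4 - h p) \<ge> 0" using hQ[OF p] by (intro mult_nonneg_nonneg) auto
        then have "1 \<le> (1 + 4 * h p) * (1 - h p)" by (simp add: algebra_simps)
        then show ?thesis using hQ[OF p] by (subst pos_divide_le_eq) auto
      qed
      also have "\<dots> \<le> 1 + 12 * (1 / real p)" using hQ[OF p] by simp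
      also have "\<dots> \<le> exp (12 * (1 / real p))" by (rule exp_ge_add_one_self)
      finally show "1 / (1 - h p) \<le> exp (12 * (1 / real p))" .
    qed simp
    also have "(\<Prod>p\<in>Q. exp (12 * (1 / real p))) = exp (12 * (\<Sum>p\<in>Q. 1 / real p))"
      using finQ by (simp add: exp_sum sum_distrib_left)
    also have "Z powr (-\<delta>) * \<dots> \<le> Z powr (-\<delta>) * exp (12 * (ln (ln y) + C))"
      using C[OF y2] by (intro mult_left_mono) (auto simp: Q_def)
    also have "exp (12 * (ln (ln y) + C)) = exp (12 * C) * exp (ln (ln y)) ^ 12"
      by (simp add: exp_add distrib_left flip: exp_of_nat_mult)
    also have "exp (ln (ln y)) = ln y" using ly by simp
    also have "Z powr (-\<delta>) = exp (- (ln Z / ln y))" using Z by (simp add: powr_def \<delta>_def)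
    finally show "(\<Sum>n | Z < real n \<and> n \<le> N \<and> (\<forall>p\<in>prime_factors n. real p \<le> y). 1 / real n)
       \<le> exp (12 * C) * ln y ^ 12 * exp (- (ln Z / ln y))" by (simp add: S_def mult_ac)
  qed simp
qed

lemma half_le_ln_2: "1/2 \<le> ln (2::real)"
proof -
  have "ln (1/2 :: real) \<le> 1/2 - 1" by (rule ln_le_minus_one) auto
  then show ?thesis by (simp add: ln_div)
qed

section \<open>Bilinear sums over a dyadic block\<close>

lemma e_add: "e (s + t) = e s * e t"
  by (simp add: e_def distrib_left exp_add)

lemma norm_e [simp]: "norm (e t) = 1"
  by (simp add: e_def)

lemma e_0 [simp]: "e 0 = 1"
  by (simp add: e_def)

lemma e_of_nat_mult: "e (real n * t) = e t ^ n"
  by (induction n) (simp_all add: distrib_right e_add)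

lemma e_minus: "e (- t) = cnj (e t)"
  by (simp add: e_def exp_cnj)

lemma e_eq_1_iff: "e t = 1 \<longleftrightarrow> (\<exists>k::int. t = of_int k)"
  by (auto simp: e_def exp_eq_1)

lemma norm_e_diff_le: "norm (e s - e t) \<le> 2 * pi * \<bar>s - t\<bar>"
proof -
  have "e s = e t * e (s - t)" by (simp flip: e_add)
  then have "norm (e s - e t) = norm (e t * (e (s - t) - 1))" by (simp add: algebra_simps)
  also have "\<dots> = norm (exp (\<i> * of_real (2 * pi * (s - t))) - 1)"
    by (simp add: norm_mult e_def mult_ac)
  also have "\<dots> = 2 * \<bar>sin (2 * pi * (s - t) / 2)\<bar>"
    using dist_exp_i_1[of "2 * pi * (s - t)"] by simp
  also have "\<dots> \<le> 2 * \<bar>2 * pi * (s - t) / 2\<bar>" by (intro mult_left_mono abs_sin_x_le_abs_x) auto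
  also have "\<dots> = 2 * pi * \<bar>s - t\<bar>" by (simp add: abs_mult)
  finally show ?thesis .
qed

lemma additive_character_orthogonality:
  fixes q m m' :: nat and a :: int
  assumes "q > 0" "coprime a (int q)"
  shows "norm (\<Sum>b<q. e (real b * real m * (a / q)) * cnj (e (real b * real m' * (a / q))))
           \<le> (if m mod q = m' mod q then real q else 0)"
proof -
  define w where "w = e ((real m - real m') * (a / q))"
  have "(\<Sum>b<q. e (real b * real m * (a / q)) * cnj (e (real b * real m' * (a / q)))) = (\<Sum>b<q. w ^ b)"
  proof (intro sum.cong refl)
    fix b
    have "e (real b * real m * (a / q)) * cnj (e (real b * real m' * (a / q))) =
        e (real b * ((real m - real m') * (a / q)))"
      unfolding e_minus[symmetric] e_add[symmetric] by (simp add: algebra_simps diff_divide_distrib)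
    then show "e (real b * real m * (a / q)) * cnj (e (real b * real m' * (a / q))) = w ^ b"
      by (simp only: w_def e_of_nat_mult)
  qed
  moreover have "norm (\<Sum>b<q. w ^ b) \<le> (if m mod q = m' mod q then real q else 0)"
  proof (cases "m mod q = m' mod q")
    case True
    have "norm (\<Sum>b<q. w ^ b) \<le> (\<Sum>b<q. 1)" by (rule sum_norm_le) (simp add: w_def norm_power)
    then show ?thesis using True by simp
  next
    case False
    have "w \<noteq> 1"
    proof
      assume "w = 1"
      then obtain k :: int where k: "(real m - real m') * (a / q) = of_int k"
        unfolding w_def e_eq_1_iff by blast
      then have "of_int ((int m - int m') * a) = (of_int (k * int q) :: real)"
        using assms(1) by (simp add: field_simps)
      then have "(int m - int m') * a = k * int q" by (simp only: of_int_eq_iff)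
      then have "int q dvd (int m - int m') * a" by simp
      then have "int q dvd int m - int m'"
        using assms(2) by (simp add: coprime_dvd_mult_left_iff coprime_commute)
      then have "int m mod int q = int m' mod int q" by (simp add: mod_eq_dvd_iff)
      then show False using False by (simp flip: of_nat_mod)
    qed
    moreover have "w ^ q = 1"
    proof -
      have "w ^ q = e (of_int ((int m - int m') * a))"
        using assms(1) unfolding w_def e_of_nat_mult[symmetric] by simp
      also have "\<dots> = 1" unfolding e_eq_1_iff by blast
      finally show ?thesis .
    qed
    ultimately have "(\<Sum>b<q. w ^ b) = 0" by (simp add: geometric_sum)
    then show ?thesis using False by simp
  qed
  ultimately show ?thesis by simp
qed

text \<open>
Parseval modulo \<open>q\<close>: the mean square over all frequencies \<open>b a/q\<close> only sees pairs in the same residue class.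
\<close>

lemma exponential_sum_energy:
  fixes q :: nat and a :: int and c :: "nat \<Rightarrow> complex" and v :: "nat \<Rightarrow> real"
  assumes "q > 0" "coprime a (int q)" "finite A" "\<And>m. m \<in> A \<Longrightarrow> norm (c m) \<le> v m"
  shows "(\<Sum>b<q. (norm (\<Sum>m\<in>A. c m * e (real b * real m * (a / q))))\<^sup>2)
      \<le> real q * (\<Sum>m\<in>A. \<Sum>m'\<in>A. of_bool (m mod q = m' mod q) * (v m * v m'))"
proof -
  define E where "E b m = e (real b * real m * (a / q))" for b m :: nat
  have v0: "v m \<ge> 0" if "m \<in> A" for m using assms(4)[OF that] norm_ge_zero order.trans by blast
  have sq: "complex_of_real ((norm (\<Sum>m\<in>A. c m * E b m))\<^sup>2) =
      (\<Sum>m\<in>A. \<Sum>m'\<in>A. (c m * cnj (c m')) * (E b m * cnj (E b m')))" for b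
    unfolding complex_norm_square cnj_sum sum_product by (intro sum.cong refl) (simp add: mult_ac)
  have "complex_of_real (\<Sum>b<q. (norm (\<Sum>m\<in>A. c m * E b m))\<^sup>2) =
     (\<Sum>b<q. \<Sum>m\<in>A. \<Sum>m'\<in>A. (c m * cnj (c m')) * (E b m * cnj (E b m')))"
    unfolding of_real_sum sq ..
  also have "\<dots> = (\<Sum>m\<in>A. \<Sum>b<q. \<Sum>m'\<in>A. (c m * cnj (c m')) * (E b m * cnj (E b m')))"
    by (rule sum.swap)
  also have "\<dots> = (\<Sum>m\<in>A. \<Sum>m'\<in>A. \<Sum>b<q. (c m * cnj (c m')) * (E b m * cnj (E b m')))"
    by (intro sum.cong refl sum.swap)
  also have "\<dots> = (\<Sum>m\<in>A. \<Sum>m'\<in>A. (c m * cnj (c m')) * (\<Sum>b<q. E b m * cnj (E b m')))"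
    by (simp only: sum_distrib_left)
  finally have eq: "complex_of_real (\<Sum>b<q. (norm (\<Sum>m\<in>A. c m * E b m))\<^sup>2) = \<dots>" .
  have "(\<Sum>b<q. (norm (\<Sum>m\<in>A. c m * E b m))\<^sup>2) = norm (complex_of_real (\<Sum>b<q. (norm (\<Sum>m\<in>A. c m * E b m))\<^sup>2))"
    unfolding norm_of_real by (intro abs_of_nonneg[symmetric] sum_nonneg) auto
  also have "\<dots> \<le> (\<Sum>m\<in>A. \<Sum>m'\<in>A. norm ((c m * cnj (c m')) * (\<Sum>b<q. E b m * cnj (E b m'))))"
    unfolding eq by (intro order.trans[OF norm_sum] sum_mono norm_sum)
  also have "\<dots> \<le> (\<Sum>m\<in>A. \<Sum>m'\<in>A. real q * (of_bool (m mod q = m' mod q) * (v m * v m')))"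
  proof (intro sum_mono)
    fix m m' assume m: "m \<in> A" "m' \<in> A"
    have "norm ((c m * cnj (c m')) * (\<Sum>b<q. E b m * cnj (E b m'))) =
       (norm (c m) * norm (c m')) * norm (\<Sum>b<q. E b m * cnj (E b m'))"
      by (simp add: norm_mult)
    also have "\<dots> \<le> (v m * v m') * (if m mod q = m' mod q then real q else 0)"
      unfolding E_def using m assms(4) v0
      by (intro mult_mono[OF mult_mono] additive_character_orthogonality assms) auto
    finally show "norm ((c m * cnj (c m')) * (\<Sum>b<q. E b m * cnj (E b m')))
       \<le> real q * (of_bool (m mod q = m' mod q) * (v m * v m'))" by (auto split: if_splits simp: mult_ac)
  qed
  finally show ?thesis unfolding E_def by (simp only: sum_distrib_left)
qed

lemma sum_reciprocal_le:
  fixes V :: real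
  assumes "V \<ge> 1"
  shows "(\<Sum>m | 1 \<le> m \<and> real m \<le> V. 1 / real m) \<le> 1 + ln V"
proof -
  have *: "(\<Sum>m=1..n. 1 / real m) \<le> 1 + ln (real n)" if "n \<ge> 1" for n
    using that
  proof (induction n rule: dec_induct)
    case (step n)
    have "ln (real n / real (Suc n)) \<le> real n / real (Suc n) - 1"
      using step.hyps by (intro ln_le_minus_one) auto
    then have "1 / real (Suc n) \<le> ln (real (Suc n)) - ln (real n)"
      using step.hyps by (simp add: ln_div field_simps)
    then show ?case using step.IH by simp
  qed simp
  define n where "n = nat \<lfloor>V\<rfloor>"
  have n: "n \<ge> 1" "real n \<le> V" using assms by (auto simp: n_def le_nat_floor)
  have "{m. 1 \<le> m \<and> real m \<le> V} = {1..n}"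
    using n assms by (auto simp: n_def le_nat_floor intro: order.trans[OF of_nat_mono])
  then have "(\<Sum>m | 1 \<le> m \<and> real m \<le> V. 1 / real m) \<le> 1 + ln (real n)" using *[OF n(1)] by simp
  also have "ln (real n) \<le> ln V" using n by (subst ln_le_cancel_iff) auto
  finally show ?thesis by simp
qed

text \<open>
The terms are compared with a telescoping sum at half-integers, so that the bound \<open>2/U\<close> holds for
every positive \<open>U\<close>, including \<open>U < 1\<close>.
\<close>

lemma sum_reciprocal_squares_le:
  fixes U :: real
  assumes "U > 0" "finite A" "\<And>m. m \<in> A \<Longrightarrow> U < real m"
  shows "(\<Sum>m\<in>A. 1 / (real m)\<^sup>2) \<le> 2 / U"
proof -
  define m0 where "m0 = nat \<lfloor>U\<rfloor> + 1"
  have m0: "m0 \<ge> 1" "U < real m0"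
  proof -
    have "U < real_of_int \<lfloor>U\<rfloor> + 1" by (rule real_of_int_floor_add_one_gt)
    moreover have "real m0 = real_of_int \<lfloor>U\<rfloor> + 1" using assms(1) by (simp add: m0_def)
    ultimately show "U < real m0" by linarith
    show "m0 \<ge> 1" by (simp add: m0_def)
  qed
  have *: "(\<Sum>m=m0..<m0 + k. 1 / (real m)\<^sup>2) \<le> 1 / (real m0 - 1/2) - 1 / (real (m0 + k) - 1/2)" for k
  proof (induction k)
    case (Suc k)
    define x where "x = real (m0 + k)"
    have x: "x \<ge> 1" using m0 by (simp add: x_def)
    have "x\<^sup>2 \<ge> 1" using x by (rule one_le_power)
    then have "x\<^sup>2 > 0" "x\<^sup>2 - 1/4 > 0" "x\<^sup>2 - 1/4 \<le> x\<^sup>2" by linarith+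
    then have "1 / x\<^sup>2 \<le> 1 / (x\<^sup>2 - 1/4)" by (intro divide_left_mono mult_pos_pos) simp_all
    also have "x\<^sup>2 - 1/4 = (x - 1/2) * (x + 1/2)" by (simp add: algebra_simps power2_eq_square)
    also have "1 / ((x - 1/2) * (x + 1/2)) = 1 / (x - 1/2) - 1 / (x + 1/2)"
    proof -
      have "x - 1/2 \<noteq> 0" "x + 1/2 \<noteq> 0" using x by linarith+
      then have "1 / (x - 1/2) - 1 / (x + 1/2) = (1 * (x + 1/2) - 1 * (x - 1/2)) / ((x - 1/2) * (x + 1/2))"
        by (rule diff_frac_eq)
      moreover have "1 * (x + 1/2) - 1 * (x - 1/2) = 1" by simp
      ultimately show ?thesis by (simp only:)
    qed
    finally have "1 / x\<^sup>2 \<le> 1 / (x - 1/2) - 1 / (x + 1/2)" .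
    moreover have eq: "real (m0 + k) = x" "real (m0 + Suc k) - 1/2 = x + 1/2"
      unfolding x_def by linarith+
    moreover have sum: "(\<Sum>m=m0..<m0 + Suc k. 1 / (real m)\<^sup>2) = (\<Sum>m=m0..<m0 + k. 1 / (real m)\<^sup>2) + 1 / x\<^sup>2"
      unfolding x_def add_Suc_right by (rule sum.atLeastLessThan_Suc) simp
    ultimately show ?case using Suc unfolding eq sum by linarith
  qed simp
  obtain N where N: "A \<subseteq> {..N}" using assms(2) unfolding finite_nat_iff_bounded_le ..
  have "(\<Sum>m\<in>A. 1 / (real m)\<^sup>2) \<le> (\<Sum>m=m0..<m0 + (N + 1). 1 / (real m)\<^sup>2)"
  proof (rule sum_mono2)
    show "A \<subseteq> {m0..<m0 + (N + 1)}"
    proof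
      fix m assume m: "m \<in> A"
      then have "U < real m" and mN: "m \<le> N" using assms(3) N by auto
      moreover have "real (nat \<lfloor>U\<rfloor>) \<le> U" using assms(1) by simp
      ultimately have "m0 \<le> m" unfolding m0_def by linarith
      then show "m \<in> {m0..<m0 + (N + 1)}" using mN by auto
    qed
  qed auto
  also have "\<dots> \<le> 1 / (real m0 - 1/2)" 
  proof -
    have "0 \<le> real (m0 + (N + 1)) - 1/2" using m0(1) by linarith
    then have "0 \<le> 1 / (real (m0 + (N + 1)) - 1/2)" by (rule divide_nonneg_nonneg[OF zero_le_one])
    then show ?thesis using *[of "N + 1"] by linarith
  qed
  also have "\<dots> \<le> 1 / (real m0 / 2)" using m0 by (intro divide_left_mono) auto
  also have "\<dots> = 2 / real m0" by simp
  also have "\<dots> \<le> 2 / U" using m0 assms(1) by (intro frac_le) linarith+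
  finally show ?thesis .
qed

text \<open>
The diagonal is \<open>O(1/U)\<close>.  Off the diagonal the larger element is \<open>m' + jq \<ge> jq\<close>, which separates
the two sums and gives \<open>(ln V)^2/q\<close>.
\<close>

lemma congruent_pairs_reciprocal_le:
  fixes U V :: real and q :: nat
  assumes "q > 0" "U > 0" "V \<ge> 1" "finite A" "\<And>m. m \<in> A \<Longrightarrow> U < real m \<and> real m \<le> V"
  shows "(\<Sum>m\<in>A. \<Sum>m'\<in>A. of_bool (m mod q = m' mod q) * (1 / real m * (1 / real m')))
      \<le> 2 / U + 2 * (1 + ln V)\<^sup>2 / real q"
proof -
  define L where "L = 1 + ln V"
  have L0: "L \<ge> 1" using assms(3) by (simp add: L_def)
  have pos: "m > 0" if "m \<in> A" for m using assms(2) assms(5)[OF that] by (auto intro: gr0I)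
  define F where "F m m' = of_bool (m mod q = m' mod q) * (1 / real m * (1 / real m'))" for m m'
  define D where "D = (\<Sum>m\<in>A. \<Sum>m'\<in>A. of_bool (m' < m) * F m m')"
  have "(\<Sum>m\<in>A. \<Sum>m'\<in>A. F m m') =
      (\<Sum>m\<in>A. \<Sum>m'\<in>A. (if m = m' then 1 / (real m)\<^sup>2 else 0) + of_bool (m' < m) * F m m' + of_bool (m < m') * F m' m)"
    by (intro sum.cong refl) (auto simp: F_def power2_eq_square)
  also have "\<dots> = (\<Sum>m\<in>A. 1 / (real m)\<^sup>2) + D + (\<Sum>m\<in>A. \<Sum>m'\<in>A. of_bool (m < m') * F m' m)"
    unfolding sum.distrib D_def using assms(4) by (simp add: sum.delta)
  also have "(\<Sum>m\<in>A. \<Sum>m'\<in>A. of_bool (m < m') * F m' m) = D"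
    unfolding D_def by (rule sum.swap)
  finally have split: "(\<Sum>m\<in>A. \<Sum>m'\<in>A. F m m') = (\<Sum>m\<in>A. 1 / (real m)\<^sup>2) + 2 * D" by simp
  have inner: "(\<Sum>m\<in>A. of_bool (m' < m \<and> m mod q = m' mod q) * (1 / real m)) \<le> L / q" if m': "m' \<in> A" for m'
  proof -
    define A' where "A' = {m\<in>A. m' < m \<and> m mod q = m' mod q}"
    define j where "j m = (m - m') div q" for m
    have j: "m = m' + q * j m" if "m \<in> A'" for m
    proof -
      have "q dvd m - m'" using that mod_eq_dvd_iff_nat[of m' m q] by (simp add: A'_def)
      then show ?thesis using that by (simp add: j_def A'_def)
    qed
    have jpos: "j m \<ge> 1" if "m \<in> A'" for m
      using j[OF that] that by (cases "j m") (auto simp: A'_def)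
    have "(\<Sum>m\<in>A. of_bool (m' < m \<and> m mod q = m' mod q) * (1 / real m)) = (\<Sum>m\<in>A'. 1 / real m)"
      unfolding A'_def using assms(4) by (intro sum.mono_neutral_cong_right) auto
    also have "\<dots> \<le> (\<Sum>m\<in>A'. 1 / real q * (1 / real (j m)))"
    proof (intro sum_mono)
      fix m assume m: "m \<in> A'"
      have "q * j m \<le> m" using j[OF m] by linarith
      then have "real q * real (j m) \<le> real m" by (metis of_nat_le_iff of_nat_mult)
      then have "1 / real m \<le> 1 / (real q * real (j m))"
        using jpos[OF m] assms(1) pos[of m] m
        by (intro divide_left_mono) (auto intro!: mult_pos_pos simp: A'_def)
      then show "1 / real m \<le> 1 / real q * (1 / real (j m))" by simp
    qed
    also have "\<dots> = 1 / real q * (\<Sum>m\<in>A'. 1 / real (j m))" by (simp add: sum_distrib_left)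
    also have "(\<Sum>m\<in>A'. 1 / real (j m)) = (\<Sum>i\<in>j ` A'. 1 / real i)"
    proof -
      have "inj_on j A'" by (rule inj_onI) (metis j)
      then show ?thesis by (simp add: sum.reindex)
    qed
    also have "\<dots> \<le> (\<Sum>i | 1 \<le> i \<and> real i \<le> V. 1 / real i)"
    proof (rule sum_mono2)
      show "finite {i. 1 \<le> i \<and> real i \<le> V}" by (rule finite_nat_upto_real)
      show "j ` A' \<subseteq> {i. 1 \<le> i \<and> real i \<le> V}"
      proof clarify
        fix m assume m: "m \<in> A'"
        have "j m \<le> q * j m" using assms(1) by simp
        then have "j m \<le> m" using j[OF m] by linarith
        moreover have "real m \<le> V" using m assms(5) by (auto simp: A'_def)
        ultimately have "real (j m) \<le> V" by linarith
        then show "1 \<le> j m \<and> real (j m) \<le> V" using jpos[OF m] by simp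
      qed
    qed auto
    also have "\<dots> \<le> L" unfolding L_def by (rule sum_reciprocal_le[OF assms(3)])
    finally show ?thesis by (simp add: divide_right_mono)
  qed
  have "D = (\<Sum>m'\<in>A. \<Sum>m\<in>A. of_bool (m' < m) * F m m')" unfolding D_def by (rule sum.swap)
  also have "\<dots> = (\<Sum>m'\<in>A. 1 / real m' * (\<Sum>m\<in>A. of_bool (m' < m \<and> m mod q = m' mod q) * (1 / real m)))"
    unfolding sum_distrib_left by (intro sum.cong refl) (auto simp: F_def)
  also have "\<dots> \<le> (\<Sum>m'\<in>A. 1 / real m' * (L / q))"
    using inner by (intro sum_mono mult_left_mono) auto
  also have "\<dots> = (\<Sum>m'\<in>A. 1 / real m') * (L / q)" by (simp only: sum_distrib_right)
  also have "\<dots> \<le> L * (L / q)"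
  proof (intro mult_right_mono)
    have "(\<Sum>m'\<in>A. 1 / real m') \<le> (\<Sum>m | 1 \<le> m \<and> real m \<le> V. 1 / real m)"
    proof (rule sum_mono2)
      show "finite {m. 1 \<le> m \<and> real m \<le> V}" by (rule finite_nat_upto_real)
    qed (use assms(5) pos in \<open>auto simp: Suc_le_eq\<close>)
    then show "(\<Sum>m'\<in>A. 1 / real m') \<le> L" using sum_reciprocal_le[OF assms(3)] by (simp add: L_def)
  qed (use L0 in auto)
  finally have "2 * D \<le> 2 * (1 + ln V)\<^sup>2 / real q" by (simp add: L_def power2_eq_square)
  moreover have "(\<Sum>m\<in>A. 1 / (real m)\<^sup>2) \<le> 2 / U"
    using assms by (intro sum_reciprocal_squares_le) auto
  ultimately show ?thesis using split unfolding F_def by linarith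
qed

text \<open>
The inner sum over \<open>m\<close> depends on \<open>p\<close> only through its residue modulo \<open>q\<close>.  After Cauchy-Schwarz the
sum over \<open>p\<close> therefore becomes a sum over all residues, each with multiplicity at most \<open>B\<close>, to which
Parseval applies.
\<close>

lemma bilinear_block:
  fixes q :: nat and a :: int and b c :: "nat \<Rightarrow> complex" and H U V B :: real
  assumes q: "q > 0" "coprime a (int q)"
    and P: "finite P" "H > 0" "\<And>p. p \<in> P \<Longrightarrow> H < real p" "\<And>p. p \<in> P \<Longrightarrow> norm (b p) \<le> 1"
    and A: "finite A" "U > 0" "V \<ge> 1" "\<And>m. m \<in> A \<Longrightarrow> U < real m \<and> real m \<le> V"
           "\<And>m. m \<in> A \<Longrightarrow> norm (c m) \<le> 1 / real m"
    and B: "B \<ge> 0" "\<And>r. real (card {p\<in>P. p mod q = r}) \<le> B"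
  shows "norm (\<Sum>p\<in>P. \<Sum>m\<in>A. b p / of_nat p * c m * e (real p * real m * (a / q)))
      \<le> 1 / H * sqrt (real (card P) * (B * (real q * (2 / U + 2 * (1 + ln V)\<^sup>2 / real q))))"
proof -
  define F where "F n = (\<Sum>m\<in>A. c m * e (real n * real m * (a / q)))" for n :: nat
  have Fmod: "F n = F (n mod q)" for n
  proof -
    have "e (real n * real m * (a / q)) = e (real (n mod q) * real m * (a / q))" for m
    proof -
      have "real n = real (n mod q) + real q * real (n div q)"
        by (metis mod_mult_div_eq of_nat_add of_nat_mult)
      then have "real n * real m * (a / q) = real (n mod q) * real m * (a / q) + of_int (int (n div q) * int m * a)"
        using q(1) by (simp add: field_simps)
      moreover have "e (of_int (int (n div q) * int m * a)) = 1" unfolding e_eq_1_iff by blast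
      ultimately show ?thesis by (simp only: e_add mult_1_right)
    qed
    then show ?thesis by (simp add: F_def)
  qed
  have "norm (\<Sum>p\<in>P. \<Sum>m\<in>A. b p / of_nat p * c m * e (real p * real m * (a / q)))
      = norm (\<Sum>p\<in>P. b p / of_nat p * F p)"
    by (simp add: F_def sum_distrib_left mult_ac)
  also have "\<dots> \<le> (\<Sum>p\<in>P. 1 / H * norm (F p))"
  proof (rule sum_norm_le)
    fix p assume p: "p \<in> P"
    have "norm (b p) / real p \<le> 1 / H" using P(2-4) p by (intro frac_le) (auto intro: less_imp_le)
    then show "norm (b p / of_nat p * F p) \<le> 1 / H * norm (F p)"
      unfolding norm_mult norm_divide norm_of_nat by (rule mult_right_mono) auto
  qed
  also have "\<dots> = 1 / H * (\<Sum>p\<in>P. 1 * norm (F p))" by (simp add: sum_distrib_left)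
  also have "\<dots> \<le> 1 / H * sqrt (real (card P) * (B * (real q * (2 / U + 2 * (1 + ln V)\<^sup>2 / real q))))"
  proof (intro mult_left_mono real_le_rsqrt)
    have "(\<Sum>p\<in>P. 1 * norm (F p))\<^sup>2 \<le> (\<Sum>p\<in>P. 1\<^sup>2) * (\<Sum>p\<in>P. (norm (F p))\<^sup>2)"
      by (rule Cauchy_Schwarz_ineq_sum)
    also have "(\<Sum>p\<in>P. (norm (F p))\<^sup>2) = (\<Sum>r<q. \<Sum>p | p \<in> P \<and> p mod q = r. (norm (F p))\<^sup>2)"
      using P(1) q(1) by (intro sum.group[symmetric]) auto
    also have "\<dots> = (\<Sum>r<q. real (card {p\<in>P. p mod q = r}) * (norm (F r))\<^sup>2)"
    proof (intro sum.cong refl)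
      fix r
      have "(\<Sum>p | p \<in> P \<and> p mod q = r. (norm (F p))\<^sup>2) = (\<Sum>p | p \<in> P \<and> p mod q = r. (norm (F r))\<^sup>2)"
        using Fmod by (intro sum.cong refl) (metis (mono_tags, lifting) mem_Collect_eq)
      then show "(\<Sum>p | p \<in> P \<and> p mod q = r. (norm (F p))\<^sup>2) = real (card {p\<in>P. p mod q = r}) * (norm (F r))\<^sup>2"
        by simp
    qed
    also have "\<dots> \<le> (\<Sum>r<q. B * (norm (F r))\<^sup>2)"
      using B by (intro sum_mono mult_right_mono) auto
    also have "\<dots> = B * (\<Sum>r<q. (norm (F r))\<^sup>2)" by (simp add: sum_distrib_left)
    also have "(\<Sum>r<q. (norm (F r))\<^sup>2) \<le>
        real q * (\<Sum>m\<in>A. \<Sum>m'\<in>A. of_bool (m mod q = m' mod q) * (1 / real m * (1 / real m')))"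
      unfolding F_def using A by (intro exponential_sum_energy q) auto
    also have "(\<Sum>m\<in>A. \<Sum>m'\<in>A. of_bool (m mod q = m' mod q) * (1 / real m * (1 / real m')))
        \<le> 2 / U + 2 * (1 + ln V)\<^sup>2 / real q"
      using A q by (intro congruent_pairs_reciprocal_le) auto
    finally show "(\<Sum>p\<in>P. 1 * norm (F p))\<^sup>2 \<le> real (card P) * (B * (real q * (2 / U + 2 * (1 + ln V)\<^sup>2 / real q)))"
      using B(1) by (simp add: mult_left_mono)
  qed (use P in auto)
  finally show ?thesis .
qed

section \<open>Extracting a prime factor\<close>

definition omega_in :: "nat set \<Rightarrow> nat \<Rightarrow> nat" where
  "omega_in P n = card {p \<in> P. p dvd n}"

lemma omega_in_quotient_ge:
  assumes "finite P" "\<And>p. p \<in> P \<Longrightarrow> prime p" "p \<in> P" "p dvd n"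
  shows "omega_in P n \<le> Suc (omega_in P (n div p))"
proof -
  have "{r \<in> P. r dvd n} \<subseteq> insert p {r \<in> P. r dvd n div p}"
  proof
    fix r assume r: "r \<in> {r \<in> P. r dvd n}"
    show "r \<in> insert p {r \<in> P. r dvd n div p}"
    proof (cases "r = p")
      case False
      then have "coprime r p" using r assms(2,3) by (auto intro: primes_coprime)
      moreover have "r dvd p * (n div p)" using r assms(4) by simp
      ultimately have "r dvd n div p" by (simp add: coprime_dvd_mult_right_iff)
      then show ?thesis using r by simp
    qed simp
  qed
  then have "omega_in P n \<le> card (insert p {r \<in> P. r dvd n div p})"
    unfolding omega_in_def using assms(1) by (intro card_mono) auto
  also have "\<dots> \<le> Suc (omega_in P (n div p))"
    unfolding omega_in_def by (rule card_insert_le_m1) auto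
  finally show ?thesis .
qed

lemma omega_in_quotient_eq:
  assumes "finite P" "\<And>p. p \<in> P \<Longrightarrow> prime p" "p \<in> P" "p dvd n" "\<not> p\<^sup>2 dvd n"
  shows "omega_in P n = Suc (omega_in P (n div p))"
proof -
  have np: "\<not> p dvd n div p"
  proof
    assume "p dvd n div p"
    then have "p * p dvd p * (n div p)" by (rule mult_dvd_mono[OF dvd_refl])
    then show False using assms(4,5) by (simp add: power2_eq_square)
  qed
  have "insert p {r \<in> P. r dvd n div p} \<subseteq> {r \<in> P. r dvd n}"
  proof -
    have "n div p dvd n" using assms(4) by (metis dvd_triv_right dvd_mult_div_cancel)
    then show ?thesis using assms(3,4) dvd_trans[of _ "n div p" n] by blast
  qed
  then have "card (insert p {r \<in> P. r dvd n div p}) \<le> omega_in P n"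
    unfolding omega_in_def using assms(1) by (intro card_mono) auto
  moreover have "card (insert p {r \<in> P. r dvd n div p}) = Suc (omega_in P (n div p))"
    unfolding omega_in_def using assms(1) np by (subst card_insert_disjoint) auto
  ultimately show ?thesis using omega_in_quotient_ge[OF assms(1-4)] by simp
qed

lemma ramare_weight_sum_le:
  fixes g :: "nat \<Rightarrow> complex"
  assumes "finite P" "\<And>p. p \<in> P \<Longrightarrow> prime p" "n > 0"
    and g: "\<And>m. m > 0 \<Longrightarrow> norm (g m) \<le> 1 / (1 + real (omega_in P m))"
  shows "(\<Sum>p | p \<in> P \<and> p dvd n. norm (g (n div p))) \<le> 1"
proof (cases "omega_in P n = 0")
  case True
  then have "{p \<in> P. p dvd n} = {}" using assms(1) by (simp add: omega_in_def)
  then show ?thesis by (simp only: sum.empty)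
next
  case False
  have "(\<Sum>p | p \<in> P \<and> p dvd n. norm (g (n div p))) \<le> (\<Sum>p | p \<in> P \<and> p dvd n. 1 / real (omega_in P n))"
  proof (intro sum_mono)
    fix p assume p: "p \<in> {p. p \<in> P \<and> p dvd n}"
    then have "n div p > 0" using assms(3) by (auto elim!: dvdE)
    then have "norm (g (n div p)) \<le> 1 / (1 + real (omega_in P (n div p)))" by (rule g)
    also have "\<dots> \<le> 1 / real (omega_in P n)"
      using omega_in_quotient_ge[OF assms(1,2), of p n] p False by (intro divide_left_mono) auto
    finally show "norm (g (n div p)) \<le> 1 / real (omega_in P n)" .
  qed
  also have "\<dots> = 1" using False by (simp add: omega_in_def)
  finally show ?thesis .
qed

lemma norm_ramare_weight_le:
  assumes "norm (f m) \<le> 1"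
  shows "norm (f m / (1 + of_nat (omega_in P m) :: complex)) \<le> 1 / (1 + real (omega_in P m))"
proof -
  have "norm (1 + of_nat (omega_in P m) :: complex) = 1 + real (omega_in P m)"
    by (metis norm_of_nat of_nat_Suc)
  then show ?thesis using assms by (simp add: norm_divide divide_right_mono)
qed

text \<open>
If no prime of \<open>P\<close> divides \<open>n\<close> twice, each of the \<open>\<omega>(n)\<close> primes \<open>p\<close> contributes \<open>f(n)/\<omega>(n)\<close>, since \<open>p\<close> is
coprime to \<open>n/p\<close> and \<open>\<omega>(n/p) = \<omega>(n) - 1\<close>.  Otherwise both terms are at most 1 in absolute value.
The weight \<open>1/(1 + \<omega>(m))\<close> depends on \<open>m\<close> alone, so the variables \<open>p\<close> and \<open>m\<close> are
separated without any condition relating them.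
\<close>

lemma ramare_identity:
  fixes f :: "nat \<Rightarrow> complex"
  assumes P: "finite P" "\<And>p. p \<in> P \<Longrightarrow> prime p" and n: "n > 0"
    and f: "multiplicative f" "\<And>n. n > 0 \<Longrightarrow> norm (f n) \<le> 1"
  defines "g \<equiv> \<lambda>m. f m / (1 + of_nat (omega_in P m))"
  shows "norm (f n * of_bool (omega_in P n > 0) - (\<Sum>p | p \<in> P \<and> p dvd n. f p * g (n div p)))
      \<le> 2 * real (card {p \<in> P. p\<^sup>2 dvd n})"
proof (cases "{p \<in> P. p\<^sup>2 dvd n} = {}")
  case True
  have "(\<Sum>p | p \<in> P \<and> p dvd n. f p * g (n div p)) = (\<Sum>p | p \<in> P \<and> p dvd n. f n / of_nat (omega_in P n))"
  proof (intro sum.cong refl)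
    fix p assume p: "p \<in> {p. p \<in> P \<and> p dvd n}"
    then have np2: "\<not> p\<^sup>2 dvd n" using True by auto
    then have "omega_in P n = Suc (omega_in P (n div p))"
      using p by (intro omega_in_quotient_eq P) auto
    moreover have "f n = f p * f (n div p)"
    proof -
      have "\<not> p dvd n div p"
      proof
        assume "p dvd n div p"
        then have "p * p dvd p * (n div p)" by (rule mult_dvd_mono[OF dvd_refl])
        moreover have "p * (n div p) = n" using p by simp
        ultimately have "p * p dvd n" by (simp only:)
        then show False using np2 by (simp add: power2_eq_square)
      qed
      then have "coprime p (n div p)" using p P(2) by (auto intro: prime_imp_coprime)
      moreover have "p > 0" "n div p > 0" using p P(2) n by (auto simp: prime_gt_0_nat elim!: dvdE)
      ultimately have "f (p * (n div p)) = f p * f (n div p)"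
        using f(1) unfolding multiplicative_def by blast
      then show ?thesis using p by simp
    qed
    ultimately show "f p * g (n div p) = f n / of_nat (omega_in P n)" by (simp add: g_def)
  qed
  also have "\<dots> = f n * of_bool (omega_in P n > 0)"
    by (simp add: omega_in_def)
  finally show ?thesis by simp
next
  case False
  have gb: "norm (g m) \<le> 1 / (1 + real (omega_in P m))" if "m > 0" for m
    unfolding g_def using that by (intro norm_ramare_weight_le f(2))
  have "card {p \<in> P. p\<^sup>2 dvd n} > 0" using False P(1) by (simp add: card_gt_0_iff)
  have "norm (f n * of_bool (omega_in P n > 0) - (\<Sum>p | p \<in> P \<and> p dvd n. f p * g (n div p))) \<le>
      norm (f n * of_bool (omega_in P n > 0)) + norm (\<Sum>p | p \<in> P \<and> p dvd n. f p * g (n div p))"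
    by (rule norm_triangle_ineq4)
  also have "norm (f n * of_bool (omega_in P n > 0)) \<le> 1" using f(2)[OF n] by auto
  also have "norm (\<Sum>p | p \<in> P \<and> p dvd n. f p * g (n div p)) \<le> (\<Sum>p | p \<in> P \<and> p dvd n. norm (g (n div p)))"
  proof (rule sum_norm_le)
    fix p assume p: "p \<in> {p. p \<in> P \<and> p dvd n}"
    then have "norm (f p) \<le> 1" using f(2) P(2) prime_gt_0_nat by blast
    then have "norm (f p) * norm (g (n div p)) \<le> 1 * norm (g (n div p))" by (rule mult_right_mono) auto
    then show "norm (f p * g (n div p)) \<le> norm (g (n div p))" by (simp add: norm_mult)
  qed
  also have "\<dots> \<le> 1" using gb by (intro ramare_weight_sum_le P n) auto
  finally have "norm (f n * of_bool (omega_in P n > 0) - (\<Sum>p | p \<in> P \<and> p dvd n. f p * g (n div p))) \<le> 2"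
    by simp
  also have "\<dots> \<le> 2 * real (card {p \<in> P. p\<^sup>2 dvd n})"
    using \<open>card {p \<in> P. p\<^sup>2 dvd n} > 0\<close> by simp
  finally show ?thesis .
qed

lemma sum_over_prime_divisors_eq_pairs:
  fixes F :: "nat \<Rightarrow> nat \<Rightarrow> 'a :: comm_monoid_add"
  assumes "finite P" "finite S" "0 \<notin> P"
  shows "(\<Sum>n\<in>S. \<Sum>p | p \<in> P \<and> p dvd n. F p (n div p)) = (\<Sum>(p, m)\<in>{(p, m). p \<in> P \<and> p * m \<in> S}. F p m)"
proof -
  have "(\<Sum>n\<in>S. \<Sum>p | p \<in> P \<and> p dvd n. F p (n div p)) =
      (\<Sum>(n, p)\<in>Sigma S (\<lambda>n. {p. p \<in> P \<and> p dvd n}). F p (n div p))"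
    using assms by (subst sum.Sigma) auto
  also have "\<dots> = (\<Sum>(p, m)\<in>{(p, m). p \<in> P \<and> p * m \<in> S}. F p m)"
    by (rule sum.reindex_bij_witness[of _ "\<lambda>(p, m). (p * m, p)" "\<lambda>(n, p). (p, n div p)"])
       (use assms(3) in \<open>auto intro: gr0I\<close>)
  finally show ?thesis .
qed

lemma finite_factor_pairs:
  assumes "finite P" "finite S" "0 \<notin> P"
  shows "finite {(p, m). p \<in> P \<and> p * m \<in> (S :: nat set)}"
proof -
  have "{(p, m). p \<in> P \<and> p * m \<in> S} \<subseteq> (\<lambda>(n, p). (p, n div p)) ` (S \<times> P)"
  proof clarify
    fix p m assume "p \<in> P" "p * m \<in> S"
    moreover have "p \<noteq> 0" using assms(3) \<open>p \<in> P\<close> by metis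
    then have "p * m div p = m" by (rule nonzero_mult_div_cancel_left)
    ultimately show "(p, m) \<in> (\<lambda>(n, p). (p, n div p)) ` (S \<times> P)"
      by (intro image_eqI[of _ _ "(p * m, p)"]) simp_all
  qed
  then show ?thesis by (rule finite_subset) (intro finite_imageI finite_cartesian_product assms)
qed

lemma finite_nat_real_interval [simp]: "finite {n. Y < real n \<and> real n \<le> X}"
  by (rule finite_subset[of _ "{..nat \<lfloor>X\<rfloor>}"]) (auto simp: le_nat_floor)

lemma sum_reciprocal_octave_le:
  fixes Y :: real
  assumes "Y \<ge> 1"
  shows "(\<Sum>n | Y < real n \<and> real n \<le> 2 * Y. 1 / real n) \<le> 2"
proof -
  have "{n. Y < real n \<and> real n \<le> 2 * Y} \<subseteq> {nat \<lfloor>Y\<rfloor> + 1..nat \<lfloor>2 * Y\<rfloor>}"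
    using assms by (auto simp: le_nat_floor Suc_le_eq nat_less_iff floor_less_iff)
  then have "card {n. Y < real n \<and> real n \<le> 2 * Y} \<le> card {nat \<lfloor>Y\<rfloor> + 1..nat \<lfloor>2 * Y\<rfloor>}"
    by (intro card_mono) auto
  also have "\<dots> = nat \<lfloor>2 * Y\<rfloor> - nat \<lfloor>Y\<rfloor>" by simp
  finally have "real (card {n. Y < real n \<and> real n \<le> 2 * Y}) \<le> real (nat \<lfloor>2 * Y\<rfloor> - nat \<lfloor>Y\<rfloor>)" by simp
  also have "\<dots> \<le> 2 * Y"
  proof -
    have "real (nat \<lfloor>2 * Y\<rfloor>) \<le> 2 * Y" using assms by simp
    then show ?thesis by linarith
  qed
  finally have card: "real (card {n. Y < real n \<and> real n \<le> 2 * Y}) \<le> 2 * Y" .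
  have "(\<Sum>n | Y < real n \<and> real n \<le> 2 * Y. 1 / real n) \<le> (\<Sum>n | Y < real n \<and> real n \<le> 2 * Y. 1 / Y)"
    using assms by (intro sum_mono divide_left_mono) auto
  also have "\<dots> = real (card {n. Y < real n \<and> real n \<le> 2 * Y}) * (1 / Y)" by simp
  also have "\<dots> \<le> 2 * Y * (1 / Y)" using card assms by (intro mult_right_mono) auto
  also have "\<dots> = 2" using assms by simp
  finally show ?thesis .
qed

text \<open>
Since the weights of the factorisations \<open>n = pm\<close> of a fixed \<open>n\<close> add up to at most 1, passing to pairs does not
enlarge trivial bounds.
\<close>

lemma sum_factor_pairs_weight_le:
  fixes g :: "nat \<Rightarrow> complex"
  assumes P: "finite P" "\<And>p. p \<in> P \<Longrightarrow> prime p"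
    and g: "\<And>m. m > 0 \<Longrightarrow> norm (g m) \<le> 1 / (1 + real (omega_in P m))"
    and S: "finite S" "0 \<notin> S"
  shows "(\<Sum>(p, m)\<in>{(p, m). p \<in> P \<and> p * m \<in> S}. norm (g m) / (real p * real m)) \<le> (\<Sum>n\<in>S. 1 / real n)"
proof -
  have P0: "0 \<notin> P" using P(2) by fastforce
  have "(\<Sum>(p, m)\<in>{(p, m). p \<in> P \<and> p * m \<in> S}. norm (g m) / (real p * real m)) =
     (\<Sum>n\<in>S. \<Sum>p | p \<in> P \<and> p dvd n. norm (g (n div p)) / (real p * real (n div p)))"
    using sum_over_prime_divisors_eq_pairs[OF P(1) S(1) P0, of "\<lambda>p m. norm (g m) / (real p * real m)"] by simp
  also have "\<dots> = (\<Sum>n\<in>S. (\<Sum>p | p \<in> P \<and> p dvd n. norm (g (n div p))) * (1 / real n))"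
    unfolding sum_distrib_right by (intro sum.cong refl) (auto simp flip: of_nat_mult)
  also have "\<dots> \<le> (\<Sum>n\<in>S. 1 * (1 / real n))"
    using S(2) by (intro sum_mono mult_right_mono ramare_weight_sum_le P g) (auto intro: gr0I)
  finally show ?thesis by simp
qed

text \<open>
On the block with \<open>H < p \<le> 2H\<close> the hyperbolic condition \<open>Y < pm \<le> X\<close> is replaced by the condition
\<open>Y/H < m \<le> X/(2H)\<close> on \<open>m\<close> alone, which implies it.  The pairs lost satisfy \<open>pm \<le> 2Y\<close> or \<open>pm > X/2\<close>,
and contribute at most 4.
\<close>

lemma type_II_sum:
  fixes q J :: nat and a :: int and b g :: "nat \<Rightarrow> complex" and H0 W X Y :: real and B :: "nat \<Rightarrow> real"
  assumes q: "q > 0" "coprime a (int q)"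
    and P: "finite P" "\<And>p. p \<in> P \<Longrightarrow> prime p"
           "\<And>p. p \<in> P \<Longrightarrow> H0 < real p \<and> real p \<le> H0 * 2 ^ J" "H0 \<ge> 1"
    and b: "\<And>p. p \<in> P \<Longrightarrow> norm (b p) \<le> 1"
    and g: "\<And>m. m > 0 \<Longrightarrow> norm (g m) \<le> 1 / (1 + real (omega_in P m))"
    and WXY: "W > 0" "Y \<ge> 1" "X \<ge> 2"
  defines "Pj \<equiv> \<lambda>j. {p \<in> P. H0 * 2 ^ j < real p \<and> real p \<le> H0 * 2 ^ Suc j}"
  assumes B: "\<And>j r. j < J \<Longrightarrow> real (card {p \<in> Pj j. p mod q = r}) \<le> B j"
  shows "norm (\<Sum>(p, m)\<in>{(p, m). p \<in> P \<and> W < real m \<and> Y < real (p * m) \<and> real (p * m) \<le> X}.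
             b p / of_nat p * (g m / of_nat m) * e (real p * real m * (a / q)))
     \<le> 4 + (\<Sum>j<J. 1 / (H0 * 2 ^ j) * sqrt (real (card (Pj j)) * (B j * (real q *
          (2 / max W (Y / (H0 * 2 ^ j)) + 2 * (1 + ln X)\<^sup>2 / real q)))))"
proof -
  define w where "w p m = b p / of_nat p * (g m / of_nat m) * e (real p * real m * (a / q))" for p m
  define T where "T = {(p, m). p \<in> P \<and> W < real m \<and> Y < real (p * m) \<and> real (p * m) \<le> X}"
  define H where "H j = H0 * 2 ^ j" for j
  define A where "A j = {m. max W (Y / H j) < real m \<and> real m \<le> X / (2 * H j)}" for j
  define E where "E = {n. Y < real n \<and> real n \<le> 2 * Y} \<union> {n. X / 2 < real n \<and> real n \<le> 2 * (X / 2)}"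
  define T' where "T' = (\<Union>j<J. Pj j \<times> A j)"
  have P0: "0 \<notin> P" using P(2) by fastforce
  have Hpos: "H j \<ge> 1" for j
  proof -
    have "1 * 1 \<le> H0 * 2 ^ j" using P(4) by (intro mult_mono) auto
    then show ?thesis by (simp add: H_def)
  qed
  have Pj: "p \<in> Pj j \<longleftrightarrow> p \<in> P \<and> H j < real p \<and> real p \<le> 2 * H j" for p j
    by (simp add: Pj_def H_def mult_ac)
  have finT: "finite T"
  proof -
    have "finite {(p, m). p \<in> P \<and> p * m \<in> {n. Y < real n \<and> real n \<le> X}}"
      using P(1) P0 by (intro finite_factor_pairs) auto
    then show ?thesis by (rule rev_finite_subset) (auto simp: T_def)
  qed
  have finA: "finite (A j)" for j by (simp add: A_def)
  have finPj: "finite (Pj j)" for j using P(1) by (simp add: Pj_def)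
  have A0: "m > 0" if "m \<in> A j" for m j using that WXY(1) by (auto simp: A_def intro: gr0I)
  have T'T: "T' \<subseteq> T"
  proof
    fix x assume "x \<in> T'"
    then obtain p m j where x: "x = (p, m)" "p \<in> Pj j" "m \<in> A j" by (auto simp: T'_def)
    have Hp: "H j > 0" using Hpos[of j] by linarith
    have "Y < real m * H j" using x(3) Hp by (simp add: A_def field_simps)
    also have "\<dots> \<le> real m * real p" using x(2) by (intro mult_left_mono) (auto simp: Pj)
    finally have 1: "Y < real (p * m)" by (simp add: mult_ac)
    have "real m * real p \<le> real m * (2 * H j)" using x(2) by (intro mult_left_mono) (auto simp: Pj)
    also have "\<dots> \<le> X" using x(3) Hp by (simp add: A_def field_simps)
    finally have 2: "real (p * m) \<le> X" by (simp add: mult_ac)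
    show "x \<in> T" using x 1 2 by (auto simp: T_def A_def Pj)
  qed
  have level: "\<exists>j<J. p \<in> Pj j" if p: "p \<in> P" for p
  proof -
    \<comment> \<open>The dyadic block containing \<open>p\<close> is the one just before the first end point at or above \<open>p\<close>.\<close>
    define j where "j = (LEAST j. real p \<le> H j)"
    have ex: "real p \<le> H J" using P(3)[OF p] by (simp add: H_def)
    then have le: "real p \<le> H j" unfolding j_def by (rule LeastI)
    have "j \<noteq> 0"
    proof
      assume "j = 0"
      then show False using le P(3)[OF p] by (simp add: H_def)
    qed
    then obtain i where i: "j = Suc i" by (cases j) auto
    have "\<not> real p \<le> H i" using i unfolding j_def by (intro not_less_Least) auto
    moreover have "j \<le> J" unfolding j_def using ex by (rule Least_le)
    ultimately show ?thesis using le i p by (intro exI[of _ i]) (auto simp: Pj H_def)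
  qed
  have disj: "(Pj i \<times> A i) \<inter> (Pj j \<times> A j) = {}" if "i \<noteq> j" for i j
  proof -
    have *: "Pj i \<inter> Pj j = {}" if "i < j" for i j
    proof -
      have "H0 * 2 ^ Suc i \<le> H0 * 2 ^ j" using that P(4) by (intro mult_left_mono power_increasing) auto
      then show ?thesis by (force simp: Pj_def)
    qed
    show ?thesis using that *[of i j] *[of j i] by (cases i j rule: linorder_cases) auto
  qed
  have "(\<Sum>(p, m)\<in>T. w p m) = (\<Sum>(p, m)\<in>T'. w p m) + (\<Sum>(p, m)\<in>T - T'. w p m)"
    using finT T'T by (metis add.commute sum.subset_diff)
  then have "norm (\<Sum>(p, m)\<in>T. w p m) \<le> norm (\<Sum>(p, m)\<in>T'. w p m) + norm (\<Sum>(p, m)\<in>T - T'. w p m)"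
    by (simp add: norm_triangle_ineq)
  also have "norm (\<Sum>(p, m)\<in>T - T'. w p m) \<le> 4"
  proof -
    have sub: "T - T' \<subseteq> {(p, m). p \<in> P \<and> p * m \<in> E}"
    proof
      fix x assume x: "x \<in> T - T'"
      then obtain p m where pm: "x = (p, m)" "p \<in> P" "W < real m" "Y < real (p * m)" "real (p * m) \<le> X"
        by (auto simp: T_def)
      obtain j where j: "j < J" "p \<in> Pj j" using level[OF pm(2)] by blast
      have Hp: "H j > 0" using Hpos[of j] by linarith
      have "m \<notin> A j" using x pm j by (auto simp: T'_def)
      then have "real m \<le> Y / H j \<or> X / (2 * H j) < real m" using pm(3) by (auto simp: A_def)
      then have "p * m \<in> E"
      proof
        assume "real m \<le> Y / H j"
        then have "real m * (2 * H j) \<le> 2 * Y" using Hp by (simp add: field_simps)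
        moreover have "real m * real p \<le> real m * (2 * H j)" using j by (intro mult_left_mono) (auto simp: Pj)
        ultimately have "real (p * m) \<le> 2 * Y" by (simp add: mult_ac)
        then show ?thesis using pm by (simp add: E_def)
      next
        assume "X / (2 * H j) < real m"
        then have "X / 2 < real m * H j" using Hp by (simp add: field_simps)
        also have "\<dots> \<le> real m * real p" using j by (intro mult_left_mono) (auto simp: Pj)
        finally show ?thesis using pm by (simp add: E_def mult_ac)
      qed
      then show "x \<in> {(p, m). p \<in> P \<and> p * m \<in> E}" using pm by simp
    qed
    have finE: "finite E" "0 \<notin> E"
      unfolding E_def using WXY by (intro finite_UnI finite_nat_real_interval) auto
    have "norm (\<Sum>(p, m)\<in>T - T'. w p m) \<le> (\<Sum>(p, m)\<in>T - T'. norm (g m) / (real p * real m))"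
    proof (rule sum_norm_le)
      fix x assume x: "x \<in> T - T'"
      obtain p m where pm: "x = (p, m)" by force
      have "norm (b p) \<le> 1" using x pm b by (auto simp: T_def)
      then have "norm (b p) * (norm (g m) / (real p * real m)) \<le> 1 * (norm (g m) / (real p * real m))"
        by (rule mult_right_mono) auto
      then show "norm (case x of (p, m) \<Rightarrow> w p m) \<le> (case x of (p, m) \<Rightarrow> norm (g m) / (real p * real m))"
        by (simp add: pm w_def norm_mult norm_divide)
    qed
    also have "\<dots> \<le> (\<Sum>(p, m)\<in>{(p, m). p \<in> P \<and> p * m \<in> E}. norm (g m) / (real p * real m))"
      using sub finite_factor_pairs[OF P(1) finE(1) P0] by (intro sum_mono2) auto
    also have "\<dots> \<le> (\<Sum>n\<in>E. 1 / real n)"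
      by (intro sum_factor_pairs_weight_le P g finE) auto
    also have "\<dots> \<le> (\<Sum>n | Y < real n \<and> real n \<le> 2 * Y. 1 / real n) +
        (\<Sum>n | X / 2 < real n \<and> real n \<le> 2 * (X / 2). 1 / real n)"
      unfolding E_def
      by (subst sum_Un[OF finite_nat_real_interval finite_nat_real_interval]) (simp add: sum_nonneg)
    also have "\<dots> \<le> 2 + 2"
      using WXY by (intro add_mono sum_reciprocal_octave_le) auto
    finally show ?thesis by simp
  qed
  also have "norm (\<Sum>(p, m)\<in>T'. w p m) \<le> (\<Sum>j<J. 1 / H j * sqrt (real (card (Pj j)) * (B j * (real q *
          (2 / max W (Y / H j) + 2 * (1 + ln X)\<^sup>2 / real q)))))"
  proof -
    have "(\<Sum>(p, m)\<in>T'. w p m) = (\<Sum>j<J. \<Sum>(p, m)\<in>Pj j \<times> A j. w p m)"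
      unfolding T'_def using finA finPj disj by (intro sum.UNION_disjoint) auto
    also have "\<dots> = (\<Sum>j<J. \<Sum>p\<in>Pj j. \<Sum>m\<in>A j. w p m)"
      by (simp add: sum.cartesian_product)
    finally have "norm (\<Sum>(p, m)\<in>T'. w p m) \<le> (\<Sum>j<J. norm (\<Sum>p\<in>Pj j. \<Sum>m\<in>A j. w p m))"
      by (simp add: norm_sum)
    also have "\<dots> \<le> (\<Sum>j<J. 1 / H j * sqrt (real (card (Pj j)) * (B j * (real q *
          (2 / max W (Y / H j) + 2 * (1 + ln X)\<^sup>2 / real q)))))"
    proof (intro sum_mono)
      fix j assume j: "j \<in> {..<J}"
      have Hp: "H j > 0" using Hpos[of j] by linarith
      have B0: "B j \<ge> 0" using B[of j 0] j by (meson lessThan_iff of_nat_0_le_iff order.trans)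
      have XH: "X / (2 * H j) \<le> X"
      proof -
        have "X / (2 * H j) \<le> X / 1" using Hpos[of j] WXY(3) by (intro divide_left_mono) auto
        then show ?thesis by simp
      qed
      show "norm (\<Sum>p\<in>Pj j. \<Sum>m\<in>A j. w p m) \<le> 1 / H j * sqrt (real (card (Pj j)) * (B j * (real q *
          (2 / max W (Y / H j) + 2 * (1 + ln X)\<^sup>2 / real q))))"
        unfolding w_def
      proof (rule bilinear_block[OF q finPj Hp])
        fix m assume m: "m \<in> A j"
        show "max W (Y / H j) < real m \<and> real m \<le> X" using m XH by (auto simp: A_def)
        have "norm (g m) \<le> 1 / (1 + real (omega_in P m))" by (rule g[OF A0[OF m]])
        also have "\<dots> \<le> 1" by simp
        finally show "norm (g m / of_nat m) \<le> 1 / real m" by (simp add: norm_divide divide_right_mono)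
      next
        fix r show "real (card {p \<in> Pj j. p mod q = r}) \<le> B j" using B j by simp
      qed (use finA b WXY B0 in \<open>auto simp: Pj\<close>)
    qed
    finally show ?thesis .
  qed
  finally show ?thesis unfolding T_def w_def H_def by (simp add: add.commute)
qed

text \<open>
This measures the exceptional set of \<open>ramare_identity\<close>: each prime \<open>p > D\<close> contributes at most
\<open>(1 + ln X)/p^2\<close>.
\<close>

lemma sum_square_divisors_le:
  fixes D X :: real
  assumes P: "finite P" "\<And>p. p \<in> P \<Longrightarrow> D < real p" and D: "D > 0" and X: "X \<ge> 1"
    and S: "finite S" "\<And>n. n \<in> S \<Longrightarrow> 1 \<le> n \<and> real n \<le> X"
  shows "(\<Sum>n\<in>S. real (card {p \<in> P. p\<^sup>2 dvd n}) / real n) \<le> 2 / D * (1 + ln X)"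
proof -
  define R where "R = {m. 1 \<le> m \<and> real m \<le> X}"
  have finR: "finite R"
    unfolding R_def by (rule finite_nat_upto_real)
  have p0: "p > 0" if "p \<in> P" for p using P(2)[OF that] D by (auto intro: gr0I)
  have "(\<Sum>n\<in>S. real (card {p \<in> P. p\<^sup>2 dvd n}) / real n) = (\<Sum>n\<in>S. \<Sum>p\<in>P. of_bool (p\<^sup>2 dvd n) / real n)"
  proof (intro sum.cong refl)
    fix n
    have "real (card {p \<in> P. p\<^sup>2 dvd n}) = (\<Sum>p\<in>P. of_bool (p\<^sup>2 dvd n))"
      using P(1) by (simp add: of_bool_def sum.If_cases Int_def)
    then show "real (card {p \<in> P. p\<^sup>2 dvd n}) / real n = (\<Sum>p\<in>P. of_bool (p\<^sup>2 dvd n) / real n)"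
      by (simp add: sum_divide_distrib)
  qed
  also have "\<dots> = (\<Sum>p\<in>P. \<Sum>n\<in>S. of_bool (p\<^sup>2 dvd n) / real n)" by (rule sum.swap)
  also have "\<dots> \<le> (\<Sum>p\<in>P. 1 / (real p)\<^sup>2 * (1 + ln X))"
  proof (intro sum_mono)
    fix p assume p: "p \<in> P"
    have "(\<Sum>n\<in>S. of_bool (p\<^sup>2 dvd n) / real n) = (\<Sum>n | n \<in> S \<and> p\<^sup>2 dvd n. 1 / real n)"
      using S(1) by (intro sum.mono_neutral_cong_right) auto
    also have "\<dots> \<le> (\<Sum>n\<in>(\<lambda>m. p\<^sup>2 * m) ` R. 1 / real n)"
    proof (intro sum_mono2)
      show "{n. n \<in> S \<and> p\<^sup>2 dvd n} \<subseteq> (\<lambda>m. p\<^sup>2 * m) ` R"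
      proof
        fix n assume "n \<in> {n. n \<in> S \<and> p\<^sup>2 dvd n}"
        then obtain m where nm: "n = p\<^sup>2 * m" and n: "p\<^sup>2 * m \<in> S" by auto
        have pm: "1 \<le> p\<^sup>2 * m" "real (p\<^sup>2 * m) \<le> X" using S(2)[OF n] by blast+
        have "real m \<le> real (p\<^sup>2 * m)" using p0[OF p] by (intro of_nat_mono) simp
        then have "real m \<le> X" using pm(2) by linarith
        moreover have "1 \<le> m" using pm(1) by (cases m) auto
        ultimately have "m \<in> R" by (simp add: R_def)
        then show "n \<in> (\<lambda>m. p\<^sup>2 * m) ` R" unfolding nm by blast
      qed
    qed (use finR in auto)
    also have "\<dots> = (\<Sum>m\<in>R. 1 / real (p\<^sup>2 * m))"
      using p0[OF p] by (subst sum.reindex) (auto simp: inj_on_def)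
    also have "\<dots> = 1 / (real p)\<^sup>2 * (\<Sum>m\<in>R. 1 / real m)" by (simp add: sum_distrib_left)
    also have "\<dots> \<le> 1 / (real p)\<^sup>2 * (1 + ln X)"
      unfolding R_def by (intro mult_left_mono sum_reciprocal_le X) auto
    finally show "(\<Sum>n\<in>S. of_bool (p\<^sup>2 dvd n) / real n) \<le> 1 / (real p)\<^sup>2 * (1 + ln X)" .
  qed
  also have "\<dots> = (\<Sum>p\<in>P. 1 / (real p)\<^sup>2) * (1 + ln X)" by (simp only: sum_distrib_right)
  also have "\<dots> \<le> 2 / D * (1 + ln X)"
    using X by (intro mult_right_mono sum_reciprocal_squares_le D P) auto
  finally show ?thesis .
qed

lemma ramare_sum:
  fixes f :: "nat \<Rightarrow> complex" and D X \<theta> :: real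
  assumes P: "finite P" "\<And>p. p \<in> P \<Longrightarrow> prime p" "\<And>p. p \<in> P \<Longrightarrow> D < real p" and D: "D > 0" and X: "X \<ge> 1"
    and S: "finite S" "\<And>n. n \<in> S \<Longrightarrow> 1 \<le> n \<and> real n \<le> X"
    and f: "multiplicative f" "\<And>n. n > 0 \<Longrightarrow> norm (f n) \<le> 1"
  defines "g \<equiv> \<lambda>m. f m / (1 + of_nat (omega_in P m))"
  shows "norm ((\<Sum>n\<in>S. f n * of_bool (omega_in P n > 0) / of_nat n * e (real n * \<theta>))
           - (\<Sum>(p, m)\<in>{(p, m). p \<in> P \<and> p * m \<in> S}. f p / of_nat p * (g m / of_nat m) * e (real p * real m * \<theta>)))
         \<le> 4 / D * (1 + ln X)"
proof -
  have P0: "0 \<notin> P" using P(2) by fastforce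
  have "(\<Sum>(p, m)\<in>{(p, m). p \<in> P \<and> p * m \<in> S}. f p / of_nat p * (g m / of_nat m) * e (real p * real m * \<theta>)) =
     (\<Sum>n\<in>S. \<Sum>p | p \<in> P \<and> p dvd n. f p / of_nat p * (g (n div p) / of_nat (n div p)) * e (real p * real (n div p) * \<theta>))"
    using sum_over_prime_divisors_eq_pairs[OF P(1) S(1) P0,
        of "\<lambda>p m. f p / of_nat p * (g m / of_nat m) * e (real p * real m * \<theta>)"] by simp
  also have "\<dots> = (\<Sum>n\<in>S. (\<Sum>p | p \<in> P \<and> p dvd n. f p * g (n div p)) / of_nat n * e (real n * \<theta>))"
  proof (intro sum.cong refl)
    fix n
    have "f p / of_nat p * (g (n div p) / of_nat (n div p)) * e (real p * real (n div p) * \<theta>) =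
        f p * g (n div p) / of_nat n * e (real n * \<theta>)" if "p dvd n" for p
    proof -
      have "real p * real (n div p) = real n" "of_nat p * of_nat (n div p) = (of_nat n :: complex)"
        using that by (simp_all flip: of_nat_mult)
      then show ?thesis by (simp only: times_divide_times_eq)
    qed
    then show "(\<Sum>p | p \<in> P \<and> p dvd n. f p / of_nat p * (g (n div p) / of_nat (n div p)) * e (real p * real (n div p) * \<theta>))
      = (\<Sum>p | p \<in> P \<and> p dvd n. f p * g (n div p)) / of_nat n * e (real n * \<theta>)"
      by (simp add: sum_divide_distrib sum_distrib_right)
  qed
  finally have "norm ((\<Sum>n\<in>S. f n * of_bool (omega_in P n > 0) / of_nat n * e (real n * \<theta>))
           - (\<Sum>(p, m)\<in>{(p, m). p \<in> P \<and> p * m \<in> S}. f p / of_nat p * (g m / of_nat m) * e (real p * real m * \<theta>)))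
      = norm (\<Sum>n\<in>S. (f n * of_bool (omega_in P n > 0) - (\<Sum>p | p \<in> P \<and> p dvd n. f p * g (n div p))) / of_nat n * e (real n * \<theta>))"
    by (simp add: sum_subtractf diff_divide_distrib left_diff_distrib)
  also have "\<dots> \<le> (\<Sum>n\<in>S. 2 * (real (card {p \<in> P. p\<^sup>2 dvd n}) / real n))"
  proof (rule sum_norm_le)
    fix n assume n: "n \<in> S"
    then have "n > 0" using S(2) by fastforce
    then have "norm (f n * of_bool (omega_in P n > 0) - (\<Sum>p | p \<in> P \<and> p dvd n. f p * g (n div p)))
        \<le> 2 * real (card {p \<in> P. p\<^sup>2 dvd n})"
      unfolding g_def by (intro ramare_identity P f) auto
    then show "norm ((f n * of_bool (omega_in P n > 0) - (\<Sum>p | p \<in> P \<and> p dvd n. f p * g (n div p))) / of_nat n * e (real n * \<theta>))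
       \<le> 2 * (real (card {p \<in> P. p\<^sup>2 dvd n}) / real n)"
      by (simp add: norm_mult norm_divide divide_right_mono)
  qed
  also have "\<dots> = 2 * (\<Sum>n\<in>S. real (card {p \<in> P. p\<^sup>2 dvd n}) / real n)" by (simp only: sum_distrib_left)
  also have "\<dots> \<le> 2 * (2 / D * (1 + ln X))"
    by (intro mult_left_mono sum_square_divisors_le P D X S) auto
  finally show ?thesis by simp
qed

lemma multiplicative_smooth_restriction:
  assumes "multiplicative f"
  shows "multiplicative (\<lambda>n. f n * of_bool (\<forall>p\<in>prime_factors n. real p \<le> y))"
  using assms unfolding multiplicative_def
  by (auto simp: prime_factors_product of_bool_def)

lemma card_residue_class_octave_le:
  fixes H :: real
  assumes "H > 0" "q > 0" "\<And>p. p \<in> P \<Longrightarrow> real p \<le> 2 * H" "finite P"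
  shows "real (card {p \<in> P. p mod q = r}) \<le> 2 * H / real q + 1"
proof -
  have "card {p \<in> P. p mod q = r} = card ((\<lambda>p. p div q) ` {p \<in> P. p mod q = r})"
  proof (rule card_image[symmetric], rule inj_onI)
    fix x y assume "x \<in> {p \<in> P. p mod q = r}" "y \<in> {p \<in> P. p mod q = r}" "x div q = y div q"
    then show "x = y" by (metis (mono_tags, lifting) div_mod_decomp mem_Collect_eq)
  qed
  also have "\<dots> \<le> card {..nat \<lfloor>2 * H\<rfloor> div q}"
  proof (intro card_mono)
    show "(\<lambda>p. p div q) ` {p \<in> P. p mod q = r} \<subseteq> {..nat \<lfloor>2 * H\<rfloor> div q}"
      using assms(3) by (auto intro!: div_le_mono le_nat_floor)
  qed auto
  finally have "real (card {p \<in> P. p mod q = r}) \<le> real (nat \<lfloor>2 * H\<rfloor> div q) + 1" by simp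
  also have "real (nat \<lfloor>2 * H\<rfloor> div q) \<le> real (nat \<lfloor>2 * H\<rfloor>) / real q" by (rule of_nat_div_le_of_nat)
  also have "\<dots> \<le> 2 * H / real q" using assms by (intro divide_right_mono) auto
  finally show ?thesis by simp
qed

text \<open>
Here the trivial bounds \<open>N \<le> 2H + 1\<close> and \<open>B = 2H/q + 1\<close> suffice: with \<open>U \<ge> q^2/H\<close> the quantity under the root,
divided by \<open>H^2\<close>, is up to constants the sum of \<open>H/q^2\<close>, \<open>L^2/q\<close>, \<open>1/q\<close> and \<open>L^2/H\<close>, each of which is at most
\<open>L^2/P1\<close> in the range \<open>P1 \<le> H \<le> q^(3/2)\<close>, as \<open>P1\<close> is at most \<open>q^(1/2)\<close>.
\<close>

lemma medium_prime_block_le: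
  fixes q :: nat and H P1 L N B U :: real
  assumes q: "q > 0" and P1: "1 \<le> P1" "P1 \<le> real q powr (1/2)" "P1 \<le> H" and H: "H \<le> real q powr (3/2)" and L: "L \<ge> 1"
    and N: "0 \<le> N" "N \<le> 2 * H + 1" and B: "B = 2 * H / real q + 1" and U: "U \<ge> (real q)\<^sup>2 / H"
  shows "1 / H * sqrt (N * (B * (real q * (2 / U + 2 * L\<^sup>2 / real q)))) \<le> 6 * L * P1 powr (-1/2)"
proof -
  have q0: "real q \<ge> 1" and H0: "H > 0" using q P1 by auto
  have N3: "N \<le> 3 * H" using N P1 by linarith
  have "2 / U \<le> 2 / ((real q)\<^sup>2 / H)" using U q0 H0 by (intro divide_left_mono mult_pos_pos less_le_trans[OF _ U]) auto
  then have "N * (B * (real q * (2 / U + 2 * L\<^sup>2 / real q))) \<le>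
     (3 * H) * ((2 * H / real q + 1) * (real q * (2 * H / (real q)\<^sup>2 + 2 * L\<^sup>2 / real q)))"
    unfolding B using N N3 q0 H0 U
    by (intro mult_mono add_mono) (auto intro!: mult_nonneg_nonneg add_nonneg_nonneg divide_nonneg_nonneg order.trans[OF _ U])
  also have "\<dots> = H\<^sup>2 * (12 * (H / (real q)\<^sup>2) + 12 * L\<^sup>2 / real q + 6 / real q + 6 * L\<^sup>2 / H)"
    using q0 H0 by (simp add: field_simps power2_eq_square)
  also have "\<dots> \<le> H\<^sup>2 * (36 * (L\<^sup>2 / P1))"
  proof (rule mult_left_mono)
    have P1q: "P1 \<le> real q"
    proof -
      have "real q powr (1/2) \<le> real q powr 1" using q0 by (intro powr_mono) auto
      then show ?thesis using P1 q0 by simp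
    qed
    have L2: "L\<^sup>2 \<ge> 1" using L by (rule one_le_power)
    have "H / (real q)\<^sup>2 \<le> real q powr (3/2) / (real q)\<^sup>2" using H by (intro divide_right_mono) auto
    also have "\<dots> = real q powr (-1/2)"
      using q0 by (simp add: powr_diff[symmetric] flip: powr_numeral)
    also have "\<dots> = 1 / real q powr (1/2)" by (simp add: powr_minus_divide)
    also have "\<dots> \<le> 1 / P1" using P1 q0 by (intro divide_left_mono mult_pos_pos) auto
    also have "\<dots> \<le> L\<^sup>2 / P1" using L2 P1 by (intro divide_right_mono) auto
    finally have a: "H / (real q)\<^sup>2 \<le> L\<^sup>2 / P1" .
    have b: "L\<^sup>2 / real q \<le> L\<^sup>2 / P1" using P1 P1q q0 by (intro divide_left_mono) auto
    have c: "1 / real q \<le> L\<^sup>2 / P1" using P1 P1q q0 L2 by (intro frac_le) auto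
    have d: "L\<^sup>2 / H \<le> L\<^sup>2 / P1" using P1 H0 by (intro divide_left_mono) auto
    show "12 * (H / (real q)\<^sup>2) + 12 * L\<^sup>2 / real q + 6 / real q + 6 * L\<^sup>2 / H \<le> 36 * (L\<^sup>2 / P1)"
      using a b c d by simp
  qed auto
  also have "\<dots> = (H * (6 * L * P1 powr (-1/2)))\<^sup>2"
  proof -
    have "(P1 powr (-1/2))\<^sup>2 = 1 / P1"
      using P1 by (simp add: power2_eq_square powr_add[symmetric] powr_minus_divide)
    then show ?thesis by (simp add: power_mult_distrib)
  qed
  finally have "sqrt (N * (B * (real q * (2 / U + 2 * L\<^sup>2 / real q)))) \<le> H * (6 * L * P1 powr (-1/2))"
    using H0 L by (intro real_le_lsqrt) auto
  then have "1 / H * sqrt (N * (B * (real q * (2 / U + 2 * L\<^sup>2 / real q)))) \<le> 1 / H * (H * (6 * L * P1 powr (-1/2)))"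
    using H0 by (intro mult_left_mono) auto
  then show ?thesis using H0 by simp
qed

section \<open>Integers without a large prime factor\<close>

lemma omega_in_pos_iff: "finite P \<Longrightarrow> omega_in P n > 0 \<longleftrightarrow> (\<exists>p\<in>P. p dvd n)"
  by (auto simp: omega_in_def card_gt_0_iff)

lemma smooth_tail_exponential_sum_le:
  fixes f :: "nat \<Rightarrow> complex" and \<theta> :: real
  assumes tail: "\<forall>y\<ge>exp 2. \<forall>Z\<ge>1. \<forall>N::nat.
     (\<Sum>n | Z < real n \<and> n \<le> N \<and> (\<forall>p\<in>prime_factors n. real p \<le> y). 1 / real n)
       \<le> C * ln y ^ 12 * exp (- (ln Z / ln y))"
    and y: "y \<ge> exp 2" and Z: "Z \<ge> 1" and f: "\<And>n. n > 0 \<Longrightarrow> norm (f n) \<le> 1"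
    and S: "finite S" "\<And>n. n \<in> S \<Longrightarrow> Z < real n \<and> (\<forall>p\<in>prime_factors n. real p \<le> y)"
  shows "norm (\<Sum>n\<in>S. f n / of_nat n * e (real n * \<theta>)) \<le> C * ln y ^ 12 * exp (- (ln Z / ln y))"
proof -
  obtain N where N: "S \<subseteq> {..N}" using S(1) unfolding finite_nat_iff_bounded_le ..
  have "norm (\<Sum>n\<in>S. f n / of_nat n * e (real n * \<theta>)) \<le> (\<Sum>n\<in>S. 1 / real n)"
  proof (rule sum_norm_le)
    fix n assume n: "n \<in> S"
    then have "n > 0" using S(2)[OF n] Z by (auto intro: gr0I)
    then show "norm (f n / of_nat n * e (real n * \<theta>)) \<le> 1 / real n"
      using f by (simp add: norm_mult norm_divide divide_right_mono)
  qed
  also have "\<dots> \<le> (\<Sum>n | Z < real n \<and> n \<le> N \<and> (\<forall>p\<in>prime_factors n. real p \<le> y). 1 / real n)"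
  proof (rule sum_mono2)
    show "finite {n. Z < real n \<and> n \<le> N \<and> (\<forall>p\<in>prime_factors n. real p \<le> y)}"
      by (rule finite_subset[of _ "{..N}"]) auto
  qed (use S(2) N in auto)
  also have "\<dots> \<le> C * ln y ^ 12 * exp (- (ln Z / ln y))" using tail y Z by blast
  finally show ?thesis .
qed

text \<open>
There are \<open>O(l)\<close> dyadic blocks between \<open>exp(sqrt l)\<close> and \<open>q^(3/2)\<close>, and each saves \<open>exp(-sqrt l / 2)\<close> against a
loss of \<open>1 + ln X \<le> 1 + l^2\<close>.
\<close>

lemma medium_primes_sum_bounded:
  fixes q :: nat and a :: int and f :: "nat \<Rightarrow> complex" and X l :: real
  assumes q: "q > 0" "coprime a (int q)" and l: "l = ln (real q)" "l \<ge> 4"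
    and X: "(real q)\<^sup>2 \<le> X" "X \<le> exp (l\<^sup>2)"
    and f: "multiplicative f" "\<And>n. n > 0 \<Longrightarrow> norm (f n) \<le> 1"
    and small: "4 * exp (- sqrt l) * (1 + l\<^sup>2) \<le> 1" "(3 * l + 1) * (6 * (1 + l\<^sup>2) * exp (- sqrt l / 2)) \<le> 1"
  defines "P \<equiv> {p. prime p \<and> exp (sqrt l) < real p \<and> real p \<le> real q powr (3/2)}"
  shows "norm (\<Sum>n | (real q)\<^sup>2 < real n \<and> real n \<le> X.
           f n * of_bool (omega_in P n > 0) / of_nat n * e (real n * (a / q))) \<le> 6"
proof -
  define P1 where "P1 = exp (sqrt l)"
  define S where "S = {n. (real q)\<^sup>2 < real n \<and> real n \<le> X}"
  define g where "g m = f m / (1 + of_nat (omega_in P m))" for m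
  define J where "J = nat \<lceil>3 * l\<rceil>"
  define T where "T = (\<Sum>(p, m)\<in>{(p, m). p \<in> P \<and> p * m \<in> S}. f p / of_nat p * (g m / of_nat m) * e (real p * real m * (a / q)))"
  have qe: "real q = exp l" using q l by simp
  have q1: "real q \<ge> 1" using q by simp
  have P11: "P1 \<ge> 1" using l by (simp add: P1_def)
  have q2: "(real q)\<^sup>2 \<ge> 1" using q1 by (rule one_le_power)
  have X1: "X \<ge> 1" using X q2 by linarith
  have lnX: "ln X \<le> l\<^sup>2" using X X1 ln_le_cancel_iff[of X "exp (l\<^sup>2)"] by simp
  have lnX0: "ln X \<ge> 0" using X1 by simp
  have finP: "finite P" unfolding P_def by (rule finite_primes_upto)
  have Pp: "prime p" "P1 < real p" "real p \<le> real q powr (3/2)" if "p \<in> P" for p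
    using that by (auto simp: P_def P1_def)
  have finS: "finite S" unfolding S_def by (rule finite_nat_real_interval)
  have "norm ((\<Sum>n\<in>S. f n * of_bool (omega_in P n > 0) / of_nat n * e (real n * (a / q))) - T)
      \<le> 4 / P1 * (1 + ln X)"
    unfolding T_def g_def
  proof (rule ramare_sum)
    fix n assume "n \<in> S"
    then show "1 \<le> n \<and> real n \<le> X" using q2 by (auto simp: S_def Suc_le_eq intro: gr0I)
  qed (use finP Pp P11 X1 finS f in auto)
  also have "\<dots> \<le> 4 / P1 * (1 + l\<^sup>2)" using lnX P11 by (intro mult_left_mono) auto
  also have "\<dots> = 4 * exp (- sqrt l) * (1 + l\<^sup>2)" by (simp add: P1_def exp_minus field_simps)
  also have "\<dots> \<le> 1" by (rule small)
  finally have R: "norm ((\<Sum>n\<in>S. f n * of_bool (omega_in P n > 0) / of_nat n * e (real n * (a / q))) - T) \<le> 1" .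
  \<comment> \<open>Hence the blocks starting at \<open>P1\<close> reach \<open>q^(3/2)\<close>.\<close>
  have exp2: "exp (3/2 * l) \<le> 2 ^ J"
  proof -
    note ln2 = half_le_ln_2
    have "3 * l \<le> real J" unfolding J_def by (rule real_nat_ceiling_ge)
    then have "3/2 * l \<le> real J * (1/2)" by simp
    also have "\<dots> \<le> real J * ln 2" using ln2 by (intro mult_left_mono) auto
    finally have "exp (3/2 * l) \<le> exp (real J * ln 2)" by simp
    also have "\<dots> = 2 ^ J" by (simp add: exp_of_nat_mult)
    finally show ?thesis .
  qed
  have H0: "real q powr (3/2) = exp (3/2 * l)" using q l by (simp add: powr_def)
  have Peq: "{(p, m). p \<in> P \<and> p * m \<in> S} = {(p, m). p \<in> P \<and> 1/2 < real m \<and> (real q)\<^sup>2 < real (p * m) \<and> real (p * m) \<le> X}"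
  proof -
    have "1/2 < real m" if "(real q)\<^sup>2 < real (p * m)" for p m
      using that by (cases m) auto
    then have "(p \<in> P \<and> p * m \<in> S) = (p \<in> P \<and> 1/2 < real m \<and> (real q)\<^sup>2 < real (p * m) \<and> real (p * m) \<le> X)" for p m
      unfolding S_def mem_Collect_eq by blast
    then show ?thesis by (simp only:)
  qed
  define Pj where "Pj j = {p \<in> P. P1 * 2 ^ j < real p \<and> real p \<le> P1 * 2 ^ Suc j}" for j
  have "norm T \<le> 4 + (\<Sum>j<J. 1 / (P1 * 2 ^ j) * sqrt (real (card (Pj j)) *
      ((2 * (P1 * 2 ^ j) / real q + 1) * (real q *
          (2 / max (1/2) ((real q)\<^sup>2 / (P1 * 2 ^ j)) + 2 * (1 + ln X)\<^sup>2 / real q)))))"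
    (is "_ \<le> 4 + (\<Sum>j<J. ?t j)")
    unfolding T_def Peq Pj_def
  proof (rule type_II_sum[OF q finP])
    fix p assume p: "p \<in> P"
    have "real p \<le> 1 * exp (3/2 * l)" using Pp(3)[OF p] H0 by simp
    also have "\<dots> \<le> P1 * 2 ^ J" using exp2 P11 by (intro mult_mono) auto
    finally show "P1 < real p \<and> real p \<le> P1 * 2 ^ J" using Pp(2)[OF p] by simp
    show "norm (f p) \<le> 1" using Pp(1)[OF p] f(2) prime_gt_0_nat by blast
  next
    fix m :: nat assume "m > 0"
    then show "norm (g m) \<le> 1 / (1 + real (omega_in P m))"
      unfolding g_def by (intro norm_ramare_weight_le f(2))
  next
    have "l \<ge> 1" using l by simp
    then have "exp l \<ge> 2" using exp_ge_add_one_self[of l] by linarith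
    then have "real q \<ge> 2" using qe by simp
    then have "2 * 1 \<le> real q * real q" by (intro mult_mono) auto
    then show "X \<ge> 2" using X by (simp add: power2_eq_square)
  next
    fix j r
    show "real (card {p \<in> {p \<in> P. P1 * 2 ^ j < real p \<and> real p \<le> P1 * 2 ^ Suc j}. p mod q = r})
        \<le> 2 * (P1 * 2 ^ j) / real q + 1"
      using P11 q finP by (intro card_residue_class_octave_le) auto
  qed (use Pp P11 q2 in auto)
  also have "(\<Sum>j<J. ?t j)
      \<le> (\<Sum>j<J. 6 * (1 + ln X) * P1 powr (-1/2))"
  proof (intro sum_mono)
    fix j
    define H where "H = P1 * 2 ^ j"
    have HP: "P1 \<le> H"
    proof -
      have "P1 * 1 \<le> P1 * 2 ^ j" using P11 by (intro mult_left_mono) auto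
      then show ?thesis by (simp add: H_def)
    qed
    show "?t j \<le> 6 * (1 + ln X) * P1 powr (-1/2)"
    proof (cases "H \<le> real q powr (3/2)")
      case True
      have "sqrt l \<le> l / 2"
        using l by (intro real_le_lsqrt) (auto simp: power2_eq_square)
      then have "P1 \<le> real q powr (1/2)" using q l by (simp add: P1_def powr_def)
      moreover have "real (card (Pj j)) \<le> 2 * H + 1"
        using card_residue_class_octave_le[of H 1 "Pj j" 0] HP P11 finP by (auto simp: Pj_def H_def)
      ultimately show ?thesis
        unfolding H_def[symmetric] using q P11 HP True lnX0
        by (intro medium_prime_block_le) auto
    next
      case False
      then have "Pj j = {}" using Pp(3) by (force simp: Pj_def H_def)
      then have c: "card (Pj j) = 0" by (simp only: card.empty)
      show ?thesis unfolding c using lnX0 by simp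
    qed
  qed
  also have "\<dots> = real J * (6 * (1 + ln X) * P1 powr (-1/2))" by simp
  also have "\<dots> \<le> (3 * l + 1) * (6 * (1 + l\<^sup>2) * exp (- sqrt l / 2))"
  proof (intro mult_mono)
    show "real J \<le> 3 * l + 1" unfolding J_def using l by linarith
    show "P1 powr (-1/2) \<le> exp (- sqrt l / 2)" by (simp add: P1_def powr_def)
  qed (use l lnX lnX0 in auto)
  also have "\<dots> \<le> 1" by (rule small)
  finally have "norm T \<le> 5" by simp
  then have "norm (\<Sum>n\<in>S. f n * of_bool (omega_in P n > 0) / of_nat n * e (real n * (a / q))) \<le> 1 + 5"
    using R norm_triangle_sub[of "\<Sum>n\<in>S. f n * of_bool (omega_in P n > 0) / of_nat n * e (real n * (a / q))" T] by linarith
  then show ?thesis by (simp add: S_def)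
qed

text \<open>
With \<open>H0 = q^(3/2)\<close>, \<open>P1 = exp(sqrt l)\<close> and \<open>X0 = exp(l^2)\<close>, the range is cut into three.  The integers above \<open>X0\<close>
are \<open>H0\<close>-smooth, and those with all primes at most \<open>P1\<close> exceed \<open>q^2\<close>; Rankin's bound
applies to both, with \<open>ln X0 / ln H0 = 2l/3\<close> and \<open>ln(q^2)/ln P1 = 2 sqrt l\<close>.  In the remaining set the smoothness
condition is absorbed into the multiplicative function.
\<close>

lemma smooth_part_bounded:
  "\<exists>C l0. \<forall>q::nat. \<forall>a::int. \<forall>x. \<forall>f. q > 0 \<longrightarrow> l0 \<le> ln (real q) \<longrightarrow> coprime a (int q) \<longrightarrow> multiplicative f
     \<longrightarrow> (\<forall>n>0. norm (f n) \<le> 1) \<longrightarrow>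
     norm (\<Sum>n | (real q)\<^sup>2 < real n \<and> real n \<le> x \<and> (\<forall>p\<in>prime_factors n. real p \<le> real q powr (3/2)).
         f n / of_nat n * e (real n * (a / q))) \<le> C"
proof -
  obtain C where C: "C > 0" and tail: "\<forall>y\<ge>exp 2. \<forall>Z\<ge>1. \<forall>N::nat.
     (\<Sum>n | Z < real n \<and> n \<le> N \<and> (\<forall>p\<in>prime_factors n. real p \<le> y). 1 / real n)
       \<le> C * ln y ^ 12 * exp (- (ln Z / ln y))"
    using smooth_reciprocal_tail by blast
  have "eventually (\<lambda>l::real. 4 * exp (- sqrt l) * (1 + l\<^sup>2) \<le> 1 \<and>
      (3 * l + 1) * (6 * (1 + l\<^sup>2) * exp (- sqrt l / 2)) \<le> 1 \<and>
      (3/2 * l) ^ 12 * exp (- (2/3 * l)) \<le> 1 \<and> sqrt l ^ 12 * exp (- (2 * sqrt l)) \<le> 1 \<and> l \<ge> 4) at_top"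
    (is "eventually ?small _")
    by (intro eventually_conj; real_asymp)
  then obtain l0 where l0: "\<And>l. l \<ge> l0 \<Longrightarrow> ?small l"
    unfolding eventually_at_top_linorder by blast
  show ?thesis
  proof (rule exI[of _ "2 * C + 6"], rule exI[of _ l0], intro allI impI)
    fix q :: nat and a :: int and x :: real and f :: "nat \<Rightarrow> complex"
    assume q: "q > 0" and ql: "l0 \<le> ln (real q)" and cop: "coprime a (int q)" and f: "multiplicative f"
      and fb: "\<forall>n>0. norm (f n) \<le> 1"
    define l where "l = ln (real q)"
    have small: "4 * exp (- sqrt l) * (1 + l\<^sup>2) \<le> 1"
      "(3 * l + 1) * (6 * (1 + l\<^sup>2) * exp (- sqrt l / 2)) \<le> 1"
      "(3/2 * l) ^ 12 * exp (- (2/3 * l)) \<le> 1" "sqrt l ^ 12 * exp (- (2 * sqrt l)) \<le> 1" "l \<ge> 4"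
      using l0[of l] ql by (auto simp: l_def)
    have qe: "real q = exp l" using q by (simp add: l_def)
    define H0 where "H0 = real q powr (3/2)"
    define P1 where "P1 = exp (sqrt l)"
    define X0 where "X0 = exp (l\<^sup>2)"
    define X where "X = min x X0"
    define sm where "sm y n \<longleftrightarrow> (\<forall>p\<in>prime_factors n. real p \<le> y)" for y and n :: nat
    define t where "t n = f n / of_nat n * e (real n * (a / q))" for n
    define N where "N = {n. (real q)\<^sup>2 < real n \<and> real n \<le> x \<and> sm H0 n}"
    define N1 where "N1 = {n\<in>N. X0 < real n}"
    define N2 where "N2 = {n\<in>N. real n \<le> X0 \<and> sm P1 n}"
    define N3 where "N3 = {n\<in>N. real n \<le> X0 \<and> \<not> sm P1 n}"
    define P where "P = {p. prime p \<and> exp (sqrt l) < real p \<and> real p \<le> real q powr (3/2)}"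
    define S where "S = {n. (real q)\<^sup>2 < real n \<and> real n \<le> X}"
    define f' where "f' n = f n * of_bool (sm H0 n)" for n
    have H0e: "H0 = exp (3/2 * l)" using q by (simp add: H0_def powr_def l_def)
    have finN: "finite N" by (rule finite_subset[OF _ finite_nat_real_interval[of "(real q)\<^sup>2" x]]) (auto simp: N_def)
    have finP: "finite P" unfolding P_def by (rule finite_primes_upto)
    have finN123: "finite N1" "finite N2" "finite N3"
      unfolding N1_def N2_def N3_def by (intro finite_subset[OF _ finN], blast)+
    have q2: "(real q)\<^sup>2 \<ge> 1" using q by (intro one_le_power) auto
    have sqrtl: "sqrt l \<ge> 2" using small(5) real_le_rsqrt[of 2 l] by simp
    have X0q: "(real q)\<^sup>2 \<le> X0"
    proof -
      have "2 * l \<le> l\<^sup>2" using small(5) by (simp add: power2_eq_square)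
      then show ?thesis unfolding qe X0_def by (simp flip: exp_of_nat_mult)
    qed
    have b1: "norm (\<Sum>n\<in>N1. t n) \<le> C"
    proof -
      have "norm (\<Sum>n\<in>N1. t n) \<le> C * ln H0 ^ 12 * exp (- (ln X0 / ln H0))"
        unfolding t_def
      proof (rule smooth_tail_exponential_sum_le[OF tail])
        show "H0 \<ge> exp 2" using small(5) by (simp add: H0e)
      qed (use finN123 fb in \<open>auto simp: N1_def N_def sm_def X0_def\<close>)
      also have "ln H0 ^ 12 = (3/2 * l) ^ 12" by (simp add: H0e)
      also have "ln X0 / ln H0 = 2/3 * l" using small(5) by (simp add: H0e X0_def power2_eq_square)
      also have "C * (3/2 * l) ^ 12 * exp (- (2/3 * l)) = C * ((3/2 * l) ^ 12 * exp (- (2/3 * l)))" by simp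
      also have "\<dots> \<le> C * 1" using C small(3) by (intro mult_left_mono) auto
      finally show ?thesis by simp
    qed
    have b2: "norm (\<Sum>n\<in>N2. t n) \<le> C"
    proof -
      have "norm (\<Sum>n\<in>N2. t n) \<le> C * ln P1 ^ 12 * exp (- (ln ((real q)\<^sup>2) / ln P1))"
        unfolding t_def
      proof (rule smooth_tail_exponential_sum_le[OF tail])
        show "P1 \<ge> exp 2" using sqrtl by (simp add: P1_def)
      qed (use finN123 fb q2 in \<open>auto simp: N2_def N_def sm_def simp del: of_nat_power of_nat_power_less_of_nat_cancel_iff\<close>)
      also have "ln P1 = sqrt l" by (simp add: P1_def)
      also have "ln ((real q)\<^sup>2) / sqrt l = 2 * sqrt l"
      proof -
        have "ln ((real q)\<^sup>2) = 2 * l" using q by (simp add: ln_realpow l_def)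
        also have "l = sqrt l * sqrt l" using small(5) by simp
        finally have "ln ((real q)\<^sup>2) = 2 * (sqrt l * sqrt l)" .
        moreover have "sqrt l \<noteq> 0" using sqrtl by linarith
        ultimately show ?thesis by (metis mult.assoc nonzero_mult_div_cancel_right)
      qed
      also have "C * sqrt l ^ 12 * exp (- (2 * sqrt l)) = C * (sqrt l ^ 12 * exp (- (2 * sqrt l)))" by simp
      also have "\<dots> \<le> C * 1" using C small(4) by (intro mult_left_mono) auto
      finally show ?thesis by simp
    qed
    have b3: "norm (\<Sum>n\<in>N3. t n) \<le> 6"
    proof (cases "(real q)\<^sup>2 \<le> x")
      case False
      have "n \<notin> N3" for n
      proof
        assume "n \<in> N3"
        then have "(real q)\<^sup>2 < real n" "real n \<le> x" unfolding N3_def N_def by blast+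
        then show False using False by linarith
      qed
      then have "N3 = {}" by blast
      then show ?thesis by simp
    next
      case True
      have "(\<Sum>n\<in>N3. t n) = (\<Sum>n\<in>S. f' n * of_bool (omega_in P n > 0) / of_nat n * e (real n * (a / q)))"
      proof (rule sum.mono_neutral_cong_left)
        show "finite S" unfolding S_def by (rule finite_nat_real_interval)
        show "N3 \<subseteq> S" by (auto simp: N3_def N_def S_def X_def)
        have key: "n \<in> N3 \<longleftrightarrow> sm H0 n \<and> omega_in P n > 0" if n: "n \<in> S" for n
        proof -
          have n0: "n > 0" using n q2 by (auto simp: S_def intro: gr0I)
          have "n \<in> N3 \<longleftrightarrow> sm H0 n \<and> \<not> sm P1 n" using n by (auto simp: N3_def N_def S_def X_def)
          also have "\<dots> \<longleftrightarrow> sm H0 n \<and> (\<exists>p\<in>P. p dvd n)"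
          proof -
            have "p \<in> prime_factors n \<longleftrightarrow> prime p \<and> p dvd n" for p using n0 by (auto simp: in_prime_factors_iff)
            then have "sm y n \<longleftrightarrow> (\<forall>p. prime p \<longrightarrow> p dvd n \<longrightarrow> real p \<le> y)" for y
              unfolding sm_def by blast
            moreover have "(\<exists>p\<in>P. p dvd n) \<longleftrightarrow> (\<exists>p. prime p \<and> P1 < real p \<and> real p \<le> H0 \<and> p dvd n)"
              unfolding P_def P1_def H0_def by blast
            ultimately show ?thesis using not_le by metis
          qed
          finally show ?thesis using omega_in_pos_iff[OF finP, of n] by simp
        qed
        show "\<forall>n\<in>S - N3. f' n * of_bool (omega_in P n > 0) / of_nat n * e (real n * (a / q)) = 0"
        proof
          fix n assume "n \<in> S - N3"
          then have "\<not> (sm H0 n \<and> omega_in P n > 0)" using key by blast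
          then show "f' n * of_bool (omega_in P n > 0) / of_nat n * e (real n * (a / q)) = 0" by (auto simp: f'_def)
        qed
        fix n assume n: "n \<in> N3"
        then have "n \<in> S" by (auto simp: N3_def N_def S_def X_def)
        then have "sm H0 n \<and> omega_in P n > 0" using key n by blast
        then show "t n = f' n * of_bool (omega_in P n > 0) / of_nat n * e (real n * (a / q))"
          by (simp add: t_def f'_def)
      qed
      also have "norm \<dots> \<le> 6"
        unfolding S_def P_def
      proof (rule medium_primes_sum_bounded[OF q cop l_def small(5)])
        show "(real q)\<^sup>2 \<le> X" using True X0q by (simp add: X_def)
        show "X \<le> exp (l\<^sup>2)" by (simp add: X_def X0_def)
        show "multiplicative f'" unfolding f'_def sm_def by (rule multiplicative_smooth_restriction[OF f])
        show "norm (f' n) \<le> 1" if "n > 0" for n using fb that by (auto simp: f'_def)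
      qed (use small in auto)
      finally show ?thesis .
    qed
    have "(\<Sum>n\<in>N. t n) = (\<Sum>n\<in>N1. t n) + ((\<Sum>n\<in>N2. t n) + (\<Sum>n\<in>N3. t n))"
    proof -
      have "N = N1 \<union> (N2 \<union> N3)" by (auto simp: N1_def N2_def N3_def)
      moreover have "N1 \<inter> (N2 \<union> N3) = {}" "N2 \<inter> N3 = {}" by (auto simp: N1_def N2_def N3_def)
      ultimately show ?thesis using finN123 by (simp add: sum.union_disjoint)
    qed
    then have "norm (\<Sum>n\<in>N. t n) \<le> C + (C + 6)"
      using norm_triangle_mono[OF b1 norm_triangle_mono[OF b2 b3]] by simp
    then show "norm (\<Sum>n | (real q)\<^sup>2 < real n \<and> real n \<le> x \<and> (\<forall>p\<in>prime_factors n. real p \<le> real q powr (3/2)).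
         f n / of_nat n * e (real n * (a / q))) \<le> 2 * C + 6"
      by (simp add: N_def t_def sm_def H0_def)
  qed
qed

section \<open>Integers with a large prime factor\<close>

lemma sum_reciprocal_primes_range:
  fixes Z :: real
  assumes "Z \<ge> 2"
  shows "(\<Sum>p | prime p \<and> Z < real p \<and> real p \<le> Z * 2 ^ K. 1 / real p) \<le> real K * (102 / ln Z)"
proof (induction K)
  case 0
  have "{p. prime p \<and> Z < real p \<and> real p \<le> Z * 2 ^ 0} = {}" by auto
  then show ?case by (simp only: sum.empty)
next
  case (Suc K)
  define H where "H = Z * 2 ^ K"
  have "Z * 1 \<le> Z * 2 ^ K" using assms by (intro mult_left_mono) auto
  then have HZ: "Z \<le> H" by (simp add: H_def)
  have H2: "H \<ge> 2" using HZ assms by linarith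
  have fin: "finite {p. prime p \<and> Z < real p \<and> real p \<le> H}" "finite {p. prime p \<and> H < real p \<and> real p \<le> 2 * H}"
    by (rule finite_primes_upto)+
  have twoH: "Z * 2 ^ Suc K = 2 * H" by (simp add: H_def)
  have set: "{p. prime p \<and> Z < real p \<and> real p \<le> Z * 2 ^ Suc K} =
     {p. prime p \<and> Z < real p \<and> real p \<le> H} \<union> {p. prime p \<and> H < real p \<and> real p \<le> 2 * H}"
    unfolding twoH using HZ H2 by auto
  have "(\<Sum>p | prime p \<and> Z < real p \<and> real p \<le> Z * 2 ^ Suc K. 1 / real p) =
      (\<Sum>p | prime p \<and> Z < real p \<and> real p \<le> H. 1 / real p) + (\<Sum>p | prime p \<and> H < real p \<and> real p \<le> 2 * H. 1 / real p)"
    unfolding set using fin by (intro sum.union_disjoint) auto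
  also have "\<dots> \<le> real K * (102 / ln Z) + 102 / ln H"
    using Suc[folded H_def] H2 by (intro add_mono sum_reciprocal_primes_dyadic)
  also have "102 / ln H \<le> 102 / ln Z" using HZ assms by (intro divide_left_mono) auto
  also have "real K * (102 / ln Z) + 102 / ln Z = real (Suc K) * (102 / ln Z)"
    by (simp only: of_nat_Suc distrib_right mult_1 add.commute)
  finally show ?case by simp
qed

lemma sum_reciprocal_primes_short_range:
  fixes Q M Z :: real
  assumes M: "M \<ge> 1" and Z: "Z \<ge> 2" "2 * M * Z \<le> Q"
  shows "(\<Sum>p | prime p \<and> Q / M < real p \<and> real p \<le> Q. 1 / real p) \<le> (2 * ln M + 1) * (102 / ln Z)"
proof -
  define K where "K = nat \<lceil>log 2 M\<rceil>"
  have logM: "log 2 M \<ge> 0" using M by simp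
  have K: "real K \<le> log 2 M + 1" "log 2 M \<le> real K" unfolding K_def using logM by linarith+
  have MK: "M \<le> 2 ^ K"
  proof -
    have "M = 2 powr (log 2 M)" using M by simp
    also have "\<dots> \<le> 2 powr (real K)" using K by (intro powr_mono) auto
    finally show ?thesis by (simp add: powr_realpow)
  qed
  have KM: "2 ^ K \<le> 2 * M"
  proof -
    have "2 ^ K = 2 powr (real K)" by (simp add: powr_realpow)
    also have "\<dots> \<le> 2 powr (log 2 M + 1)" using K by (intro powr_mono) auto
    also have "\<dots> = 2 * M" using M by (simp add: powr_add)
    finally show ?thesis .
  qed
  define Z' where "Z' = Q / 2 ^ K"
  have Q0: "Q > 0" using M Z by (smt (verit) mult_pos_pos)
  have ZZ: "Z \<le> Z'"
  proof -
    have "Z * 2 ^ K \<le> Z * (2 * M)" using KM Z by (intro mult_left_mono) auto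
    also have "\<dots> \<le> Q" using Z by (simp add: mult_ac)
    finally show ?thesis by (simp add: Z'_def field_simps)
  qed
  have QM: "Z' \<le> Q / M" unfolding Z'_def using MK M Q0 by (intro divide_left_mono) auto
  have "(\<Sum>p | prime p \<and> Q / M < real p \<and> real p \<le> Q. 1 / real p) \<le>
      (\<Sum>p | prime p \<and> Z' < real p \<and> real p \<le> Z' * 2 ^ K. 1 / real p)"
  proof (rule sum_mono2)
    show "finite {p. prime p \<and> Z' < real p \<and> real p \<le> Z' * 2 ^ K}" by (rule finite_primes_upto)
    show "{p. prime p \<and> Q / M < real p \<and> real p \<le> Q} \<subseteq> {p. prime p \<and> Z' < real p \<and> real p \<le> Z' * 2 ^ K}"
      using QM by (auto simp: Z'_def)
  qed auto
  also have "\<dots> \<le> real K * (102 / ln Z')" using ZZ Z by (intro sum_reciprocal_primes_range) auto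
  also have "\<dots> \<le> (2 * ln M + 1) * (102 / ln Z)"
  proof (intro mult_mono divide_left_mono)
    note ln2 = half_le_ln_2
    have "log 2 M \<le> ln M / (1/2)"
      unfolding log_def using ln2 M by (intro divide_left_mono) auto
    then show "real K \<le> 2 * ln M + 1" using K by simp
  qed (use ZZ Z M in auto)
  finally show ?thesis .
qed

text \<open>
Here \<open>s\<close> stands for \<open>ln ln x\<close> and \<open>N\<close> for the number of primes in the block \<open>(H, 2H]\<close>, \<open>H = H0 2^j\<close>.  Both \<open>N\<close> and
\<open>\<phi>(q) B\<close> are \<open>O(H/ln H)\<close>, so the root is \<open>O((H/ln H) (q/(\<phi>(q) M))^(1/2))\<close>, and \<open>M = s^3\<close> turns the
last factor into \<open>O(1/s)\<close>.
\<close>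

lemma large_prime_block_le:
  fixes q j :: nat and H0 L s M N C B U :: real
  assumes q: "real q \<ge> 2" "real q \<le> H0" and s: "s > 0" and M: "M = s ^ 3"
    and LM: "(1 + L)\<^sup>2 * M \<le> real q" and C: "C > 0" "real q / real (totient q) \<le> C * s"
    and U: "U \<ge> M" and N: "0 \<le> N" "N \<le> 102 * (H0 * 2 ^ j) / ln (H0 * 2 ^ j)"
    and B: "B = 102 * (H0 * 2 ^ j) / (real (totient q) * ln (H0 * 2 ^ j))"
  shows "1 / (H0 * 2 ^ j) * sqrt (N * (B * (real q * (2 / U + 2 * (1 + L)\<^sup>2 / real q))))
    \<le> 408 * sqrt C / s * (1 / real (Suc j))"
proof -
  define H where "H = H0 * 2 ^ j"
  have H2: "2 ^ Suc j \<le> H"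
  proof -
    have "2 * 2 ^ j \<le> H0 * 2 ^ j" using q by (intro mult_right_mono) auto
    then show ?thesis by (simp add: H_def)
  qed
  have lnH: "ln H \<ge> real (Suc j) / 2"
  proof -
    note ln2 = half_le_ln_2
    have "real (Suc j) * (1/2) \<le> real (Suc j) * ln 2" using ln2 by (intro mult_left_mono) auto
    also have "\<dots> = ln (2 ^ Suc j)" by (simp only: ln_realpow zero_less_numeral)
    also have "\<dots> \<le> ln H" using H2 by (subst ln_le_cancel_iff) (auto intro: less_le_trans[OF _ H2])
    finally show ?thesis by simp
  qed
  have H0: "H > 0" by (rule less_le_trans[OF _ H2]) simp
  have lnH0: "ln H > 0" using lnH by (rule less_le_trans[rotated]) simp
  have M0: "M > 0" using s M by simp
  have phi: "real (totient q) > 0" using q by (auto intro: Nat.gr0I)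
  define E where "E = 102 * H / ln H"
  have E0: "E \<ge> 0" using H0 lnH0 by (simp add: E_def)
  have BE: "B = E / real (totient q)" unfolding B E_def H_def by simp
  have inner: "real q * (2 / U + 2 * (1 + L)\<^sup>2 / real q) \<le> real q * (4 / M)"
  proof (intro mult_left_mono)
    have "2 / U \<le> 2 / M" using U M0 by (intro divide_left_mono) auto
    moreover have "2 * (1 + L)\<^sup>2 / real q \<le> 2 / M" using LM M0 q by (simp add: field_simps)
    ultimately show "2 / U + 2 * (1 + L)\<^sup>2 / real q \<le> 4 / M" by simp
  qed simp
  have step: "B * (real q * (2 / U + 2 * (1 + L)\<^sup>2 / real q)) \<le> E / real (totient q) * (real q * (4 / M))"
    unfolding BE by (rule mult_left_mono[OF inner]) (use E0 in simp)
  have nonneg: "0 \<le> B * (real q * (2 / U + 2 * (1 + L)\<^sup>2 / real q))"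
    unfolding BE using E0 U M0 by (intro mult_nonneg_nonneg add_nonneg_nonneg divide_nonneg_nonneg) auto
  have "N \<le> E" using N by (simp only: H_def E_def)
  then have "N * (B * (real q * (2 / U + 2 * (1 + L)\<^sup>2 / real q))) \<le> E * (E / real (totient q) * (real q * (4 / M)))"
    by (rule mult_mono[OF _ step E0 nonneg])
  also have "\<dots> = E\<^sup>2 * (4 / M) * (real q / real (totient q))"
    using phi M0 by (simp add: field_simps power2_eq_square)
  also have "\<dots> \<le> E\<^sup>2 * (4 / M) * (C * s)" using C M0 by (intro mult_left_mono) auto
  also have "\<dots> = (E * (2 * sqrt C / s))\<^sup>2"
    using C(1) s by (simp add: M power_mult_distrib power_divide power2_eq_square power3_eq_cube)
  finally have "sqrt (N * (B * (real q * (2 / U + 2 * (1 + L)\<^sup>2 / real q)))) \<le> E * (2 * sqrt C / s)"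
    using E0 C s by (intro real_le_lsqrt) auto
  then have "1 / H * sqrt (N * (B * (real q * (2 / U + 2 * (1 + L)\<^sup>2 / real q)))) \<le> 1 / H * (E * (2 * sqrt C / s))"
    using H0 by (intro mult_left_mono) auto
  also have "\<dots> = 204 * sqrt C / s * (1 / ln H)" using H0 by (simp add: E_def)
  also have "\<dots> \<le> 204 * sqrt C / s * (1 / (real (Suc j) / 2))"
    using lnH C s by (intro mult_left_mono divide_left_mono) (auto intro!: mult_pos_pos lnH0)
  also have "\<dots> = 408 * sqrt C / s * (1 / real (Suc j))" by simp
  finally show ?thesis unfolding H_def .
qed

text \<open>
A term of frequency \<open>k\<close> moves by \<open>O(k |\<alpha> - \<theta>|)\<close>, which the weight \<open>1/k\<close> makes independent of \<open>k\<close>.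
\<close>

lemma frequency_perturbation:
  fixes c :: "'i \<Rightarrow> complex" and k :: "'i \<Rightarrow> real" and \<alpha> \<theta> :: real
  assumes "\<And>i. i \<in> I \<Longrightarrow> k i > 0" "\<And>i. i \<in> I \<Longrightarrow> norm (c i) \<le> 1 / k i"
  shows "norm ((\<Sum>i\<in>I. c i * e (k i * \<alpha>)) - (\<Sum>i\<in>I. c i * e (k i * \<theta>))) \<le> real (card I) * (2 * pi * \<bar>\<alpha> - \<theta>\<bar>)"
proof -
  have "norm ((\<Sum>i\<in>I. c i * e (k i * \<alpha>)) - (\<Sum>i\<in>I. c i * e (k i * \<theta>))) =
      norm (\<Sum>i\<in>I. c i * (e (k i * \<alpha>) - e (k i * \<theta>)))"
    by (simp add: sum_subtractf right_diff_distrib)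
  also have "\<dots> \<le> (\<Sum>i\<in>I. 2 * pi * \<bar>\<alpha> - \<theta>\<bar>)"
  proof (rule sum_norm_le)
    fix i assume i: "i \<in> I"
    have k: "k i > 0" using assms(1)[OF i] .
    have "norm (c i * (e (k i * \<alpha>) - e (k i * \<theta>))) \<le> 1 / k i * (2 * pi * \<bar>k i * \<alpha> - k i * \<theta>\<bar>)"
      unfolding norm_mult using assms(2)[OF i] k by (intro mult_mono norm_e_diff_le) auto
    also have "\<bar>k i * \<alpha> - k i * \<theta>\<bar> = k i * \<bar>\<alpha> - \<theta>\<bar>"
      using k by (simp add: abs_mult flip: right_diff_distrib)
    also have "1 / k i * (2 * pi * (k i * \<bar>\<alpha> - \<theta>\<bar>)) = 2 * pi * \<bar>\<alpha> - \<theta>\<bar>" using k by simp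
    finally show "norm (c i * (e (k i * \<alpha>) - e (k i * \<theta>))) \<le> 2 * pi * \<bar>\<alpha> - \<theta>\<bar>" .
  qed
  finally show ?thesis by simp
qed

text \<open>
The pairs \<open>(p, m)\<close> fall into the main term, the edge \<open>p \<le> q^2\<close>, \<open>m \<le> M\<close>, and the bilinear part \<open>m > M\<close>.  In the
bilinear part the block bounds \<open>O(1/(s (j+1)))\<close> are summed over \<open>j = O(ln x)\<close>, and the harmonic sum
gives back the factor \<open>s = ln ln x\<close>.
\<close>

lemma large_prime_factor_part:
  fixes q :: nat and a :: int and f :: "nat \<Rightarrow> complex" and x C :: real
  defines "L \<equiv> ln x" and "s \<equiv> ln (ln x)" and "M \<equiv> ln (ln x) ^ 3"
  assumes x: "x \<ge> 2" and L: "L \<ge> 1" and s: "s \<ge> 1" and q: "real q \<ge> 2" "coprime a (int q)" "real q \<ge> 2 * M"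
    and LM: "(1 + L)\<^sup>2 * M \<le> real q" and Lq: "1 + L \<le> real q" and L3: "1 + ln (3 * L) \<le> 4 * s"
    and edge: "(1 + ln M) * ((2 * ln M + 1) * (102 / ln (real q))) \<le> 1"
    and C: "C > 0" "real q / real (totient q) \<le> C * s"
    and f: "multiplicative f" "\<And>n. n > 0 \<Longrightarrow> norm (f n) \<le> 1"
  defines "P \<equiv> {p. prime p \<and> real q powr (3/2) < real p \<and> real p \<le> x}"
  shows "norm ((\<Sum>n | (real q)\<^sup>2 < real n \<and> real n \<le> x.
           f n * of_bool (omega_in P n > 0) / of_nat n * e (real n * (a / q)))
         - (\<Sum>(m, p)\<in>Sigma {m. 1 \<le> m \<and> real m \<le> M} (\<lambda>m. {p. prime p \<and> (real q)\<^sup>2 < real p \<and> real p \<le> x / real m}).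
             f m / of_nat m * (f p / of_nat p) * e (real m * real p * (a / q)))) \<le> 9 + 1632 * sqrt C"
proof -
  define H0 where "H0 = real q powr (3/2)"
  define S where "S = {n. (real q)\<^sup>2 < real n \<and> real n \<le> x}"
  define g where "g m = f m / (1 + of_nat (omega_in P m))" for m
  define w where "w p m = f p / of_nat p * (g m / of_nat m) * e (real p * real m * (a / q))" for p m
  define T where "T = {(p, m). p \<in> P \<and> p * m \<in> S}"
  define Tbig where "Tbig = {(p, m). p \<in> P \<and> M < real m \<and> (real q)\<^sup>2 < real (p * m) \<and> real (p * m) \<le> x}"
  define Tmain where "Tmain = {(p, m). prime p \<and> (real q)\<^sup>2 < real p \<and> 1 \<le> m \<and> real m \<le> M \<and> real p \<le> x / real m}"
  define Tedge where "Tedge = {(p, m). p \<in> P \<and> real p \<le> (real q)\<^sup>2 \<and> real m \<le> M \<and> p * m \<in> S}"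
  have M1: "M \<ge> 1" unfolding M_def using s[unfolded s_def] by (rule one_le_power)
  have qH0: "real q \<le> H0"
  proof -
    have "real q powr 1 \<le> real q powr (3/2)" using q by (intro powr_mono) auto
    then show ?thesis using q by (simp add: H0_def)
  qed
  have H0q2: "H0 \<le> (real q)\<^sup>2"
  proof -
    have "real q powr (3/2) \<le> real q powr 2" using q by (intro powr_mono) auto
    then show ?thesis using q by (simp add: H0_def)
  qed
  have q2: "(real q)\<^sup>2 \<ge> 1" using q by (intro one_le_power) auto
  have finP: "finite P" unfolding P_def by (rule finite_primes_upto)
  have Pp: "prime p" "H0 < real p" "real p \<le> x" if "p \<in> P" for p using that by (auto simp: P_def H0_def)
  have P0: "0 \<notin> P" using Pp(1) by fastforce
  have finS: "finite S" unfolding S_def by (rule finite_nat_real_interval)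
  have finT: "finite T" unfolding T_def by (rule finite_factor_pairs[OF finP finS P0])
  have SD: "n \<in> S \<longleftrightarrow> (real q)\<^sup>2 < real n \<and> real n \<le> x" for n by (simp only: S_def mem_Collect_eq)
  have fp: "norm (f p) \<le> 1" if "prime p" for p using f(2) prime_gt_0_nat[OF that] by blast
  have gb: "norm (g m) \<le> 1 / (1 + real (omega_in P m))" if "m > 0" for m
    unfolding g_def using that by (intro norm_ramare_weight_le f(2))
  have "norm ((\<Sum>n\<in>S. f n * of_bool (omega_in P n > 0) / of_nat n * e (real n * (a / q))) - (\<Sum>(p, m)\<in>T. w p m))
      \<le> 4 / H0 * (1 + ln x)"
    unfolding T_def w_def g_def
  proof (rule ramare_sum)
    fix n assume "n \<in> S"
    then have n: "(real q)\<^sup>2 < real n" "real n \<le> x" using SD by auto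
    then have "real n > 1" using q2 by linarith
    then show "1 \<le> n \<and> real n \<le> x" using n by simp
  qed (use finP Pp q qH0 x finS f in auto)
  also have "\<dots> \<le> 4"
  proof -
    have "1 + ln x \<le> H0" using Lq qH0 by (simp add: L_def)
    then show ?thesis using qH0 q by (simp add: field_simps)
  qed
  finally have R: "norm ((\<Sum>n\<in>S. f n * of_bool (omega_in P n > 0) / of_nat n * e (real n * (a / q))) - (\<Sum>(p, m)\<in>T. w p m)) \<le> 4" .

  have big: "norm (\<Sum>(p, m)\<in>Tbig. w p m) \<le> 4 + 1632 * sqrt C"
  proof -
    define J where "J = nat \<lceil>2 * L\<rceil>"
    define Pj where "Pj j = {p \<in> P. H0 * 2 ^ j < real p \<and> real p \<le> H0 * 2 ^ Suc j}" for j
    \<comment> \<open>Hence the blocks starting at \<open>H0\<close> reach \<open>x\<close>.\<close>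
    have expx: "x \<le> 2 ^ J"
    proof -
      note ln2 = half_le_ln_2
      have "2 * L \<le> real J" unfolding J_def by (rule real_nat_ceiling_ge)
      then have "L \<le> real J * (1/2)" by simp
      also have "\<dots> \<le> real J * ln 2" using ln2 by (intro mult_left_mono) auto
      finally have "exp L \<le> exp (real J * ln 2)" by simp
      then show ?thesis using x by (simp add: exp_of_nat_mult L_def)
    qed
    have Hj: "H0 \<le> H0 * 2 ^ j" for j
    proof -
      have "H0 * 1 \<le> H0 * 2 ^ j" using q qH0 by (intro mult_left_mono) auto
      then show ?thesis by simp
    qed
    have Hj2: "2 \<le> H0 * 2 ^ j" for j using Hj[of j] q qH0 by linarith
    have Pjsub: "{p \<in> Pj j. p mod q = r} \<subseteq> {p. prime p \<and> H0 * 2 ^ j < real p \<and> real p \<le> 2 * (H0 * 2 ^ j) \<and> p mod q = r}"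
      "Pj j \<subseteq> {p. prime p \<and> H0 * 2 ^ j < real p \<and> real p \<le> 2 * (H0 * 2 ^ j)}" for j r
      using Pp(1) by (auto simp: Pj_def)
    have "norm (\<Sum>(p, m)\<in>Tbig. w p m) \<le> 4 + (\<Sum>j<J. 1 / (H0 * 2 ^ j) * sqrt (real (card (Pj j)) *
      ((102 * (H0 * 2 ^ j) / (real (totient q) * ln (H0 * 2 ^ j))) * (real q *
          (2 / max M ((real q)\<^sup>2 / (H0 * 2 ^ j)) + 2 * (1 + ln x)\<^sup>2 / real q)))))"
      (is "_ \<le> 4 + (\<Sum>j<J. ?t j)")
      unfolding Tbig_def Pj_def w_def
    proof (rule type_II_sum[OF _ q(2) finP Pp(1)])
      fix p assume p: "p \<in> P"
      have "real p \<le> 1 * 2 ^ J" using order.trans[OF Pp(3)[OF p] expx] by (simp only: mult_1)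
      also have "\<dots> \<le> H0 * 2 ^ J" using q qH0 by (intro mult_right_mono) auto
      finally show "H0 < real p \<and> real p \<le> H0 * 2 ^ J" using Pp(2)[OF p] by simp
      show "norm (f p) \<le> 1" using fp Pp(1)[OF p] by blast
    next
      fix j r
      have "real (card {p \<in> Pj j. p mod q = r}) \<le>
         real (card {p. prime p \<and> H0 * 2 ^ j < real p \<and> real p \<le> 2 * (H0 * 2 ^ j) \<and> p mod q = r})"
      proof (intro of_nat_mono card_mono Pjsub)
        show "finite {p. prime p \<and> H0 * 2 ^ j < real p \<and> real p \<le> 2 * (H0 * 2 ^ j) \<and> p mod q = r}"
          by (rule finite_subset[OF _ finite_primes_upto[of "\<lambda>_. True" "2 * (H0 * 2 ^ j)"]]) auto
      qed
      also have "\<dots> \<le> 102 * (H0 * 2 ^ j) / (real (totient q) * ln (H0 * 2 ^ j))"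
        using q Hj[of j] Hj2 by (intro brun_titchmarsh) (auto simp: H0_def)
      finally show "real (card {p \<in> {p \<in> P. H0 * 2 ^ j < real p \<and> real p \<le> H0 * 2 ^ Suc j}. p mod q = r})
        \<le> 102 * (H0 * 2 ^ j) / (real (totient q) * ln (H0 * 2 ^ j))" by (simp add: Pj_def)
    qed (use q qH0 gb M1 q2 x in auto)
    also have "(\<Sum>j<J. ?t j)
       \<le> (\<Sum>j<J. 408 * sqrt C / s * (1 / real (Suc j)))"
    proof (intro sum_mono)
      fix j
      have "real (card (Pj j)) \<le> real (card {p. prime p \<and> H0 * 2 ^ j < real p \<and> real p \<le> 2 * (H0 * 2 ^ j)})"
        by (intro of_nat_mono card_mono Pjsub finite_primes_upto)
      also have "\<dots> \<le> 102 * (H0 * 2 ^ j) / ln (H0 * 2 ^ j)" by (rule chebyshev_dyadic[OF Hj2])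
      finally have card: "real (card (Pj j)) \<le> 102 * (H0 * 2 ^ j) / ln (H0 * 2 ^ j)" .
      show "?t j \<le> 408 * sqrt C / s * (1 / real (Suc j))"
        by (rule large_prime_block_le[where M = M])
           (use q qH0 s LM C card in \<open>auto simp: M_def s_def L_def\<close>)
    qed
    also have "\<dots> = 408 * sqrt C / s * (\<Sum>j<J. 1 / real (Suc j))" by (simp only: sum_distrib_left)
    also have "\<dots> \<le> 408 * sqrt C / s * (4 * s)"
    proof (rule mult_left_mono)
      have J3: "real J \<le> 3 * L" unfolding J_def using L by linarith
      have "(\<Sum>j<J. 1 / real (Suc j)) = (\<Sum>m\<in>Suc ` {..<J}. 1 / real m)" by (simp add: sum.reindex)
      also have "\<dots> \<le> (\<Sum>m | 1 \<le> m \<and> real m \<le> 3 * L. 1 / real m)"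
      proof (rule sum_mono2)
        show "finite {m. 1 \<le> m \<and> real m \<le> 3 * L}" by (rule finite_nat_upto_real)
        show "Suc ` {..<J} \<subseteq> {m. 1 \<le> m \<and> real m \<le> 3 * L}" using J3 by auto
      qed auto
      also have "\<dots> \<le> 1 + ln (3 * L)" using L by (intro sum_reciprocal_le) auto
      also have "\<dots> \<le> 4 * s" by (rule L3)
      finally show "(\<Sum>j<J. 1 / real (Suc j)) \<le> 4 * s" .
    qed (use C s in auto)
    also have "408 * sqrt C / s * (4 * s) = 1632 * sqrt C" using s by simp
    finally show ?thesis by simp
  qed

  have edge_bound: "norm (\<Sum>(p, m)\<in>Tedge. w p m) \<le> 1"
  proof -
    define A where "A = {m. 1 \<le> m \<and> real m \<le> M}"
    define E where "E = {p. prime p \<and> (real q)\<^sup>2 / M < real p \<and> real p \<le> (real q)\<^sup>2}"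
    have finA: "finite A" unfolding A_def by (rule finite_nat_upto_real)
    have finE: "finite E" unfolding E_def by (rule finite_primes_upto)
    have sub: "(p, m) \<in> E \<times> A \<and> m > 0 \<and> prime p" if "(p, m) \<in> Tedge" for p m
    proof -
      have pm: "p \<in> P" "real p \<le> (real q)\<^sup>2" "real m \<le> M" "(real q)\<^sup>2 < real (p * m)"
        using that SD by (auto simp: Tedge_def simp del: of_nat_mult)
      have m0: "m > 0" using pm(4) by (cases m) auto
      have "real p * real m \<le> real p * M" using pm(3) by (intro mult_left_mono) auto
      then have "(real q)\<^sup>2 < real p * M" using pm(4) by simp
      then have "(real q)\<^sup>2 / M < real p" using M1 by (simp add: field_simps)
      then show ?thesis using pm m0 Pp(1) by (auto simp: E_def A_def)
    qed
    have "norm (\<Sum>(p, m)\<in>Tedge. w p m) \<le> (\<Sum>(p, m)\<in>Tedge. 1 / real p * (1 / real m))"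
    proof (rule sum_norm_le)
      fix z assume z: "z \<in> Tedge"
      obtain p m where pm: "z = (p, m)" by force
      have m: "m > 0" "prime p" using sub z pm by auto
      have "norm (g m) \<le> 1 / (1 + real (omega_in P m))" by (rule gb[OF m(1)])
      also have "\<dots> \<le> 1" by simp
      finally have "norm (f p) / real p * (norm (g m) / real m) \<le> 1 / real p * (1 / real m)"
        using fp[OF m(2)] by (intro mult_mono divide_right_mono) auto
      then show "norm (case z of (p, m) \<Rightarrow> w p m) \<le> (case z of (p, m) \<Rightarrow> 1 / real p * (1 / real m))"
        by (simp add: pm w_def norm_mult norm_divide)
    qed
    also have "\<dots> \<le> (\<Sum>(p, m)\<in>E \<times> A. 1 / real p * (1 / real m))"
      using sub finA finE by (intro sum_mono2) auto
    also have "\<dots> = (\<Sum>p\<in>E. 1 / real p) * (\<Sum>m\<in>A. 1 / real m)"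
      by (subst sum_product) (simp only: sum.cartesian_product)
    also have "\<dots> \<le> ((2 * ln M + 1) * (102 / ln (real q))) * (1 + ln M)"
    proof (intro mult_mono)
      have "2 * M * real q \<le> real q * real q" using q by (intro mult_right_mono) auto
      then show "(\<Sum>p\<in>E. 1 / real p) \<le> (2 * ln M + 1) * (102 / ln (real q))"
        unfolding E_def using M1 q by (intro sum_reciprocal_primes_short_range) (auto simp: power2_eq_square)
      show "(\<Sum>m\<in>A. 1 / real m) \<le> 1 + ln M" unfolding A_def by (rule sum_reciprocal_le[OF M1])
    qed (use M1 q in \<open>auto intro!: sum_nonneg\<close>)
    also have "\<dots> \<le> 1" using edge by (simp only: mult.commute)
    finally show ?thesis .
  qed

  have main: "(\<Sum>(p, m)\<in>Tmain. w p m) =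
     (\<Sum>(m, p)\<in>Sigma {m. 1 \<le> m \<and> real m \<le> M} (\<lambda>m. {p. prime p \<and> (real q)\<^sup>2 < real p \<and> real p \<le> x / real m}).
             f m / of_nat m * (f p / of_nat p) * e (real m * real p * (a / q)))"
  proof (rule sum.reindex_bij_witness[of _ prod.swap prod.swap])
    fix z assume z: "z \<in> Tmain"
    obtain p m where pm: "z = (p, m)" by force
    have m: "1 \<le> m" "real m \<le> M" using z pm by (auto simp: Tmain_def)
    \<comment> \<open>The primes in \<open>P\<close> exceed \<open>M \<ge> m\<close>, so the weight of \<open>m\<close> is 1.\<close>
    have "omega_in P m = 0"
    proof -
      have "\<not> p dvd m" if "p \<in> P" for p
      proof
        assume "p dvd m"
        then have "real p \<le> real m" using m by (auto dest: dvd_imp_le)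
        moreover have "M \<le> H0" using q qH0 M1 by linarith
        ultimately show False using Pp(2)[OF that] m by linarith
      qed
      then have "{p \<in> P. p dvd m} = {}" by blast
      then show ?thesis unfolding omega_in_def by (simp only: card.empty)
    qed
    then have "g m = f m" by (simp add: g_def)
    then show "(case prod.swap z of (m, p) \<Rightarrow> f m / of_nat m * (f p / of_nat p) * e (real m * real p * (a / q))) =
       (case z of (p, m) \<Rightarrow> w p m)"
      by (simp add: pm w_def mult_ac)
  qed (auto simp: Tmain_def)

  have split: "(\<Sum>(p, m)\<in>T. w p m) = (\<Sum>(p, m)\<in>Tmain. w p m) + ((\<Sum>(p, m)\<in>Tedge. w p m) + (\<Sum>(p, m)\<in>Tbig. w p m))"
  proof -
    have mainT: "Tmain = {(p, m). p \<in> P \<and> p * m \<in> S \<and> real m \<le> M \<and> (real q)\<^sup>2 < real p}"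
    proof -
      have "(prime p \<and> (real q)\<^sup>2 < real p \<and> 1 \<le> m \<and> real m \<le> M \<and> real p \<le> x / real m) \<longleftrightarrow>
          (p \<in> P \<and> p * m \<in> S \<and> real m \<le> M \<and> (real q)\<^sup>2 < real p)" for p m
      proof
        assume h: "prime p \<and> (real q)\<^sup>2 < real p \<and> 1 \<le> m \<and> real m \<le> M \<and> real p \<le> x / real m"
        then have hp: "prime p" "(real q)\<^sup>2 < real p" "1 \<le> m" "real m \<le> M" "real p \<le> x / real m" by blast+
        have pmx: "real p * real m \<le> x" using hp(3,5) by (simp add: pos_le_divide_eq)
        have "real p * 1 \<le> real p * real m" using hp(3) by (intro mult_left_mono) auto
        then have px: "real p \<le> x" "(real q)\<^sup>2 < real p * real m" using hp(2) pmx by linarith+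
        have "real q powr (3/2) < real p" using hp(2) H0q2 unfolding H0_def by linarith
        then have "p \<in> P" using hp(1) px(1) unfolding P_def by blast
        moreover have "p * m \<in> S" unfolding SD of_nat_mult using px(2) pmx by blast
        ultimately show "p \<in> P \<and> p * m \<in> S \<and> real m \<le> M \<and> (real q)\<^sup>2 < real p" using hp by blast
      next
        assume h: "p \<in> P \<and> p * m \<in> S \<and> real m \<le> M \<and> (real q)\<^sup>2 < real p"
        then have pm: "(real q)\<^sup>2 < real (p * m)" "real (p * m) \<le> x" using SD by auto
        then have m0: "m > 0" by (cases m) auto
        then have "real p \<le> x / real m" using pm(2) by (simp add: pos_le_divide_eq)
        then show "prime p \<and> (real q)\<^sup>2 < real p \<and> 1 \<le> m \<and> real m \<le> M \<and> real p \<le> x / real m"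
          using h m0 Pp(1) by (simp add: Suc_le_eq)
      qed
      then show ?thesis unfolding Tmain_def by (simp only:)
    qed
    have flip: "real p \<le> (real q)\<^sup>2 \<longleftrightarrow> \<not> (real q)\<^sup>2 < real p" "M < real m \<longleftrightarrow> \<not> real m \<le> M" for p m :: nat
      by (simp_all only: not_less not_le)
    have T: "T = Tmain \<union> (Tedge \<union> Tbig)"
      unfolding T_def mainT Tedge_def Tbig_def flip SD by blast
    moreover have "Tmain \<inter> (Tedge \<union> Tbig) = {}" "Tedge \<inter> Tbig = {}"
      unfolding mainT Tedge_def Tbig_def flip by blast+
    moreover have "finite Tmain" "finite (Tedge \<union> Tbig)" "finite Tedge" "finite Tbig"
      using finT unfolding T finite_Un by blast+
    ultimately show ?thesis by (simp only: sum.union_disjoint)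
  qed
  have "norm ((\<Sum>n\<in>S. f n * of_bool (omega_in P n > 0) / of_nat n * e (real n * (a / q))) - (\<Sum>(p, m)\<in>Tmain. w p m))
     = norm (((\<Sum>n\<in>S. f n * of_bool (omega_in P n > 0) / of_nat n * e (real n * (a / q))) - (\<Sum>(p, m)\<in>T. w p m))
         + ((\<Sum>(p, m)\<in>Tedge. w p m) + (\<Sum>(p, m)\<in>Tbig. w p m)))"
    unfolding split by (simp add: algebra_simps)
  also have "\<dots> \<le> 4 + (1 + (4 + 1632 * sqrt C))"
    by (intro norm_triangle_mono R edge_bound big)
  finally show ?thesis unfolding main S_def by simp
qed

section \<open>The theorem\<close>

text \<open>
All size conditions on \<open>x\<close> at once; the constant \<open>l0\<close> is the threshold for \<open>ln q\<close> from the smooth part.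
\<close>

definition large_enough :: "real \<Rightarrow> real \<Rightarrow> real \<Rightarrow> bool" where
  "large_enough \<epsilon> l0 x \<longleftrightarrow>
     x \<ge> 2 \<and> ln x \<ge> 2 \<and> ln (ln x) \<ge> 1 \<and> 2 \<le> ln x powr (2 + \<epsilon>) \<and> exp l0 \<le> ln x powr (2 + \<epsilon>) \<and>
     2 * ln (ln x) ^ 3 \<le> ln x powr (2 + \<epsilon>) \<and> (1 + ln x)\<^sup>2 * ln (ln x) ^ 3 \<le> ln x powr (2 + \<epsilon>) \<and>
     1 + ln x \<le> ln x powr (2 + \<epsilon>) \<and> 1 + ln (3 * ln x) \<le> 4 * ln (ln x) \<and>
     (1 + ln (ln (ln x) ^ 3)) * ((2 * ln (ln (ln x) ^ 3) + 1) * (102 / (2 * ln (ln x)))) \<le> 1"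

lemma eventually_large_enough:
  assumes "\<epsilon> > 0"
  shows "eventually (large_enough \<epsilon> l0) at_top"
  unfolding large_enough_def using assms by (intro eventually_conj; real_asymp)

text \<open>
An \<open>n \<le> x\<close> is smooth exactly when \<open>\<omega>(n) = 0\<close>.
\<close>

lemma split_by_large_prime_factor:
  fixes f :: "nat \<Rightarrow> complex" and q :: nat and x \<theta> :: real
  assumes q: "q > 0"
  defines "P \<equiv> {p. prime p \<and> real q powr (3/2) < real p \<and> real p \<le> x}"
  shows "(\<Sum>n | (real q)\<^sup>2 < real n \<and> real n \<le> x. f n / of_nat n * e (real n * \<theta>)) =
     (\<Sum>n | (real q)\<^sup>2 < real n \<and> real n \<le> x. f n * of_bool (omega_in P n > 0) / of_nat n * e (real n * \<theta>)) +
     (\<Sum>n | (real q)\<^sup>2 < real n \<and> real n \<le> x \<and> (\<forall>p\<in>prime_factors n. real p \<le> real q powr (3/2)).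
         f n / of_nat n * e (real n * \<theta>))"
proof -
  define S where "S = {n. (real q)\<^sup>2 < real n \<and> real n \<le> x}"
  define t where "t n = f n / of_nat n * e (real n * \<theta>)" for n
  have finS: "finite S" unfolding S_def by (rule finite_nat_real_interval)
  have finP: "finite P" unfolding P_def by (rule finite_primes_upto)
  have smooth: "(\<forall>p\<in>prime_factors n. real p \<le> real q powr (3/2)) \<longleftrightarrow> \<not> omega_in P n > 0" if n: "n \<in> S" for n
  proof -
    have nx: "(real q)\<^sup>2 < real n" "real n \<le> x" using n unfolding S_def by blast+
    then have n0: "n > 0" by (cases n) auto
    have px: "real p \<le> x" if "p dvd n" for p
      using dvd_imp_le[OF that n0] nx(2) by linarith
    have pf: "p \<in> prime_factors n \<longleftrightarrow> prime p \<and> p dvd n" for p using n0 by (auto simp: in_prime_factors_iff)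
    have "(\<forall>p\<in>prime_factors n. real p \<le> real q powr (3/2)) \<longleftrightarrow> \<not> (\<exists>p. prime p \<and> p dvd n \<and> real q powr (3/2) < real p)"
      unfolding Ball_def pf not_less[symmetric] by blast
    also have "\<dots> \<longleftrightarrow> \<not> (\<exists>p\<in>P. p dvd n)" unfolding P_def Bex_def mem_Collect_eq using px by blast
    finally show ?thesis by (simp only: omega_in_pos_iff[OF finP])
  qed
  have "(\<Sum>n\<in>S. t n) = (\<Sum>n\<in>S. t n * of_bool (omega_in P n > 0) + t n * of_bool (\<not> omega_in P n > 0))"
    by (intro sum.cong refl) (simp add: of_bool_def)
  also have "\<dots> = (\<Sum>n\<in>S. t n * of_bool (omega_in P n > 0)) + (\<Sum>n\<in>S. t n * of_bool (\<not> omega_in P n > 0))"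
    by (rule sum.distrib)
  also have "(\<Sum>n\<in>S. t n * of_bool (\<not> omega_in P n > 0)) = (\<Sum>n | n \<in> S \<and> (\<forall>p\<in>prime_factors n. real p \<le> real q powr (3/2)). t n)"
  proof (rule sum.mono_neutral_cong_right[OF finS])
    show "\<forall>n\<in>S - {n. n \<in> S \<and> (\<forall>p\<in>prime_factors n. real p \<le> real q powr (3/2))}. t n * of_bool (\<not> omega_in P n > 0) = 0"
    proof
      fix n assume "n \<in> S - {n. n \<in> S \<and> (\<forall>p\<in>prime_factors n. real p \<le> real q powr (3/2))}"
      then have "omega_in P n > 0" using smooth by blast
      then show "t n * of_bool (\<not> omega_in P n > 0) = 0" by simp
    qed
    fix n assume "n \<in> {n. n \<in> S \<and> (\<forall>p\<in>prime_factors n. real p \<le> real q powr (3/2))}"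
    then have "\<not> omega_in P n > 0" using smooth by blast
    then show "t n * of_bool (\<not> omega_in P n > 0) = t n" by simp
  qed blast
  also have "{n. n \<in> S \<and> (\<forall>p\<in>prime_factors n. real p \<le> real q powr (3/2))} =
      {n. (real q)\<^sup>2 < real n \<and> real n \<le> x \<and> (\<forall>p\<in>prime_factors n. real p \<le> real q powr (3/2))}"
    unfolding S_def by blast
  also have "(\<Sum>n\<in>S. t n * of_bool (omega_in P n > 0)) = (\<Sum>n\<in>S. f n * of_bool (omega_in P n > 0) / of_nat n * e (real n * \<theta>))"
    by (intro sum.cong refl) (simp add: t_def)
  finally show ?thesis unfolding S_def t_def .
qed

theorem theorem1p3:
  fixes \<epsilon> :: real
  assumes "0 < \<epsilon>" and "\<epsilon> < 1 / 10"
  shows "\<exists>C x0 :: real. \<forall>x \<ge> x0. \<forall>\<alpha> \<in> {0..<1::real}. \<forall>(a::int) (q::int).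
     coprime a q \<longrightarrow>
     \<bar>\<alpha> - of_int a / of_int q\<bar> \<le> 1 / (of_int q * x) \<longrightarrow>
     (ln x) powr (2 + \<epsilon>) \<le> of_int q \<longrightarrow>
     of_int q \<le> x / (ln x) powr (2 + \<epsilon>) \<longrightarrow>
     of_int q \<le> x powr (1 / 2 - \<epsilon>) \<longrightarrow>
     (\<forall>f :: nat \<Rightarrow> complex. multiplicative f \<longrightarrow> f \<in> {1..} \<rightarrow> unit_disc \<longrightarrow>
       norm
         ((\<Sum>n | (of_int q)\<^sup>2 < real n \<and> real n \<le> x.
             f n / of_nat n * e (real n * \<alpha>))
          - (\<Sum>m | 1 \<le> m \<and> real m \<le> (ln (ln x)) ^ 3.
               f m / of_nat m *
               (\<Sum>p | prime p \<and> (of_int q)\<^sup>2 < real p \<and> real p \<le> x / real m.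
                  f p / of_nat p * e (real m * real p * \<alpha>))))
       \<le> C)"
proof -
  obtain C1 l0 where C1: "\<forall>q::nat. \<forall>a::int. \<forall>x. \<forall>f. q > 0 \<longrightarrow> l0 \<le> ln (real q) \<longrightarrow> coprime a (int q) \<longrightarrow> multiplicative f
     \<longrightarrow> (\<forall>n>0. norm (f n) \<le> 1) \<longrightarrow>
     norm (\<Sum>n | (real q)\<^sup>2 < real n \<and> real n \<le> x \<and> (\<forall>p\<in>prime_factors n. real p \<le> real q powr (3/2)).
         f n / of_nat n * e (real n * (a / q))) \<le> C1"
    using smooth_part_bounded by blast
  obtain C2 where C2: "C2 > 0" "\<forall>z\<ge>2. \<forall>q::nat. q > 0 \<longrightarrow> ln (real q) \<le> z \<longrightarrow> real q / real (totient q) \<le> C2 * ln z"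
    using totient_ratio_bound by blast
  obtain x0 where x0: "\<And>x. x0 \<le> x \<Longrightarrow> large_enough \<epsilon> l0 x"
    using eventually_large_enough[OF assms(1), of l0] unfolding eventually_at_top_linorder by blast
  show ?thesis
  proof (rule exI[of _ "2 * pi + (2 * pi + ((9 + 1632 * sqrt C2) + C1))"], rule exI[of _ x0], intro allI ballI impI)
    fix x \<alpha> :: real and a q' :: int and f :: "nat \<Rightarrow> complex"
    assume xx: "x0 \<le> x" and cop: "coprime a q'" and approx: "\<bar>\<alpha> - of_int a / of_int q'\<bar> \<le> 1 / (of_int q' * x)"
      and qge: "(ln x) powr (2 + \<epsilon>) \<le> of_int q'" and qle: "of_int q' \<le> x powr (1 / 2 - \<epsilon>)"
      and f: "multiplicative f" and fdisc: "f \<in> {1..} \<rightarrow> unit_disc"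
    define L where "L = ln x"
    define s where "s = ln (ln x)"
    define M where "M = ln (ln x) ^ 3"
    have X: "x \<ge> 2" "L \<ge> 2" "s \<ge> 1" "2 \<le> L powr (2 + \<epsilon>) \<and> exp l0 \<le> L powr (2 + \<epsilon>)" "2 * M \<le> L powr (2 + \<epsilon>)"
      "(1 + L)\<^sup>2 * M \<le> L powr (2 + \<epsilon>)" "1 + L \<le> L powr (2 + \<epsilon>)" "1 + ln (3 * L) \<le> 4 * s"
      "(1 + ln M) * ((2 * ln M + 1) * (102 / (2 * s))) \<le> 1"
      using x0[OF xx] unfolding large_enough_def L_def s_def M_def by blast+
    have M1: "M \<ge> 1" using X(3) unfolding M_def s_def by (rule one_le_power)
    have q'2: "real_of_int q' \<ge> 2" using X(4) qge unfolding L_def by linarith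
    define q where "q = nat q'"
    have qq: "real_of_int q' = real q" "q' = int q" using q'2 by (auto simp: q_def)
    define \<theta> where "\<theta> = real_of_int a / real q"
    have q2: "real q \<ge> 2" using q'2 qq by simp
    have q0: "q > 0" using q2 by (auto intro: gr0I)
    have cop': "coprime a (int q)" using cop qq by simp
    have Lq: "L powr (2 + \<epsilon>) \<le> real q" using qge qq by (simp add: L_def)
    have fb: "norm (f n) \<le> 1" if "n > 0" for n
      using fdisc that by (auto simp: unit_disc_def Pi_def Suc_le_eq)
    have qx: "real q \<le> x"
    proof -
      have "x powr (1/2 - \<epsilon>) \<le> x powr 1" using X(1) assms by (intro powr_mono) auto
      then show ?thesis using qle qq X(1) by simp
    qed
    have lnq: "ln (real q) \<le> L" unfolding L_def using qx q2 by (subst ln_le_cancel_iff) auto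
    have lnq2: "2 * s \<le> ln (real q)"
    proof -
      have "2 * s \<le> (2 + \<epsilon>) * s" using X(3) assms(1) by (intro mult_right_mono) auto
      also have "\<dots> = ln (L powr (2 + \<epsilon>))" using X(2) by (simp add: ln_powr s_def L_def)
      also have "\<dots> \<le> ln (real q)" using Lq q2 X(2) by (subst ln_le_cancel_iff) auto
      finally show ?thesis .
    qed
    have l0q: "l0 \<le> ln (real q)"
    proof -
      have "exp l0 \<le> real q" using X(4) Lq by simp
      then show ?thesis using q2 by (subst ln_ge_iff) auto
    qed
    have tot: "real q / real (totient q) \<le> C2 * s"
      using C2(2)[rule_format, OF X(2) q0 lnq] by (simp add: s_def L_def)
    have dist: "\<bar>\<alpha> - \<theta>\<bar> \<le> 1 / (real q * x)" using approx qq by (simp add: \<theta>_def)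

    define S where "S = {n. (real q)\<^sup>2 < real n \<and> real n \<le> x}"
    define I where "I = Sigma {m. 1 \<le> m \<and> real m \<le> M} (\<lambda>m. {p. prime p \<and> (real q)\<^sup>2 < real p \<and> real p \<le> x / real m})"
    define A where "A \<beta> = (\<Sum>n\<in>S. f n / of_nat n * e (real n * \<beta>))" for \<beta>
    define D where "D \<beta> = (\<Sum>(m, p)\<in>I. f m / of_nat m * (f p / of_nat p) * e (real m * real p * \<beta>))" for \<beta>
    have cardle: "real (card {m. 1 \<le> m \<and> real m \<le> y}) \<le> y" if "y \<ge> 0" for y
    proof -
      have "card {m. 1 \<le> m \<and> real m \<le> y} \<le> card {1..nat \<lfloor>y\<rfloor>}"
        by (intro card_mono) (auto simp: le_nat_floor)
      also have "\<dots> = nat \<lfloor>y\<rfloor>" by simp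
      finally have "real (card {m. 1 \<le> m \<and> real m \<le> y}) \<le> real (nat \<lfloor>y\<rfloor>)" by simp
      also have "\<dots> \<le> y" using that by simp
      finally show ?thesis .
    qed
    have S1: "n > 0 \<and> real n \<le> x" if "n \<in> S" for n
    proof -
      have "(real q)\<^sup>2 < real n" "real n \<le> x" using that unfolding S_def by blast+
      then show ?thesis by (cases n) auto
    qed
    \<comment> \<open>There are at most \<open>x\<close> terms.\<close>
    have dA: "norm (A \<alpha> - A \<theta>) \<le> 2 * pi"
    proof -
      have "norm (A \<alpha> - A \<theta>) \<le> real (card S) * (2 * pi * \<bar>\<alpha> - \<theta>\<bar>)"
        unfolding A_def using S1 fb
        by (intro frequency_perturbation) (auto simp: norm_divide divide_right_mono)
      also have "\<dots> \<le> x * (2 * pi * (1 / (real q * x)))"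
      proof (intro mult_mono)
        have "card S \<le> card {m. 1 \<le> m \<and> real m \<le> x}"
          using S1 by (intro card_mono finite_nat_upto_real) (auto simp: Suc_le_eq)
        then show "real (card S) \<le> x" using cardle[of x] X(1) by linarith
      qed (use dist X(1) in auto)
      also have "\<dots> = 2 * pi / real q" using X(1) by simp
      also have "\<dots> \<le> 2 * pi / 1" using q2 by (intro divide_left_mono) auto
      finally show ?thesis by simp
    qed
    \<comment> \<open>There are at most \<open>M x\<close> pairs, and \<open>M \<le> q\<close>.\<close>
    have dD: "norm (D \<alpha> - D \<theta>) \<le> 2 * pi"
    proof -
      have finp: "finite {p. prime p \<and> (real q)\<^sup>2 < real p \<and> real p \<le> y}" for y by (rule finite_primes_upto)
      have "card I = (\<Sum>m | 1 \<le> m \<and> real m \<le> M. card {p. prime p \<and> (real q)\<^sup>2 < real p \<and> real p \<le> x / real m})"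
        unfolding I_def using finite_nat_upto_real finp by (intro card_SigmaI) auto
      then have "real (card I) = (\<Sum>m | 1 \<le> m \<and> real m \<le> M. real (card {p. prime p \<and> (real q)\<^sup>2 < real p \<and> real p \<le> x / real m}))"
        by simp
      also have "\<dots> \<le> (\<Sum>m | 1 \<le> m \<and> real m \<le> M. x)"
      proof (intro sum_mono)
        fix m assume m: "m \<in> {m. 1 \<le> m \<and> real m \<le> M}"
        have "x / real m \<le> x / 1" using m X(1) by (intro divide_left_mono) auto
        then have "card {p. prime p \<and> (real q)\<^sup>2 < real p \<and> real p \<le> x / real m} \<le> card {m. 1 \<le> m \<and> real m \<le> x}"
          by (intro card_mono finite_nat_upto_real) (auto simp: Suc_le_eq prime_gt_0_nat)
        then show "real (card {p. prime p \<and> (real q)\<^sup>2 < real p \<and> real p \<le> x / real m}) \<le> x"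
          using cardle[of x] X(1) by linarith
      qed
      also have "\<dots> = real (card {m. 1 \<le> m \<and> real m \<le> M}) * x" by simp
      also have "\<dots> \<le> M * x" using cardle[of M] M1 X(1) by (intro mult_right_mono) auto
      finally have cardI: "real (card I) \<le> M * x" .
      have "norm (D \<alpha> - D \<theta>) \<le> real (card I) * (2 * pi * \<bar>\<alpha> - \<theta>\<bar>)"
      proof -
        have "norm ((\<Sum>z\<in>I. (case z of (m, p) \<Rightarrow> f m / of_nat m * (f p / of_nat p)) * e ((case z of (m, p) \<Rightarrow> real m * real p) * \<alpha>))
            - (\<Sum>z\<in>I. (case z of (m, p) \<Rightarrow> f m / of_nat m * (f p / of_nat p)) * e ((case z of (m, p) \<Rightarrow> real m * real p) * \<theta>)))
           \<le> real (card I) * (2 * pi * \<bar>\<alpha> - \<theta>\<bar>)"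
        proof (rule frequency_perturbation)
          fix z assume z: "z \<in> I"
          obtain m p where mp: "z = (m, p)" by force
          have pos: "m > 0" "p > 0" using z mp by (auto simp: I_def prime_gt_0_nat)
          then show "(case z of (m, p) \<Rightarrow> real m * real p) > 0" by (simp add: mp)
          have "norm (f m) * norm (f p) \<le> 1 * 1" using fb pos by (intro mult_mono) auto
          then show "norm (case z of (m, p) \<Rightarrow> f m / of_nat m * (f p / of_nat p)) \<le> 1 / (case z of (m, p) \<Rightarrow> real m * real p)"
            by (simp add: mp norm_mult norm_divide divide_right_mono)
        qed
        then show ?thesis unfolding D_def by (simp add: case_prod_beta)
      qed
      also have "\<dots> \<le> (M * x) * (2 * pi * (1 / (real q * x)))"
        using cardI dist X(1) M1 by (intro mult_mono) auto
      also have "\<dots> = 2 * pi * (M / real q)" using X(1) by simp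
      also have "\<dots> \<le> 2 * pi * 1"
        using X(5) Lq M1 q2 by (intro mult_left_mono) auto
      finally show ?thesis by simp
    qed

    define P where "P = {p. prime p \<and> real q powr (3/2) < real p \<and> real p \<le> x}"
    define A1 where "A1 = (\<Sum>n\<in>S. f n * of_bool (omega_in P n > 0) / of_nat n * e (real n * \<theta>))"
    define A2 where "A2 = (\<Sum>n | (real q)\<^sup>2 < real n \<and> real n \<le> x \<and> (\<forall>p\<in>prime_factors n. real p \<le> real q powr (3/2)).
         f n / of_nat n * e (real n * \<theta>))"
    have A12: "A \<theta> = A1 + A2"
      unfolding A_def A1_def A2_def S_def P_def by (rule split_by_large_prime_factor[OF q0])
    have bA2: "norm A2 \<le> C1"
      unfolding A2_def \<theta>_def using C1 q0 l0q cop' f fb by blast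
    have bA1: "norm (A1 - D \<theta>) \<le> 9 + 1632 * sqrt C2"
      unfolding A1_def D_def I_def S_def P_def \<theta>_def M_def
    proof (rule large_prime_factor_part)
      show "(1 + ln (ln (ln x) ^ 3)) * ((2 * ln (ln (ln x) ^ 3) + 1) * (102 / ln (real q))) \<le> 1"
      proof -
        have lM: "ln M \<ge> 0" using M1 by simp
        have "(1 + ln M) * ((2 * ln M + 1) * (102 / ln (real q))) \<le> (1 + ln M) * ((2 * ln M + 1) * (102 / (2 * s)))"
          using lM lnq2 X(3) by (intro mult_left_mono divide_left_mono) auto
        then show ?thesis using X(9) by (simp add: M_def)
      qed
    qed (use X Lq q2 cop' C2(1) tot f fb in \<open>auto simp: L_def s_def M_def\<close>)
    have "norm (A \<alpha> - D \<alpha>) = norm ((A \<alpha> - A \<theta>) + ((D \<theta> - D \<alpha>) + ((A1 - D \<theta>) + A2)))"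
      unfolding A12 by (simp add: algebra_simps)
    also have "\<dots> \<le> 2 * pi + (2 * pi + ((9 + 1632 * sqrt C2) + C1))"
      using dD by (intro norm_triangle_mono dA bA1 bA2) (simp add: norm_minus_commute)
    finally have final: "norm (A \<alpha> - D \<alpha>) \<le> 2 * pi + (2 * pi + ((9 + 1632 * sqrt C2) + C1))" .
    have "D \<alpha> = (\<Sum>m | 1 \<le> m \<and> real m \<le> (ln (ln x)) ^ 3.
               f m / of_nat m *
               (\<Sum>p | prime p \<and> (of_int q')\<^sup>2 < real p \<and> real p \<le> x / real m.
                  f p / of_nat p * e (real m * real p * \<alpha>)))"
    proof -
      have "D \<alpha> = (\<Sum>m | 1 \<le> m \<and> real m \<le> M. \<Sum>p | prime p \<and> (real q)\<^sup>2 < real p \<and> real p \<le> x / real m.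
          f m / of_nat m * (f p / of_nat p) * e (real m * real p * \<alpha>))"
        unfolding D_def I_def by (rule sum.Sigma[symmetric]) (use finite_nat_upto_real finite_primes_upto in auto)
      then show ?thesis unfolding qq(1) M_def by (simp only: sum_distrib_left mult.assoc)
    qed
    then show "norm
         ((\<Sum>n | (of_int q')\<^sup>2 < real n \<and> real n \<le> x.
             f n / of_nat n * e (real n * \<alpha>))
          - (\<Sum>m | 1 \<le> m \<and> real m \<le> (ln (ln x)) ^ 3.
               f m / of_nat m *
               (\<Sum>p | prime p \<and> (of_int q')\<^sup>2 < real p \<and> real p \<le> x / real m.
                  f p / of_nat p * e (real m * real p * \<alpha>))))
       \<le> 2 * pi + (2 * pi + ((9 + 1632 * sqrt C2) + C1))"
      using final unfolding A_def S_def qq(1) by (simp only:)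
  qed
qed

end
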